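(* Let $\mathcal X$ be a regular lattice with set of compact elements $\mathcal K$, let $\alpha=\max\mathcal X$, and assume $\alpha\notin\mathcal K$. Let $\mathbf Z=\{Z_\lambda\mid\lambda\in\mathcal X\}$ be a restricted inverse system of fibrations indexed by $\mathcal X$ such that $Z_\kappa$ has the homotopy type of a CW complex for each $\kappa\in\mathcal K$. Let $Z=Z_\alpha=\lim_{\lambda\in\mathcal X}Z_\lambda=\lim_{\kappa\in\mathcal K}Z_\kappa$, let $C$ be a path component of $Z$, let $\zeta\in C$, and for $\lambda\in\mathcal X$ let $C_\lambda$ and $\zeta_\lambda$ denote the images of $C$ and $\zeta$ under $Z\to Z_\lambda$. Assume that $C$ has the homotopy type of a CW complex. Then for every $\kappa\in\mathcal K$ there exists $\lambda'\in\mathcal K$ such that for all $k\geqslant 1$ and all $\mu\in\mathcal X$ with $\mu\geqslant\lambda'$ the image of $$\pi_k(C_\mu,\zeta_\mu)\to\pi_k(C_\kappa,\zeta_\kappa)$$ equals the image of $$( * )\qquad \pi_k(C,\zeta)\to\pi_k(C_\kappa,\zeta_\kappa).$$ Moreover, for all large enough $\kappa\in\mathcal K$ the morphism $( * )$ is injective for all $k\geqslant 1$. In particular, the inverse systems of groups $\{\pi_k(C_\lambda,\zeta_\lambda)\mid\lambda\in\mathcal K\}$ satisfy the Mittag-Leffler condition uniformly with respect to $k\geqslant 1$. If $C$ is open in $Z$ then for all large enough $\kappa\in\mathcal K$ the preimage of $C_\kappa$ under $Z\to Z_\kappa$ equals $C$; consequently $\mathrm{Ph}(C)=\{C\}$.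 If $\mathcal X$ is $\mathcal K$-countable, then $\mathrm{Ph}(C)=\{C\}$ regardless of whether $C$ is open or not.
   Context: All spaces are Hausdorff. A fibration is a Hurewicz fibration (not necessarily surjective). Let $(\mathcal X,\leqslant)$ be a complete lattice. An element $\kappa\in\mathcal X$ is compact if $\kappa\leqslant\sup\Lambda$ with $\Lambda\subset\mathcal X$ implies $\kappa\leqslant\sup F$ for some finite $F\subset\Lambda$; $\mathcal K$ denotes the set of compact elements. $\mathcal X$ is a regular lattice if it is distributive, every element is the supremum of a set of compact elements, and $\mathcal K$ is an ideal (for $\kappa,\kappa'\in\mathcal K$, $\xi\in\mathcal X$ also $\kappa\vee\kappa'\in\mathcal K$ and $\kappa\wedge\xi\in\mathcal K$). $\mathcal X$ is $\mathcal K$-countable if $\max\mathcal X$ is the supremum of a countable subset of $\mathcal K$. An inverse system indexed by $\mathcal X$ assigns a space $Z_\lambda$ to each $\lambda\in\mathcal X$ and functorially a bonding map $Z_\mu\to Z_\lambda$ whenever $\lambda\leqslant\mu$; it is a system of fibrations if all bonding maps are fibrations. It is restricted if for each directed subset $\mathcal L\subset\mathcal X$ with $\mu=\sup\mathcal L$ the induced map $Z_\mu\to\lim_{\lambda\in\mathcal L}Z_\lambda$ is a homeomorphism. The phrase "for all large enough $\kappa\in\mathcal K$" means: there is $\kappa_0\in\mathcal K$ such that the assertion holds for all $\kappa\in\mathcal K$ with $\kappa\geqslant\kappa_0$. An inverse system of groups $\{G_\lambda\}$ over a directed set satisfies the Mittag-Leffler condition if for each $\lambda$ there is $\mu\geqslant\lambda$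 such that for each $\nu\geqslant\mu$ the images of $G_\nu\to G_\lambda$ and $G_\mu\to G_\lambda$ coincide; "uniformly with respect to $k$" means that $\mu$ can be chosen independently of $k$. Two path components $C,D$ of $Z$ form a phantom pair if their images under $Z\to Z_\kappa$ coincide for each $\kappa\in\mathcal K$; $\mathrm{Ph}(C)$ denotes the set of all path components $D$ of $Z$ such that $C,D$ form a phantom pair. *)

theory Defs
  imports "HOL-Analysis.Analysis" "HOL-Algebra.Group"
begin

section \<open>Regular lattices\<close>

definition compact_elements :: "'x::complete_lattice set" where
  "compact_elements =
     {\<kappa>. \<forall>\<Lambda>. \<kappa> \<le> Sup \<Lambda> \<longrightarrow> (\<exists>F\<subseteq>\<Lambda>. finite F \<and> \<kappa> \<le> Sup F)}"

definition regular_lattice :: "'x::complete_lattice itself \<Rightarrow> bool" where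
  "regular_lattice _ \<longleftrightarrow>
     (\<forall>x y z :: 'x. inf x (sup y z) = sup (inf x y) (inf x z)) \<and>
     (\<forall>x :: 'x. \<exists>\<Lambda>\<subseteq>compact_elements. x = Sup \<Lambda>) \<and>
     (\<forall>\<kappa>\<in>compact_elements. \<forall>\<kappa>'\<in>compact_elements. sup \<kappa> \<kappa>' \<in> (compact_elements :: 'x set)) \<and>
     (\<forall>\<kappa>\<in>compact_elements. \<forall>\<xi>. inf \<kappa> \<xi> \<in> (compact_elements :: 'x set))"

text \<open>The qualified name is needed because HOL-Algebra's \<open>Order.top\<close> shadows \<open>top\<close>.\<close>

definition K_countable :: "'x::complete_lattice itself \<Rightarrow> bool" where
  "K_countable _ \<longleftrightarrow> (\<exists>\<Lambda>\<subseteq>compact_elements. countable \<Lambda> \<and> Sup \<Lambda> = (top_class.top :: 'x))"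

definition directed_set :: "'x::order set \<Rightarrow> bool" where
  "directed_set L \<longleftrightarrow> L \<noteq> {} \<and> (\<forall>x\<in>L. \<forall>y\<in>L. \<exists>z\<in>L. x \<le> z \<and> y \<le> z)"


section \<open>Hurewicz fibrations\<close>

definition homotopy_lifting ::
    "'t topology \<Rightarrow> 'e topology \<Rightarrow> 'b topology \<Rightarrow> ('e \<Rightarrow> 'b) \<Rightarrow> bool" where
  "homotopy_lifting T E B p \<longleftrightarrow>
     (\<forall>f H. continuous_map T E f \<longrightarrow>
        continuous_map (prod_topology (top_of_set {0..1::real}) T) B H \<longrightarrow>
        (\<forall>x\<in>topspace T. H (0, x) = p (f x)) \<longrightarrow>
        (\<exists>G. continuous_map (prod_topology (top_of_set {0..1}) T) E G \<and>
             (\<forall>x\<in>topspace T. G (0, x) = f x) \<and>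
             (\<forall>t\<in>{0..1}. \<forall>x\<in>topspace T. p (G (t, x)) = H (t, x))))"

text \<open>The homotopy lifting property is required for all Hausdorff test spaces. HOL cannot quantify
  over the type of points of the test space inside a definition; it is enough to let the test
  spaces range over the type of the mapping path space of \<^term>\<open>p\<close>, and
  \<open>hurewicz_fibration_lifting\<close> below shows that every test space over every type is then covered.\<close>

definition hurewicz_fibration :: "'e topology \<Rightarrow> 'b topology \<Rightarrow> ('e \<Rightarrow> 'b) \<Rightarrow> bool" where
  "hurewicz_fibration E B p \<longleftrightarrow>
     continuous_map E B p \<and>
     (\<forall>T :: ('e \<times> (real \<Rightarrow> 'b)) topology. Hausdorff_space T \<longrightarrow> homotopy_lifting T E B p)"

lemma separated_by_continuous_map:
  assumes g: "continuous_map Q Y g" and "Hausdorff_space Y"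
    and y: "y \<in> topspace Q" and z: "z \<in> topspace Q" and "g y \<noteq> g z"
  shows "\<exists>U V. openin Q U \<and> openin Q V \<and> y \<in> U \<and> z \<in> V \<and> disjnt U V"
proof -
  have "g y \<in> topspace Y" "g z \<in> topspace Y"
    using g y z continuous_map_image_subset_topspace by fastforce+
  then obtain U V where UV: "openin Y U" "openin Y V" "g y \<in> U" "g z \<in> V" "disjnt U V"
    using assms unfolding Hausdorff_space_def by metis
  show ?thesis
  proof (intro exI conjI)
    show "openin Q {x \<in> topspace Q. g x \<in> U}" "openin Q {x \<in> topspace Q. g x \<in> V}"
      using UV openin_continuous_map_preimage [OF g] by auto
  qed (use UV y z in \<open>auto simp: disjnt_iff\<close>)
qed

lemma hurewicz_fibration_lifting:
  fixes T :: "'t topology" and E :: "'e topology" and B :: "'b topology"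
  assumes "Hausdorff_space E" "Hausdorff_space B" "hurewicz_fibration E B p"
  shows "homotopy_lifting T E B p"
  unfolding homotopy_lifting_def
proof (intro allI impI)
  fix f H
  let ?I = "top_of_set {0..1::real}"
  assume f: "continuous_map T E f" and H: "continuous_map (prod_topology ?I T) B H"
    and 0: "\<forall>x\<in>topspace T. H (0, x) = p (f x)"
  \<comment> \<open>Factor the lifting problem through the quotient \<open>Q\<close> of \<open>T\<close> whose points are the pairs
      \<open>q x\<close>; it is Hausdorff because \<open>E\<close> and \<open>B\<close> are.\<close>
  define q where "q x = (f x, restrict (\<lambda>t. H (t, x)) {0..1})" for x
  define Q where "Q = topology (\<lambda>U. U \<subseteq> q ` topspace T \<and> openin T {x \<in> topspace T. q x \<in> U})"
  have "istopology (\<lambda>U. U \<subseteq> q ` topspace T \<and> openin T {x \<in> topspace T. q x \<in> U})"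
  proof -
    have 1: "{x \<in> topspace T. q x \<in> U \<inter> V} = {x \<in> topspace T. q x \<in> U} \<inter> {x \<in> topspace T. q x \<in> V}"
      for U V by auto
    have 2: "{x \<in> topspace T. q x \<in> \<Union> \<U>} = (\<Union>U\<in>\<U>. {x \<in> topspace T. q x \<in> U})" for \<U>
      by auto
    show ?thesis unfolding istopology_def 1 2 by blast
  qed
  then have openQ: "openin Q U \<longleftrightarrow> U \<subseteq> q ` topspace T \<and> openin T {x \<in> topspace T. q x \<in> U}" for U
    by (simp add: Q_def)
  have topQ: "topspace Q = q ` topspace T"
  proof -
    have "{x \<in> topspace T. q x \<in> q ` topspace T} = topspace T" by auto
    then have "openin Q (q ` topspace T)" by (simp add: openQ)
    then show ?thesis
      by (metis openQ openin_subset openin_topspace subset_antisym)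
  qed
  have q: "quotient_map T Q q"
    by (simp add: quotient_map_def topQ openQ)
  have "continuous_map Q E fst"
    using q f by (subst continuous_compose_quotient_map_eq [symmetric]) (auto simp: o_def q_def)
  have qI: "quotient_map (prod_topology ?I T) (prod_topology ?I Q) (\<lambda>(t, x). (t, q x))"
    by (intro quotient_map_prod_right q)
       (auto simp: locally_compact_space_euclidean Hausdorff_space_subtopology 
         compact_imp_locally_compact_space compact_space_subtopology)
  define H' where "H' = (\<lambda>(t :: real, y :: 'e \<times> (real \<Rightarrow> 'b)). snd y t)"
  have H': "continuous_map (prod_topology ?I Q) B H'"
  proof -
    have "continuous_map (prod_topology ?I T) B (H' \<circ> (\<lambda>(t, x). (t, q x)))"
      by (rule continuous_map_eq [OF H]) (auto simp: H'_def q_def)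
    then show ?thesis
      using qI continuous_compose_quotient_map by blast
  qed
  have "Hausdorff_space Q"
    unfolding Hausdorff_space_def
  proof (intro allI impI, elim conjE)
    fix y z assume y: "y \<in> topspace Q" and z: "z \<in> topspace Q" and "y \<noteq> z"
    show "\<exists>U V. openin Q U \<and> openin Q V \<and> y \<in> U \<and> z \<in> V \<and> disjnt U V"
    proof (cases "fst y = fst z")
      case False
      then show ?thesis
        by (intro separated_by_continuous_map [OF \<open>continuous_map Q E fst\<close> assms(1) y z])
    next
      case True
      then have "snd y \<noteq> snd z"
        using \<open>y \<noteq> z\<close> prod_eqI by blast
      then obtain t where t: "snd y t \<noteq> snd z t" by blast
      then have "t \<in> {0..1}"
        using y z by (auto simp: topQ q_def restrict_def split: if_splits)
      then have "continuous_map Q B (H' \<circ> Pair t)"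
        by (intro continuous_map_o_Pair [OF H']) simp
      then show ?thesis
        by (rule separated_by_continuous_map [OF _ assms(2) y z]) (simp add: H'_def t)
    qed
  qed
  then have "homotopy_lifting Q E B p"
    using assms(3) by (auto simp: hurewicz_fibration_def)
  moreover have "\<forall>y\<in>topspace Q. H' (0, y) = p (fst y)"
    using 0 by (auto simp: topQ q_def H'_def)
  ultimately obtain G where G: "continuous_map (prod_topology ?I Q) E G"
      "\<forall>y\<in>topspace Q. G (0, y) = fst y"
      "\<forall>t\<in>{0..1}. \<forall>y\<in>topspace Q. p (G (t, y)) = H' (t, y)"
    using \<open>continuous_map Q E fst\<close> H' unfolding homotopy_lifting_def by blast
  show "\<exists>G. continuous_map (prod_topology ?I T) E G \<and> (\<forall>x\<in>topspace T. G (0, x) = f x) \<and>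
            (\<forall>t\<in>{0..1}. \<forall>x\<in>topspace T. p (G (t, x)) = H (t, x))"
  proof (intro exI conjI)
    show "continuous_map (prod_topology ?I T) E (G \<circ> (\<lambda>(t, x). (t, q x)))"
      using G(1) qI continuous_map_compose quotient_imp_continuous_map by blast
  qed (use G(2,3) in \<open>auto simp: topQ q_def H'_def\<close>)
qed


section \<open>Inverse systems of spaces\<close>

text \<open>\<open>p m l\<close> is the bonding map from \<open>Z m\<close> to \<open>Z l\<close>, for \<open>l \<le> m\<close>. Taking all spaces over one
  type of points is no restriction: any family of spaces embeds in the type of its disjoint union.\<close>

definition inverse_system ::
    "('x::order \<Rightarrow> 'a topology) \<Rightarrow> ('x \<Rightarrow> 'x \<Rightarrow> 'a \<Rightarrow> 'a) \<Rightarrow> bool" where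
  "inverse_system Z p \<longleftrightarrow>
     (\<forall>l. Hausdorff_space (Z l)) \<and>
     (\<forall>l m. l \<le> m \<longrightarrow> continuous_map (Z m) (Z l) (p m l)) \<and>
     (\<forall>l. \<forall>z\<in>topspace (Z l). p l l z = z) \<and>
     (\<forall>l m n. l \<le> m \<longrightarrow> m \<le> n \<longrightarrow> (\<forall>z\<in>topspace (Z n). p m l (p n m z) = p n l z))"

definition system_of_fibrations ::
    "('x::order \<Rightarrow> 'a topology) \<Rightarrow> ('x \<Rightarrow> 'x \<Rightarrow> 'a \<Rightarrow> 'a) \<Rightarrow> bool" where
  "system_of_fibrations Z p \<longleftrightarrow>
     inverse_system Z p \<and> (\<forall>l m. l \<le> m \<longrightarrow> hurewicz_fibration (Z m) (Z l) (p m l))"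

definition inverse_limit ::
    "('x::order \<Rightarrow> 'a topology) \<Rightarrow> ('x \<Rightarrow> 'x \<Rightarrow> 'a \<Rightarrow> 'a) \<Rightarrow> 'x set \<Rightarrow> ('x \<Rightarrow> 'a) topology" where
  "inverse_limit Z p L =
     subtopology (product_topology Z L) {z. \<forall>l\<in>L. \<forall>m\<in>L. l \<le> m \<longrightarrow> p m l (z m) = z l}"

definition restricted_system ::
    "('x::complete_lattice \<Rightarrow> 'a topology) \<Rightarrow> ('x \<Rightarrow> 'x \<Rightarrow> 'a \<Rightarrow> 'a) \<Rightarrow> bool" where
  "restricted_system Z p \<longleftrightarrow>
     (\<forall>L. directed_set L \<longrightarrow>
        homeomorphic_map (Z (Sup L)) (inverse_limit Z p L) (\<lambda>z. restrict (\<lambda>l. p (Sup L) l z) L))"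

definition phantom_pair ::
    "('x::complete_lattice \<Rightarrow> 'a topology) \<Rightarrow> ('x \<Rightarrow> 'x \<Rightarrow> 'a \<Rightarrow> 'a) \<Rightarrow> 'a set \<Rightarrow> 'a set \<Rightarrow> bool" where
  "phantom_pair Z p C D \<longleftrightarrow>
     C \<in> path_components_of (Z top_class.top) \<and> D \<in> path_components_of (Z top_class.top) \<and>
     (\<forall>\<kappa>\<in>compact_elements. p top_class.top \<kappa> ` C = p top_class.top \<kappa> ` D)"

definition Ph ::
    "('x::complete_lattice \<Rightarrow> 'a topology) \<Rightarrow> ('x \<Rightarrow> 'x \<Rightarrow> 'a \<Rightarrow> 'a) \<Rightarrow> 'a set \<Rightarrow> 'a set set" where
  "Ph Z p C = {D. phantom_pair Z p C D}"


section \<open>CW complexes\<close>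

definition closed_disc :: "nat \<Rightarrow> (nat \<Rightarrow> real) set" where
  "closed_disc n = {x \<in> topspace (Euclidean_space n). (\<Sum>i<n. (x i)\<^sup>2) \<le> 1}"

definition open_disc :: "nat \<Rightarrow> (nat \<Rightarrow> real) set" where
  "open_disc n = {x \<in> topspace (Euclidean_space n). (\<Sum>i<n. (x i)\<^sup>2) < 1}"

text \<open>Whitehead's definition: \<open>\<E>\<close> is the partition of the space into open cells, \<open>d e\<close> and \<open>\<Phi> e\<close>
  are the dimension and a characteristic map of the cell \<open>e\<close>. The last two clauses are closure
  finiteness and the weak topology.\<close>

definition CW_structure ::
    "'a topology \<Rightarrow> 'a set set \<Rightarrow> ('a set \<Rightarrow> nat) \<Rightarrow> ('a set \<Rightarrow> (nat \<Rightarrow> real) \<Rightarrow> 'a) \<Rightarrow> bool" where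
  "CW_structure X \<E> d \<Phi> \<longleftrightarrow>
     Hausdorff_space X \<and>
     \<Union>\<E> = topspace X \<and> pairwise disjnt \<E> \<and>
     (\<forall>e\<in>\<E>. continuous_map (subtopology (Euclidean_space (d e)) (closed_disc (d e))) X (\<Phi> e) \<and>
        homeomorphic_map (subtopology (Euclidean_space (d e)) (open_disc (d e)))
          (subtopology X e) (\<Phi> e)) \<and>
     (\<forall>e\<in>\<E>. \<exists>F\<subseteq>\<E>. finite F \<and> (\<forall>c\<in>F. d c < d e) \<and>
        \<Phi> e ` (closed_disc (d e) - open_disc (d e)) \<subseteq> \<Union>F) \<and>
     (\<forall>A\<subseteq>topspace X. (\<forall>e\<in>\<E>. closedin X (A \<inter> X closure_of e)) \<longrightarrow> closedin X A)"

definition CW_complex :: "'a topology \<Rightarrow> bool" where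
  "CW_complex X \<longleftrightarrow> (\<exists>\<E> d \<Phi>. CW_structure X \<E> d \<Phi>)"

text \<open>The type argument is the type of points of the CW complex. A statement that has this predicate
  as a hypothesis should leave it a free type variable, so that the complex may live on any type.\<close>

definition has_CW_homotopy_type :: "'w itself \<Rightarrow> 'a topology \<Rightarrow> bool" where
  "has_CW_homotopy_type _ X \<longleftrightarrow>
     (\<exists>Y :: 'w topology. CW_complex Y \<and> X homotopy_equivalent_space Y)"


section \<open>Homotopy groups\<close>

definition unit_cube :: "nat \<Rightarrow> (nat \<Rightarrow> real) topology" where
  "unit_cube k = subtopology (Euclidean_space k) {x. \<forall>i<k. x i \<in> {0..1}}"

definition cube_boundary :: "nat \<Rightarrow> (nat \<Rightarrow> real) set" where
  "cube_boundary k = {x \<in> topspace (unit_cube k). \<exists>i<k. x i \<in> {0, 1}}"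

definition spheroid :: "nat \<Rightarrow> 'a topology \<Rightarrow> 'a \<Rightarrow> ((nat \<Rightarrow> real) \<Rightarrow> 'a) \<Rightarrow> bool" where
  "spheroid k X a f \<longleftrightarrow> continuous_map (unit_cube k) X f \<and> (\<forall>x\<in>cube_boundary k. f x = a)"

definition spheroid_homotopic ::
    "nat \<Rightarrow> 'a topology \<Rightarrow> 'a \<Rightarrow> ((nat \<Rightarrow> real) \<Rightarrow> 'a) \<Rightarrow> ((nat \<Rightarrow> real) \<Rightarrow> 'a) \<Rightarrow> bool" where
  "spheroid_homotopic k X a = homotopic_with (\<lambda>g. \<forall>x\<in>cube_boundary k. g x = a) (unit_cube k) X"

definition spheroid_class ::
    "nat \<Rightarrow> 'a topology \<Rightarrow> 'a \<Rightarrow> ((nat \<Rightarrow> real) \<Rightarrow> 'a) \<Rightarrow> ((nat \<Rightarrow> real) \<Rightarrow> 'a) set" where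
  "spheroid_class k X a f = {g. spheroid_homotopic k X a f g}"

definition spheroid_join ::
    "((nat \<Rightarrow> real) \<Rightarrow> 'a) \<Rightarrow> ((nat \<Rightarrow> real) \<Rightarrow> 'a) \<Rightarrow> (nat \<Rightarrow> real) \<Rightarrow> 'a" where
  "spheroid_join f g x = (if x 0 \<le> 1/2 then f (x(0 := 2 * x 0)) else g (x(0 := 2 * x 0 - 1)))"

definition homotopy_group :: "nat \<Rightarrow> 'a topology \<Rightarrow> 'a \<Rightarrow> ((nat \<Rightarrow> real) \<Rightarrow> 'a) set monoid" where
  "homotopy_group k X a =
     \<lparr>carrier = spheroid_class k X a ` Collect (spheroid k X a),
      monoid.mult = (\<lambda>A B. \<Union>f\<in>A. \<Union>g\<in>B. spheroid_class k X a (spheroid_join f g)),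
      one = spheroid_class k X a (\<lambda>_. a)\<rparr>"

text \<open>The map induced by \<open>\<phi>\<close> into the homotopy group of \<open>Y\<close> at \<open>b\<close>.\<close>

definition homotopy_hom ::
    "nat \<Rightarrow> 'b topology \<Rightarrow> 'b \<Rightarrow> ('a \<Rightarrow> 'b) \<Rightarrow> ((nat \<Rightarrow> real) \<Rightarrow> 'a) set \<Rightarrow> ((nat \<Rightarrow> real) \<Rightarrow> 'b) set" where
  "homotopy_hom k Y b \<phi> A = (\<Union>f\<in>A. spheroid_class k Y b (\<phi> \<circ> f))"

text \<open>The homotopy groups in positive degrees are groups, and the induced maps are functorial
  homomorphisms.\<close>

lemma topspace_unit_cube:
  "topspace (unit_cube k) = {x. (\<forall>i<k. x i \<in> {0..1}) \<and> (\<forall>i\<ge>k. x i = 0)}"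
  by (auto simp: unit_cube_def topspace_Euclidean_space)

lemma cube_coordinate:
  "x \<in> topspace (unit_cube k) \<Longrightarrow> 1 \<le> k \<Longrightarrow> 0 \<le> x 0 \<and> x 0 \<le> 1"
  by (auto simp: topspace_unit_cube)

lemma cube_upd:
  assumes "x \<in> topspace (unit_cube k)" "1 \<le> k" "0 \<le> s" "s \<le> 1"
  shows "x(0 := s) \<in> topspace (unit_cube k)"
  using assms by (auto simp: topspace_unit_cube)

lemma cube_boundary_upd:
  assumes "x \<in> topspace (unit_cube k)" "1 \<le> k" "s \<in> {0, 1}"
  shows "x(0 := s) \<in> cube_boundary k"
  using assms cube_upd [OF assms(1,2), of s]
  by (auto simp: cube_boundary_def intro: exI [of _ "0::nat"])

lemma cube_boundary_upd_cases:
  assumes "x \<in> cube_boundary k" "1 \<le> k" "0 \<le> s" "s \<le> 1" "x 0 \<in> {0, 1} \<Longrightarrow> s \<in> {0, 1}"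
  shows "x(0 := s) \<in> cube_boundary k"
proof (cases "x 0 \<in> {0, 1}")
  case True
  then show ?thesis
    using assms by (intro cube_boundary_upd) (auto simp: cube_boundary_def)
next
  case False
  then obtain i where "i < k" "x i \<in> {0, 1}" "i \<noteq> 0"
    using assms(1) unfolding cube_boundary_def by (smt (verit) mem_Collect_eq)
  then show ?thesis
    using assms cube_upd [of x k s] unfolding cube_boundary_def
    by (intro CollectI conjI exI [of _ i]) auto
qed

lemma continuous_map_unit_cube:
  "continuous_map T (unit_cube k) u \<longleftrightarrow>
     (\<forall>i. continuous_map T euclideanreal (\<lambda>z. u z i)) \<and> u ` topspace T \<subseteq> topspace (unit_cube k)"
  by (auto simp: unit_cube_def Euclidean_space_def continuous_map_in_subtopology
      continuous_map_componentwise_UNIV image_subset_iff)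

lemma continuous_map_cube_nth:
  "continuous_map (unit_cube k) euclideanreal (\<lambda>x. x i)"
  using continuous_map_unit_cube [of "unit_cube k" k "\<lambda>x. x"] by auto

lemma continuous_map_cube_upd:
  assumes "continuous_map T (unit_cube k) u" "continuous_map T euclideanreal s" "1 \<le> k"
    and "\<And>z. z \<in> topspace T \<Longrightarrow> 0 \<le> s z \<and> s z \<le> 1"
  shows "continuous_map T (unit_cube k) (\<lambda>z. (u z)(0 := s z))"
  unfolding continuous_map_unit_cube
proof (intro conjI allI)
  fix i show "continuous_map T euclideanreal (\<lambda>z. ((u z)(0 := s z)) i)"
    using assms(1,2) by (cases "i = 0") (auto simp: continuous_map_unit_cube)
next
  have "u z \<in> topspace (unit_cube k)" if "z \<in> topspace T" for z
    using assms(1) that by (auto simp: continuous_map_unit_cube)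
  then show "(\<lambda>z. (u z)(0 := s z)) ` topspace T \<subseteq> topspace (unit_cube k)"
    using assms(3,4) cube_upd by blast
qed

abbreviation cube_cylinder :: "nat \<Rightarrow> (real \<times> (nat \<Rightarrow> real)) topology" where
  "cube_cylinder k \<equiv> prod_topology (top_of_set {0..1::real}) (unit_cube k)"

lemma spheroid_homotopic_iff:
  "spheroid_homotopic k X a f g \<longleftrightarrow>
     (\<exists>h. continuous_map (cube_cylinder k) X h \<and>
          (\<forall>x\<in>topspace (unit_cube k). h (0, x) = f x) \<and>
          (\<forall>x\<in>topspace (unit_cube k). h (1, x) = g x) \<and>
          (\<forall>t\<in>{0..1}. \<forall>x\<in>cube_boundary k. h (t, x) = a))"
  unfolding spheroid_homotopic_def
  by (rule homotopic_with) (auto simp: cube_boundary_def)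

lemma spheroid_homotopic_refl [simp]: "spheroid_homotopic k X a f f \<longleftrightarrow> spheroid k X a f"
  by (auto simp: spheroid_homotopic_def spheroid_def)

lemma spheroid_homotopic_sym: "spheroid_homotopic k X a f g \<Longrightarrow> spheroid_homotopic k X a g f"
  by (simp add: spheroid_homotopic_def homotopic_with_symD)

lemma spheroid_homotopic_trans:
  "spheroid_homotopic k X a f g \<Longrightarrow> spheroid_homotopic k X a g h \<Longrightarrow> spheroid_homotopic k X a f h"
  unfolding spheroid_homotopic_def by (rule homotopic_with_trans)

lemma spheroid_homotopicD:
  assumes "spheroid_homotopic k X a f g"
  shows "spheroid k X a f" "spheroid k X a g"
  using spheroid_homotopic_refl assms spheroid_homotopic_sym spheroid_homotopic_trans by metis+

lemma spheroid_homotopic_eq: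
  assumes "spheroid k X a f" "\<And>x. x \<in> topspace (unit_cube k) \<Longrightarrow> f x = g x"
  shows "spheroid_homotopic k X a f g"
  using assms unfolding spheroid_homotopic_def spheroid_def
  by (intro homotopic_with_equal) (auto simp: cube_boundary_def)

lemma spheroid_class_eq:
  assumes "spheroid_homotopic k X a f g"
  shows "spheroid_class k X a f = spheroid_class k X a g"
  unfolding spheroid_class_def
  using spheroid_homotopic_trans [OF assms] spheroid_homotopic_trans [OF spheroid_homotopic_sym [OF assms]]
  by blast

lemma spheroid_class_eq_iff:
  assumes "spheroid k X a g"
  shows "spheroid_class k X a f = spheroid_class k X a g \<longleftrightarrow> spheroid_homotopic k X a f g"
  using assms spheroid_class_eq by (fastforce simp: spheroid_class_def)

lemma spheroid_const: "a \<in> topspace X \<Longrightarrow> spheroid k X a (\<lambda>_. a)"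
  by (simp add: spheroid_def)

lemma spheroid_homotopic_reparam:
  fixes r r' :: "real \<Rightarrow> real"
  assumes f: "spheroid k X a f" and "1 \<le> k"
    and r: "continuous_on {0..1} r" "r \<in> {0..1} \<rightarrow> {0..1}"
    and r': "continuous_on {0..1} r'" "r' \<in> {0..1} \<rightarrow> {0..1}"
    and 0: "r 0 = r' 0" "r 0 \<in> {0, 1}" and 1: "r 1 = r' 1" "r 1 \<in> {0, 1}"
  shows "spheroid_homotopic k X a (\<lambda>x. f (x(0 := r (x 0)))) (\<lambda>x. f (x(0 := r' (x 0))))"
  unfolding spheroid_homotopic_iff
proof (intro exI conjI ballI)
  let ?s = "\<lambda>z. (1 - fst z) * r (snd z 0) + fst z * r' (snd z 0)"
  let ?u = "\<lambda>z. (snd z)(0 := ?s z)"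
  have x0: "snd z 0 \<in> {0..1}" if "z \<in> topspace (cube_cylinder k)" for z
    using that \<open>1 \<le> k\<close> cube_coordinate by auto
  have s: "0 \<le> ?s z \<and> ?s z \<le> 1" if z: "z \<in> topspace (cube_cylinder k)" for z
  proof -
    have t: "0 \<le> fst z" "0 \<le> 1 - fst z"
      using z by auto
    have 2: "0 \<le> r (snd z 0)" "r (snd z 0) \<le> 1" "0 \<le> r' (snd z 0)" "r' (snd z 0) \<le> 1"
      using funcset_mem [OF r(2) x0 [OF z]] funcset_mem [OF r'(2) x0 [OF z]] by simp_all
    have "?s z \<le> (1 - fst z) * 1 + fst z * 1"
      by (intro add_mono mult_left_mono t 2)
    moreover have "0 \<le> ?s z"
      by (intro add_nonneg_nonneg mult_nonneg_nonneg t 2)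
    ultimately show ?thesis by simp
  qed
  have c: "continuous_map (cube_cylinder k) euclideanreal (\<lambda>z. snd z 0)"
    using continuous_map_compose [OF continuous_map_snd continuous_map_cube_nth] by (auto simp: o_def)
  have c01: "continuous_map (cube_cylinder k) (top_of_set {0..1}) (\<lambda>z. snd z 0)"
    using c x0 by (auto simp: continuous_map_in_subtopology)
  have cr: "continuous_map (cube_cylinder k) euclideanreal (\<lambda>z. g (snd z 0))"
    if "continuous_on {0..1} g" for g :: "real \<Rightarrow> real"
    using continuous_map_compose [OF c01, of euclideanreal g] that by (auto simp: o_def)
  have cf: "continuous_map (cube_cylinder k) euclideanreal fst"
    using continuous_map_fst continuous_map_in_subtopology by blast
  have "continuous_map (cube_cylinder k) euclideanreal ?s"
    using cr [OF r(1)] cr [OF r'(1)] cf by (intro continuous_intros) auto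
  then have "continuous_map (cube_cylinder k) (unit_cube k) ?u"
    using \<open>1 \<le> k\<close> s by (intro continuous_map_cube_upd continuous_map_snd) auto
  then show "continuous_map (cube_cylinder k) X (f \<circ> ?u)"
    using f continuous_map_compose unfolding spheroid_def by blast
  fix t x assume t: "t \<in> {0..1::real}" and x: "x \<in> cube_boundary k"
  have "x \<in> topspace (unit_cube k)" using x by (simp add: cube_boundary_def)
  then have "0 \<le> ?s (t, x)" "?s (t, x) \<le> 1"
    using s [of "(t, x)"] t by auto
  moreover have "?s (t, x) \<in> {0, 1}" if "x 0 \<in> {0, 1}"
  proof -
    have "(1 - t) * c + t * c = c" for c :: real
      by (simp add: algebra_simps)
    then show ?thesis
      using that 0 1 by (metis empty_iff fst_conv insert_iff snd_conv)
  qed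
  ultimately have "?u (t, x) \<in> cube_boundary k"
    using cube_boundary_upd_cases [OF x \<open>1 \<le> k\<close>] by simp
  then show "(f \<circ> ?u) (t, x) = a"
    using f by (simp add: spheroid_def)
qed auto

lemma spheroid_join_homotopic:
  assumes "spheroid_homotopic k X a f f'" "spheroid_homotopic k X a g g'" "1 \<le> k"
  shows "spheroid_homotopic k X a (spheroid_join f g) (spheroid_join f' g')"
proof -
  obtain h1 where h1: "continuous_map (cube_cylinder k) X h1"
      "\<forall>x\<in>topspace (unit_cube k). h1 (0, x) = f x"
      "\<forall>x\<in>topspace (unit_cube k). h1 (1, x) = f' x"
      "\<forall>t\<in>{0..1}. \<forall>x\<in>cube_boundary k. h1 (t, x) = a"
    using assms(1) unfolding spheroid_homotopic_iff by blast
  obtain h2 where h2: "continuous_map (cube_cylinder k) X h2"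
      "\<forall>x\<in>topspace (unit_cube k). h2 (0, x) = g x"
      "\<forall>x\<in>topspace (unit_cube k). h2 (1, x) = g' x"
      "\<forall>t\<in>{0..1}. \<forall>x\<in>cube_boundary k. h2 (t, x) = a"
    using assms(2) unfolding spheroid_homotopic_iff by blast
  let ?h = "\<lambda>z. if snd z 0 \<le> 1/2 then (h1 \<circ> (\<lambda>z. (fst z, (snd z)(0 := 2 * snd z 0)))) z
                 else (h2 \<circ> (\<lambda>z. (fst z, (snd z)(0 := 2 * snd z 0 - 1)))) z"
  let ?A = "{z \<in> topspace (cube_cylinder k). snd z 0 \<le> 1/2}"
  let ?B = "{z \<in> topspace (cube_cylinder k). 1/2 \<le> snd z 0}"
  have c: "continuous_map (cube_cylinder k) euclideanreal (\<lambda>z. snd z 0)"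
    using continuous_map_compose [OF continuous_map_snd continuous_map_cube_nth] by (auto simp: o_def)
  have x0: "0 \<le> x 0 \<and> x 0 \<le> 1" if "x \<in> topspace (unit_cube k)" for x
    using that \<open>1 \<le> k\<close> cube_coordinate by auto
  have upd: "continuous_map (subtopology (cube_cylinder k) S) (cube_cylinder k)
               (\<lambda>z. (fst z, (snd z)(0 := v (snd z 0))))"
    if "continuous_map (cube_cylinder k) euclideanreal (\<lambda>z. v (snd z 0))"
      "\<And>z. z \<in> topspace (cube_cylinder k) \<Longrightarrow> z \<in> S \<Longrightarrow> 0 \<le> v (snd z 0) \<and> v (snd z 0) \<le> 1"
    for S and v :: "real \<Rightarrow> real"
  proof -
    have "continuous_map (subtopology (cube_cylinder k) S) (unit_cube k)
            (\<lambda>z. (snd z)(0 := v (snd z 0)))"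
      using that \<open>1 \<le> k\<close>
      by (intro continuous_map_cube_upd continuous_map_from_subtopology continuous_map_snd) auto
    then show ?thesis
      by (simp add: continuous_map_pairwise o_def continuous_map_from_subtopology continuous_map_fst)
  qed
  have bd: "x(0 := s) \<in> cube_boundary k" if "x \<in> topspace (unit_cube k)" "s \<in> {0, 1}" for x s
    using cube_boundary_upd that \<open>1 \<le> k\<close> by blast
  have "continuous_map (cube_cylinder k) X ?h"
  proof (rule continuous_map_cases_le)
    show "continuous_map (subtopology (cube_cylinder k) ?A) X
            (h1 \<circ> (\<lambda>z. (fst z, (snd z)(0 := 2 * snd z 0))))"
      using c x0 by (intro continuous_map_compose [OF upd h1(1)] continuous_intros) auto
    show "continuous_map (subtopology (cube_cylinder k) ?B) X
            (h2 \<circ> (\<lambda>z. (fst z, (snd z)(0 := 2 * snd z 0 - 1))))"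
      using c x0 by (intro continuous_map_compose [OF upd h2(1)] continuous_intros) auto
    show "(h1 \<circ> (\<lambda>z. (fst z, (snd z)(0 := 2 * snd z 0)))) z =
          (h2 \<circ> (\<lambda>z. (fst z, (snd z)(0 := 2 * snd z 0 - 1)))) z"
      if "z \<in> topspace (cube_cylinder k)" "snd z 0 = 1/2" for z
    proof -
      have "2 * snd z 0 = 1" "2 * snd z 0 - 1 = 0"
        using that(2) by simp_all
      then show ?thesis
        using that(1) bd [of "snd z" 0] bd [of "snd z" 1] h1(4) h2(4) by (simp add: mem_Times_iff)
    qed
  qed (use c in auto)
  moreover have "?h (t, x) = a" if t: "t \<in> {0..1}" and x: "x \<in> cube_boundary k" for t x
  proof -
    have x': "x \<in> topspace (unit_cube k)" using x by (simp add: cube_boundary_def)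
    have "x(0 := 2 * x 0) \<in> cube_boundary k" if "x 0 \<le> 1/2"
      using x x0 [OF x'] that \<open>1 \<le> k\<close> by (intro cube_boundary_upd_cases) auto
    moreover have "x(0 := 2 * x 0 - 1) \<in> cube_boundary k" if "\<not> x 0 \<le> 1/2"
      using x x0 [OF x'] that \<open>1 \<le> k\<close> by (intro cube_boundary_upd_cases) auto
    ultimately show ?thesis
      using h1(4) h2(4) t by auto
  qed
  moreover have "x(0 := 2 * x 0) \<in> topspace (unit_cube k)"
    if "x \<in> topspace (unit_cube k)" "x 0 \<le> 1/2" for x
    using that x0 \<open>1 \<le> k\<close> by (intro cube_upd) auto
  moreover have "x(0 := 2 * x 0 - 1) \<in> topspace (unit_cube k)"
    if "x \<in> topspace (unit_cube k)" "\<not> x 0 \<le> 1/2" for x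
    using that x0 \<open>1 \<le> k\<close> by (intro cube_upd) auto
  ultimately show ?thesis
    unfolding spheroid_homotopic_iff spheroid_join_def
    using h1(2,3) h2(2,3) by (intro exI [of _ ?h]) auto
qed

lemma spheroid_join:
  "spheroid k X a f \<Longrightarrow> spheroid k X a g \<Longrightarrow> 1 \<le> k \<Longrightarrow> spheroid k X a (spheroid_join f g)"
  using spheroid_join_homotopic [of k X a f f g g] by simp

lemma homotopy_group_mult:
  assumes "spheroid k X a f" "spheroid k X a g" "1 \<le> k"
  shows "spheroid_class k X a f \<otimes>\<^bsub>homotopy_group k X a\<^esub> spheroid_class k X a g =
         spheroid_class k X a (spheroid_join f g)"
proof -
  have *: "spheroid_class k X a (spheroid_join f' g') = spheroid_class k X a (spheroid_join f g)"
    if "f' \<in> spheroid_class k X a f" "g' \<in> spheroid_class k X a g" for f' g'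
  proof -
    have "spheroid_homotopic k X a f f'" "spheroid_homotopic k X a g g'"
      using that by (simp_all add: spheroid_class_def)
    from spheroid_class_eq [OF spheroid_join_homotopic [OF this \<open>1 \<le> k\<close>]] show ?thesis ..
  qed
  have "f \<in> spheroid_class k X a f" "g \<in> spheroid_class k X a g"
    using assms by (simp_all add: spheroid_class_def)
  then have ne: "spheroid_class k X a f \<noteq> {}" "spheroid_class k X a g \<noteq> {}"
    by (simp_all only: ex_in_conv [symmetric]) blast+
  have "(\<Union>f'\<in>spheroid_class k X a f. \<Union>g'\<in>spheroid_class k X a g.
           spheroid_class k X a (spheroid_join f' g')) =
        (\<Union>f'\<in>spheroid_class k X a f. \<Union>g'\<in>spheroid_class k X a g.
           spheroid_class k X a (spheroid_join f g))"
    by (intro SUP_cong refl *)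
  also have "\<dots> = spheroid_class k X a (spheroid_join f g)"
    using ne by simp
  finally show ?thesis
    by (simp add: homotopy_group_def)
qed

lemma continuous_on_pw1:
  fixes u v :: "real \<Rightarrow> real"
  assumes "continuous_on UNIV u" "continuous_on UNIV v" "u c = v c"
  shows "continuous_on A (\<lambda>s. if s \<le> c then u s else v s)"
proof -
  have "continuous_on UNIV (\<lambda>s. if s \<le> c then u s else v s)"
  proof (rule continuous_on_cases_le [where h = "\<lambda>s. s"])
  qed (use assms continuous_on_subset in auto)
  then show ?thesis using continuous_on_subset by blast
qed

theorem group_homotopy_group:
  assumes "1 \<le> k" "a \<in> topspace X"
  shows "group (homotopy_group k X a)"
proof (rule groupI)
  let ?G = "homotopy_group k X a" and ?c = "spheroid_class k X a"
  have carrI: "?c f \<in> carrier ?G" if "spheroid k X a f" for f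
    using that by (simp add: homotopy_group_def)
  have carrE: "\<exists>f. spheroid k X a f \<and> A = ?c f" if "A \<in> carrier ?G" for A
    using that by (auto simp: homotopy_group_def)
  have one: "\<one>\<^bsub>?G\<^esub> = ?c (\<lambda>_. a)"
    by (simp add: homotopy_group_def)
  note const = spheroid_const [OF assms(2), of k]
  note mult = homotopy_group_mult [OF _ _ assms(1)]
  note join = spheroid_join [OF _ _ assms(1)]
  have edge: "f (x(0 := s)) = a"
    if "spheroid k X a f" "x \<in> topspace (unit_cube k)" "s \<in> {0, 1}" for f x s
    using cube_boundary_upd [OF that(2) assms(1) that(3)] that(1) by (simp add: spheroid_def)
  show "\<one>\<^bsub>?G\<^esub> \<in> carrier ?G"
    by (simp add: one carrI const)
  fix A assume "A \<in> carrier ?G"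
  then obtain f where f: "spheroid k X a f" "A = ?c f" using carrE by blast
  show "\<one>\<^bsub>?G\<^esub> \<otimes>\<^bsub>?G\<^esub> A = A"
  proof -
    let ?r = "\<lambda>s. if s \<le> 1/2 then 0 else 2 * s - 1 :: real"
    have 1: "spheroid_homotopic k X a (spheroid_join (\<lambda>_. a) f) (\<lambda>x. f (x(0 := ?r (x 0))))"
      using edge [OF f(1)]
      by (intro spheroid_homotopic_eq join [OF const f(1)]) (simp add: spheroid_join_def)
    have "continuous_on {0..1} ?r"
      by (intro continuous_on_pw1 continuous_intros) auto
    then have "spheroid_homotopic k X a (\<lambda>x. f (x(0 := ?r (x 0)))) (\<lambda>x. f (x(0 := x 0)))"
      by (rule spheroid_homotopic_reparam [OF f(1) assms(1), where r' = "\<lambda>s. s"]) auto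
    with 1 have "spheroid_homotopic k X a (spheroid_join (\<lambda>_. a) f) (\<lambda>x. f (x(0 := x 0)))"
      by (rule spheroid_homotopic_trans)
    from spheroid_class_eq [OF this] show ?thesis
      by (simp add: one f(2) mult [OF const f(1)])
  qed
  show "\<exists>B\<in>carrier ?G. B \<otimes>\<^bsub>?G\<^esub> A = \<one>\<^bsub>?G\<^esub>"
  proof (rule bexI)
    let ?f = "\<lambda>x. f (x(0 := 1 - x 0))"
    let ?r = "\<lambda>s. if s \<le> 1/2 then 1 - 2 * s else 2 * s - 1 :: real"
    have "continuous_on {0..1} (\<lambda>s::real. 1 - s)"
      by (intro continuous_intros)
    then have "spheroid_homotopic k X a ?f ?f"
      by (intro spheroid_homotopic_reparam [OF f(1) assms(1), where r = "\<lambda>s. 1 - s" and r' = "\<lambda>s. 1 - s"]) auto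
    then have f': "spheroid k X a ?f" by simp
    then show "?c ?f \<in> carrier ?G" by (rule carrI)
    have 1: "spheroid_homotopic k X a (spheroid_join ?f f) (\<lambda>x. f (x(0 := ?r (x 0))))"
      by (intro spheroid_homotopic_eq join [OF f' f(1)]) (simp add: spheroid_join_def)
    have "continuous_on {0..1} ?r"
      by (intro continuous_on_pw1 continuous_intros) auto
    then have "spheroid_homotopic k X a (\<lambda>x. f (x(0 := ?r (x 0)))) (\<lambda>x. f (x(0 := 1)))"
      by (rule spheroid_homotopic_reparam [OF f(1) assms(1), where r' = "\<lambda>_. 1"]) auto
    note 2 = spheroid_homotopic_trans [OF 1 this]
    have "spheroid_homotopic k X a (\<lambda>_. a) (\<lambda>x. f (x(0 := 1)))"
      using edge [OF f(1)] by (intro spheroid_homotopic_eq const) simp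
    note 3 = spheroid_homotopic_trans [OF 2 spheroid_homotopic_sym [OF this]]
    from spheroid_class_eq [OF 3] show "?c ?f \<otimes>\<^bsub>?G\<^esub> A = \<one>\<^bsub>?G\<^esub>"
      by (simp add: one f(2) mult [OF f' f(1)])
  qed
  fix B assume "B \<in> carrier ?G"
  then obtain g where g: "spheroid k X a g" "B = ?c g" using carrE by blast
  show "A \<otimes>\<^bsub>?G\<^esub> B \<in> carrier ?G"
    by (simp add: f(2) g(2) mult [OF f(1) g(1)] carrI [OF join [OF f(1) g(1)]])
  fix C assume "C \<in> carrier ?G"
  then obtain h where h: "spheroid k X a h" "C = ?c h" using carrE by blast
  show "A \<otimes>\<^bsub>?G\<^esub> B \<otimes>\<^bsub>?G\<^esub> C = A \<otimes>\<^bsub>?G\<^esub> (B \<otimes>\<^bsub>?G\<^esub> C)"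
  proof -
    let ?j = "spheroid_join f (spheroid_join g h)"
    let ?r = "\<lambda>s. if s \<le> 1/2 then (if s \<le> 1/4 then 2 * s else s + 1/4) else s/2 + 1/2 :: real"
    note fg = join [OF f(1) g(1)] and gh = join [OF g(1) h(1)]
    note j = join [OF f(1) gh]
    have 1: "spheroid_homotopic k X a (spheroid_join (spheroid_join f g) h)
            (\<lambda>x. ?j (x(0 := ?r (x 0))))"
      by (intro spheroid_homotopic_eq join [OF fg h(1)])
         (auto simp: spheroid_join_def algebra_simps)
    have "continuous_on {0..1} ?r"
      by (intro continuous_on_pw1 continuous_intros) auto
    then have "spheroid_homotopic k X a (\<lambda>x. ?j (x(0 := ?r (x 0)))) (\<lambda>x. ?j (x(0 := x 0)))"
      by (rule spheroid_homotopic_reparam [OF j assms(1), where r' = "\<lambda>s. s"]) auto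
    note 2 = spheroid_homotopic_trans [OF 1 this]
    from spheroid_class_eq [OF 2] show ?thesis
      by (simp add: f(2) g(2) h(2) mult [OF f(1) g(1)] mult [OF g(1) h(1)]
          mult [OF fg h(1)] mult [OF f(1) gh])
  qed
qed

lemma spheroid_homotopic_compose:
  assumes "spheroid_homotopic k X a f g" "continuous_map X Y \<phi>" "\<phi> a = b"
  shows "spheroid_homotopic k Y b (\<phi> \<circ> f) (\<phi> \<circ> g)"
  using assms unfolding spheroid_homotopic_def
  by (auto intro: homotopic_with_compose_continuous_map_left)

lemma homotopy_hom_class:
  assumes "spheroid k X a f" "continuous_map X Y \<phi>" "\<phi> a = b"
  shows "homotopy_hom k Y b \<phi> (spheroid_class k X a f) = spheroid_class k Y b (\<phi> \<circ> f)"
proof -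
  have *: "spheroid_class k Y b (\<phi> \<circ> g) = spheroid_class k Y b (\<phi> \<circ> f)"
    if "g \<in> spheroid_class k X a f" for g
  proof -
    have "spheroid_homotopic k X a f g"
      using that by (simp add: spheroid_class_def)
    from spheroid_class_eq [OF spheroid_homotopic_compose [OF this assms(2,3)]] show ?thesis ..
  qed
  have "f \<in> spheroid_class k X a f"
    using assms by (simp add: spheroid_class_def)
  then have ne: "spheroid_class k X a f \<noteq> {}"
    by blast
  have "homotopy_hom k Y b \<phi> (spheroid_class k X a f) =
        (\<Union>g\<in>spheroid_class k X a f. spheroid_class k Y b (\<phi> \<circ> f))"
    unfolding homotopy_hom_def by (intro SUP_cong refl *)
  then show ?thesis
    using ne by simp
qed

lemma spheroid_compose:
  "spheroid k X a f \<Longrightarrow> continuous_map X Y \<phi> \<Longrightarrow> \<phi> a = b \<Longrightarrow> spheroid k Y b (\<phi> \<circ> f)"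
  using spheroid_homotopic_compose [of k X a f f] by simp

lemma homotopy_group_carrierE:
  assumes "A \<in> carrier (homotopy_group k X a)"
  obtains f where "spheroid k X a f" "A = spheroid_class k X a f"
  using assms by (auto simp: homotopy_group_def)

theorem homotopy_hom:
  assumes "1 \<le> k" "continuous_map X Y \<phi>" "\<phi> a = b"
  shows "homotopy_hom k Y b \<phi> \<in> hom (homotopy_group k X a) (homotopy_group k Y b)"
proof (rule homI)
  note comp = spheroid_compose [OF _ assms(2,3)] and cls = homotopy_hom_class [OF _ assms(2,3)]
  fix A assume "A \<in> carrier (homotopy_group k X a)"
  then obtain f where f: "spheroid k X a f" "A = spheroid_class k X a f"
    by (rule homotopy_group_carrierE)
  show "homotopy_hom k Y b \<phi> A \<in> carrier (homotopy_group k Y b)"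
    unfolding f(2) cls [OF f(1)] using comp [OF f(1)] by (simp add: homotopy_group_def)
  fix B assume "B \<in> carrier (homotopy_group k X a)"
  then obtain g where g: "spheroid k X a g" "B = spheroid_class k X a g"
    by (rule homotopy_group_carrierE)
  have "\<phi> \<circ> spheroid_join f g = spheroid_join (\<phi> \<circ> f) (\<phi> \<circ> g)"
    by (rule ext) (simp add: spheroid_join_def)
  then show "homotopy_hom k Y b \<phi> (A \<otimes>\<^bsub>homotopy_group k X a\<^esub> B) =
        homotopy_hom k Y b \<phi> A \<otimes>\<^bsub>homotopy_group k Y b\<^esub> homotopy_hom k Y b \<phi> B"
    unfolding f(2) g(2) cls [OF f(1)] cls [OF g(1)]
      homotopy_group_mult [OF f(1) g(1) assms(1)]
      homotopy_group_mult [OF comp [OF f(1)] comp [OF g(1)] assms(1)]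
      cls [OF spheroid_join [OF f(1) g(1) assms(1)]]
    by simp
qed

lemma homotopy_hom_id:
  assumes "A \<in> carrier (homotopy_group k X a)" "\<And>x. x \<in> topspace X \<Longrightarrow> \<phi> x = x" "\<phi> a = a"
  shows "homotopy_hom k X a \<phi> A = A"
proof -
  obtain f where f: "spheroid k X a f" "A = spheroid_class k X a f"
    using assms(1) by (rule homotopy_group_carrierE)
  have \<phi>: "continuous_map X X \<phi>"
    by (rule continuous_map_eq [OF continuous_map_id]) (simp add: assms(2))
  have "f ` topspace (unit_cube k) \<subseteq> topspace X"
    using f(1) continuous_map_image_subset_topspace unfolding spheroid_def by blast
  then have "spheroid_homotopic k X a f (\<phi> \<circ> f)"
    by (intro spheroid_homotopic_eq f) (simp add: assms(2) image_subset_iff)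
  from spheroid_class_eq [OF this] show ?thesis
    unfolding f(2) homotopy_hom_class [OF f(1) \<phi> assms(3)] ..
qed

lemma homotopy_hom_compose:
  assumes "A \<in> carrier (homotopy_group k X a)" "continuous_map X Y \<phi>" "\<phi> a = b"
    "continuous_map Y W \<psi>" "\<psi> b = c" "continuous_map X W \<theta>" "\<theta> a = c"
    "\<And>x. x \<in> topspace X \<Longrightarrow> \<psi> (\<phi> x) = \<theta> x"
  shows "homotopy_hom k W c \<psi> (homotopy_hom k Y b \<phi> A) = homotopy_hom k W c \<theta> A"
proof -
  obtain f where f: "spheroid k X a f" "A = spheroid_class k X a f"
    using assms(1) by (rule homotopy_group_carrierE)
  have "f ` topspace (unit_cube k) \<subseteq> topspace X"
    using f(1) continuous_map_image_subset_topspace unfolding spheroid_def by blast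
  then have "spheroid_homotopic k W c (\<theta> \<circ> f) (\<psi> \<circ> (\<phi> \<circ> f))"
    by (intro spheroid_homotopic_eq spheroid_compose [OF f(1) assms(6,7)])
       (simp add: assms(8) image_subset_iff)
  from spheroid_class_eq [OF this] show ?thesis
    by (simp add: f(2) homotopy_hom_class [OF f(1) assms(2,3)] homotopy_hom_class [OF f(1) assms(6,7)]
        homotopy_hom_class [OF spheroid_compose [OF f(1) assms(2,3)] assms(4,5)])
qed


section \<open>The Mittag-Leffler condition\<close>

definition inverse_system_of_groups ::
    "'i::order set \<Rightarrow> ('i \<Rightarrow> 'g monoid) \<Rightarrow> ('i \<Rightarrow> 'i \<Rightarrow> 'g \<Rightarrow> 'g) \<Rightarrow> bool" where
  "inverse_system_of_groups I G h \<longleftrightarrow>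
     directed_set I \<and>
     (\<forall>i\<in>I. group (G i)) \<and>
     (\<forall>i\<in>I. \<forall>j\<in>I. i \<le> j \<longrightarrow> h j i \<in> hom (G j) (G i)) \<and>
     (\<forall>i\<in>I. \<forall>x\<in>carrier (G i). h i i x = x) \<and>
     (\<forall>i\<in>I. \<forall>j\<in>I. \<forall>l\<in>I. i \<le> j \<longrightarrow> j \<le> l \<longrightarrow> (\<forall>x\<in>carrier (G l). h j i (h l j x) = h l i x))"

text \<open>A family of inverse systems of groups over the same index set, with parameter \<open>k \<in> S\<close>; the
  stabilization index \<open>j\<close> does not depend on \<open>k\<close>.\<close>

definition uniformly_Mittag_Leffler ::
    "'k set \<Rightarrow> 'i::order set \<Rightarrow> ('k \<Rightarrow> 'i \<Rightarrow> 'g monoid) \<Rightarrow> ('k \<Rightarrow> 'i \<Rightarrow> 'i \<Rightarrow> 'g \<Rightarrow> 'g) \<Rightarrow> bool" where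
  "uniformly_Mittag_Leffler S I G h \<longleftrightarrow>
     (\<forall>k\<in>S. inverse_system_of_groups I (G k) (h k)) \<and>
     (\<forall>i\<in>I. \<exists>j\<in>I. i \<le> j \<and>
        (\<forall>k\<in>S. \<forall>l\<in>I. j \<le> l \<longrightarrow>
           h k l i ` carrier (G k l) = h k j i ` carrier (G k j)))"

end

theory Submission
  imports Defs "HOL-Algebra.Coset"
begin

text \<open>
  Call a space equiconnected near a compact set \<open>K\<close> if the two projections are homotopic on some
  neighbourhood of the diagonal of \<open>K\<close>. No condition is imposed on the diagonal itself, which makes
  this property invariant under homotopy domination and stable under gluing; so it passes from a
  skeleton of a CW complex to the next one, and by an infinite radial deformation to the whole complex.

  Near \<open>\<zeta>\<close>, equiconnectedness of \<open>C\<close> gives a contraction, and the loops it traces in \<open>Z \<kappa>\<close> are close to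
  each other, hence homotopic by equiconnectedness of \<open>Z \<kappa>\<close>. Lifting these homotopies shows that for
  every compact \<open>\<kappa>\<close> there is a compact \<open>l \<ge> \<kappa>\<close> such that the fibre of \<open>C\<close> over \<open>\<zeta>\<^sub>l\<close> contracts inside the
  fibre over \<open>\<zeta>\<^sub>\<kappa>\<close>. The contraction does not refer to any dimension, whence the uniformity: a spheroid
  of \<open>Z m\<close>, \<open>m \<ge> l\<close>, lifted to \<open>Z\<close> has its boundary in the fibre over \<open>\<zeta>\<^sub>l\<close>, and contracting this
  boundary does not change the projection to \<open>Z \<kappa>\<close>. In the countable case the contractions allow to
  join \<open>\<zeta>\<close> to a point of a phantom component by infinitely many paths lying in smaller and smaller
  fibres.
\<close>

section \<open>Homotopies as families of paths\<close>

text \<open>The recurring obstacle is that the homotopies are not stationary where it would be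
  convenient: equiconnecting homotopies may move the diagonal, and a homotopy lifted freely through
  a fibration moves the end points of paths and the base points of spheroids. For paths the remedy
  is to continue with the reverse of a path that has the same projection. The composite then
  projects, up to constant pieces, to some path followed by its reverse, which contracts with fixed
  end points by reparametrization alone, and \<open>squeeze\<close> transfers this contraction to
  the total space.

  Equiconnectedness is localized at compact sets for two reasons. A compact subset of a CW complex
  lies in a skeleton, so finitely many gluing steps suffice before a neighbourhood of that skeleton
  is deformed into it. And the only sets at which the property is used later are the point \<zeta>
  in C and the track of \<zeta> in \<open>Z \<kappa>\<close>, both compact.\<close>

abbreviation cyl :: "'a topology \<Rightarrow> (real \<times> 'a) topology" where
  "cyl X \<equiv> prod_topology (top_of_set {0..1::real}) X"

abbreviation homotopic :: "'a topology \<Rightarrow> 'b topology \<Rightarrow> ('a \<Rightarrow> 'b) \<Rightarrow> ('a \<Rightarrow> 'b) \<Rightarrow> bool" where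
  "homotopic \<equiv> homotopic_with (\<lambda>_. True)"

lemma homotopic_iff:
  "homotopic X Y f g \<longleftrightarrow>
     (\<exists>h. continuous_map (cyl X) Y h \<and> (\<forall>x\<in>topspace X. h (0, x) = f x) \<and>
          (\<forall>x\<in>topspace X. h (1, x) = g x))"
  by (subst homotopic_with) auto

lemma homotopicI:
  assumes "continuous_map (cyl X) Y h" "\<And>x. x \<in> topspace X \<Longrightarrow> h (0, x) = f x"
    "\<And>x. x \<in> topspace X \<Longrightarrow> h (1, x) = g x"
  shows "homotopic X Y f g"
  using assms unfolding homotopic_iff by blast

lemma homotopicE:
  assumes "homotopic X Y f g"
  obtains h where "continuous_map (cyl X) Y h" "\<And>x. x \<in> topspace X \<Longrightarrow> h (0, x) = f x"
    "\<And>x. x \<in> topspace X \<Longrightarrow> h (1, x) = g x"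
  using assms unfolding homotopic_iff by blast

lemma continuous_map_fst_cyl: "continuous_map (cyl X) euclideanreal fst"
  using continuous_map_fst continuous_map_in_subtopology by blast

lemma continuous_map_cylI:
  assumes "continuous_map T euclideanreal s" "\<And>z. z \<in> topspace T \<Longrightarrow> 0 \<le> s z \<and> s z \<le> 1"
    "continuous_map T X g"
  shows "continuous_map T (cyl X) (\<lambda>z. (s z, g z))"
  using assms by (simp add: continuous_map_pairwise o_def continuous_map_in_subtopology image_subset_iff)

lemma continuous_map_cyl_compose:
  assumes "continuous_map (cyl X) Y h"
    "continuous_map T euclideanreal s" "\<And>z. z \<in> topspace T \<Longrightarrow> 0 \<le> s z \<and> s z \<le> 1"
    "continuous_map T X g"
  shows "continuous_map T Y (\<lambda>z. h (s z, g z))"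
  using continuous_map_compose [OF continuous_map_cylI [OF assms(2-4)] assms(1)] by (simp add: o_def)

lemma continuous_map_cyl_at:
  assumes "continuous_map (cyl X) Y h" "t \<in> {0..1}"
  shows "continuous_map X Y (\<lambda>x. h (t, x))"
  using assms by (intro continuous_map_cyl_compose [OF assms(1)]) auto

lemma continuous_map_cyl_in:
  assumes "continuous_map (cyl X) Y h" "t \<in> {0..1}" "x \<in> topspace X"
  shows "h (t, x) \<in> topspace Y"
  using continuous_map_image_subset_topspace [OF assms(1)] assms(2,3) by auto

lemma continuous_map_cyl_path:
  assumes "continuous_map (cyl X) Y h" "x \<in> topspace X"
  shows "pathin Y (\<lambda>t. h (t, x))"
  unfolding pathin_def
  by (rule continuous_map_cyl_compose [OF assms(1)]) (use assms in \<open>auto simp: continuous_map_in_subtopology\<close>)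

definition conc :: "(real \<times> 'a \<Rightarrow> 'b) \<Rightarrow> (real \<times> 'a \<Rightarrow> 'b) \<Rightarrow> real \<times> 'a \<Rightarrow> 'b" where
  "conc f g = (\<lambda>(t, x). if t \<le> 1/2 then f (2 * t, x) else g (2 * t - 1, x))"

definition rev_path :: "(real \<times> 'a \<Rightarrow> 'b) \<Rightarrow> real \<times> 'a \<Rightarrow> 'b" where
  "rev_path f = (\<lambda>(t, x). f (1 - t, x))"

lemma conc_0 [simp]: "conc f g (0, x) = f (0, x)"
  and conc_1 [simp]: "conc f g (1, x) = g (1, x)"
  by (simp_all add: conc_def)

lemma rev_path_0 [simp]: "rev_path f (0, x) = f (1, x)"
  and rev_path_1 [simp]: "rev_path f (1, x) = f (0, x)"
  by (simp_all add: rev_path_def)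

lemma continuous_map_conc:
  assumes f: "continuous_map (cyl X) Y f" and g: "continuous_map (cyl X) Y g"
    and fg: "\<And>x. x \<in> topspace X \<Longrightarrow> f (1, x) = g (0, x)"
  shows "continuous_map (cyl X) Y (conc f g)"
proof -
  have "continuous_map (cyl X) Y (\<lambda>z. if fst z \<le> 1/2 then f (2 * fst z, snd z) else g (2 * fst z - 1, snd z))"
  proof (rule continuous_map_cases_le)
    let ?A = "{x \<in> topspace (cyl X). fst x \<le> 1/2}"
    let ?B = "{x \<in> topspace (cyl X). 1/2 \<le> fst x}"
    show "continuous_map (subtopology (cyl X) ?A) Y (\<lambda>z. f (2 * fst z, snd z))"
      by (intro continuous_map_cyl_compose [OF f] continuous_intros continuous_map_from_subtopology
          continuous_map_fst_cyl continuous_map_snd) auto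
    show "continuous_map (subtopology (cyl X) ?B) Y (\<lambda>z. g (2 * fst z - 1, snd z))"
      by (intro continuous_map_cyl_compose [OF g] continuous_intros continuous_map_from_subtopology
          continuous_map_fst_cyl continuous_map_snd) auto
  next
    fix z assume "z \<in> topspace (cyl X)" "fst z = 1/2"
    moreover from this have "2 * fst z = 1" by simp
    ultimately show "f (2 * fst z, snd z) = g (2 * fst z - 1, snd z)"
      using fg [of "snd z"] by (simp only: diff_self) auto
  qed (use continuous_map_fst_cyl in auto)
  then show ?thesis
    by (simp add: conc_def case_prod_beta')
qed

lemma continuous_map_rev_path:
  assumes "continuous_map (cyl X) Y f"
  shows "continuous_map (cyl X) Y (rev_path f)"
proof -
  have "continuous_map (cyl X) Y (\<lambda>z. f (1 - fst z, snd z))"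
    by (intro continuous_map_cyl_compose [OF assms] continuous_intros
        continuous_map_fst_cyl continuous_map_snd) auto
  then show ?thesis
    by (simp add: rev_path_def case_prod_beta')
qed

text \<open>A homotopy on a space carrying the weak topology of a family of maps is continuous once it is
  so on each member: the interval is compact, so the tube lemma replaces the exponential law.\<close>

lemma continuous_map_cyl_weak:
  fixes \<Phi> :: "'i \<Rightarrow> 'd \<Rightarrow> 'a"
  assumes cover: "topspace X = (\<Union>i\<in>I. \<Phi> i ` topspace (D i))"
    and weak: "\<And>U. U \<subseteq> topspace X \<Longrightarrow>
        (\<And>i. i \<in> I \<Longrightarrow> openin (D i) {v \<in> topspace (D i). \<Phi> i v \<in> U}) \<Longrightarrow> openin X U"
    and N: "openin X N"
    and Ncont: "\<And>i. i \<in> I \<Longrightarrow> openin (D i) {v \<in> topspace (D i). \<Phi> i v \<in> N}"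
    and f: "\<And>i. i \<in> I \<Longrightarrow> continuous_map (cyl (subtopology (D i) {v. \<Phi> i v \<in> N})) Y (\<lambda>z. f (fst z, \<Phi> i (snd z)))"
  shows "continuous_map (cyl (subtopology X N)) Y f"
proof -
  let ?J = "top_of_set {0..1::real}"
  have N': "N \<subseteq> topspace X"
    using N openin_subset by blast
  have im: "f (t, x) \<in> topspace Y" if "t \<in> {0..1}" "x \<in> N" for t x
  proof -
    obtain i v where "i \<in> I" "v \<in> topspace (D i)" "x = \<Phi> i v"
      using cover N' \<open>x \<in> N\<close> by auto
    then have "(t, v) \<in> topspace (cyl (subtopology (D i) {v. \<Phi> i v \<in> N}))"
      using that by simp
    then have "f (fst (t, v), \<Phi> i (snd (t, v))) \<in> topspace Y"
      using continuous_map_image_subset_topspace [OF f [OF \<open>i \<in> I\<close>]] by (simp only: image_subset_iff)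
    then show ?thesis
      using \<open>x = \<Phi> i v\<close> by simp
  qed
  show ?thesis
  proof (subst continuous_map, intro conjI allI impI)
    show "f ` topspace (cyl (subtopology X N)) \<subseteq> topspace Y"
      using im by auto
    fix V assume V: "openin Y V"
    let ?P = "{z \<in> topspace (cyl (subtopology X N)). f z \<in> V}"
    have "\<exists>S. openin (cyl (subtopology X N)) S \<and> z0 \<in> S \<and> S \<subseteq> ?P" if z0: "z0 \<in> ?P" for z0
    proof -
      obtain t0 x0 where tx: "z0 = (t0, x0)" "t0 \<in> {0..1}" "x0 \<in> N" "f (t0, x0) \<in> V"
        using z0 by auto
      obtain i v where iv: "i \<in> I" "v \<in> topspace (D i)" "x0 = \<Phi> i v"
        using cover N' tx by auto
      have pre: "openin (cyl (subtopology (D j) {v. \<Phi> j v \<in> N}))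
          {z \<in> topspace (cyl (subtopology (D j) {v. \<Phi> j v \<in> N})). f (fst z, \<Phi> j (snd z)) \<in> V}"
        (is "openin _ (?Q j)") if "j \<in> I" for j
        using openin_continuous_map_preimage [OF f [OF that] V] .
      have "(t0, v) \<in> ?Q i"
        using tx iv by auto
      from pre [OF iv(1), unfolded openin_prod_topology_alt, rule_format, OF this]
      obtain A B where AB: "openin ?J A" "openin (subtopology (D i) {v. \<Phi> i v \<in> N}) B"
          "t0 \<in> A" "v \<in> B" "A \<times> B \<subseteq> ?Q i"
        by blast
      obtain A' where A': "open A'" "A = {0..1} \<inter> A'"
        using AB(1) by (metis openin_open Int_commute)
      obtain e where e: "e > 0" "cball t0 e \<subseteq> A'"
        using A' AB(3) open_contains_cball by blast
      \<comment> \<open>A compact neighbourhood \<open>K\<close> of \<open>t0\<close> replaces the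
        open set \<open>A\<close>, so that the tube lemma applies along
        \<open>K \<times> {w}\<close> in every member of the family.\<close>
      define K where "K = cball t0 e \<inter> {0..1}"
      have K: "compact K" "K \<subseteq> A" "K \<subseteq> {0..1}"
        using e A' by (auto simp: K_def compact_Int_closed)
      \<comment> \<open>\<open>B\<close> is a neighbourhood in the single member \<open>D i\<close>;
        \<open>G\<close> is given by a condition on points of \<open>X\<close>, so its openness can
        be tested in every \<open>D j\<close>.\<close>
      define G where "G = {x \<in> N. \<forall>t\<in>K. f (t, x) \<in> V}"
      have "openin X G"
      proof (rule weak)
        show "G \<subseteq> topspace X" using N' G_def by auto
        fix j assume j: "j \<in> I"
        let ?D = "subtopology (D j) {v. \<Phi> j v \<in> N}"
        have oD: "openin (D j) (topspace ?D)"
          using Ncont [OF j] by (simp add: Int_def)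
        show "openin (D j) {v \<in> topspace (D j). \<Phi> j v \<in> G}"
        proof (subst openin_subopen, intro ballI)
          fix w assume w: "w \<in> {v \<in> topspace (D j). \<Phi> j v \<in> G}"
          have 1: "compactin ?J K"
            using K by (simp add: compactin_subtopology)
          have 2: "K \<times> {w} \<subseteq> ?Q j"
            using w K by (auto simp: G_def)
          have 3: "w \<in> topspace ?D"
            using w by (auto simp: G_def)
          obtain U W where UW: "openin ?J U" "openin ?D W" "K \<subseteq> U" "w \<in> W" "U \<times> W \<subseteq> ?Q j"
            using tube_lemma_left [OF pre [OF j] 1 3 2] by blast
          have "openin (D j) W"
          proof -
            obtain T where T: "openin (D j) T" "W = T \<inter> {v. \<Phi> j v \<in> N}"
              using UW(2) by (auto simp: openin_subtopology)
            then have "W = T \<inter> topspace ?D"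
              using openin_subset [OF T(1)] by auto
            then show ?thesis using T(1) oD by blast
          qed
          moreover have "W \<subseteq> {v \<in> topspace (D j). \<Phi> j v \<in> G}"
          proof
            fix y assume y: "y \<in> W"
            have yD: "y \<in> topspace ?D" using y UW(2) openin_subset by blast
            have "f (t, \<Phi> j y) \<in> V" if "t \<in> K" for t
            proof -
              have "(t, y) \<in> ?Q j" using UW(3,5) that y by blast
              then show ?thesis by simp
            qed
            then show "y \<in> {v \<in> topspace (D j). \<Phi> j v \<in> G}"
              using yD by (auto simp: G_def)
          qed
          ultimately show "\<exists>T. openin (D j) T \<and> w \<in> T \<and> T \<subseteq> {v \<in> topspace (D j). \<Phi> j v \<in> G}"
            using UW(4) by blast
        qed
      qed
      then have oG: "openin (subtopology X N) G"
        by (simp add: G_def N openin_open_subtopology)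
      have oB: "openin ?J (ball t0 e \<inter> {0..1})"
        unfolding openin_open by (intro exI [of _ "ball t0 e"]) auto
      show ?thesis
      proof (intro exI conjI)
        show "openin (cyl (subtopology X N)) ((ball t0 e \<inter> {0..1}) \<times> G)"
          using oG oB by (simp add: openin_prod_Times_iff)
        have "f (t, x0) \<in> V" if "t \<in> K" for t
        proof -
          have "(t, v) \<in> ?Q i" using AB(4,5) that K by blast
          then show ?thesis by (simp add: iv)
        qed
        then show "z0 \<in> (ball t0 e \<inter> {0..1}) \<times> G"
          using tx e by (auto simp: G_def)
        show "(ball t0 e \<inter> {0..1}) \<times> G \<subseteq> ?P"
          using N' by (auto simp: G_def K_def)
      qed
    qed
    then show "openin (cyl (subtopology X N)) ?P"
      by (subst openin_subopen) blast
  qed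
qed

section \<open>Local equiconnectedness\<close>

definition equiconnected_near :: "'a topology \<Rightarrow> 'a set \<Rightarrow> bool" where
  "equiconnected_near X K \<longleftrightarrow>
     (\<exists>W. openin (prod_topology X X) W \<and> (\<forall>x\<in>K. (x, x) \<in> W) \<and>
          homotopic (subtopology (prod_topology X X) W) X fst snd)"

lemma equiconnected_near_mono:
  "equiconnected_near X K \<Longrightarrow> K' \<subseteq> K \<Longrightarrow> equiconnected_near X K'"
  by (auto simp: equiconnected_near_def subset_iff)

lemma continuous_map_cyl_openin_Un:
  assumes "\<And>i. i \<in> I \<Longrightarrow> openin P (T i)"
    and "\<And>i. i \<in> I \<Longrightarrow> continuous_map (cyl (subtopology P (T i))) Y h"
  shows "continuous_map (cyl (subtopology P (\<Union>i\<in>I. T i))) Y h"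
proof (rule pasting_lemma [where f = "\<lambda>_. h"])
  let ?U = "\<Union>i\<in>I. T i"
  fix i assume i: "i \<in> I"
  show "openin (cyl (subtopology P ?U)) ({0..1} \<times> T i)"
    using assms(1) [OF i] i by (auto simp: openin_prod_Times_iff openin_subtopology)
  have "subtopology (cyl (subtopology P ?U)) ({0..1} \<times> T i) = cyl (subtopology P (T i))"
  proof -
    have "({0..1} \<times> ?U) \<inter> ({0..1::real} \<times> T i) = {0..1} \<times> T i"
      using i by auto
    then show ?thesis
      by (simp add: subtopology_Times [symmetric] subtopology_subtopology)
  qed
  then show "continuous_map (subtopology (cyl (subtopology P ?U)) ({0..1} \<times> T i)) Y h"
    using assms(2) [OF i] by simp
qed auto

text \<open>\<open>x\<close> and \<open>y\<close> are joined through \<open>g (f x)\<close> and \<open>g (f y)\<close>.\<close>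

lemma equiconnected_near_dominated:
  assumes N: "openin X N" and f: "continuous_map (subtopology X N) X' f" and g: "continuous_map X' X g"
    and gf: "homotopic (subtopology X N) X (g \<circ> f) id" and "K \<subseteq> N"
    and X': "equiconnected_near X' (f ` K)"
  shows "equiconnected_near X K"
proof -
  obtain W' where W': "openin (prod_topology X' X') W'" "\<forall>x\<in>f ` K. (x, x) \<in> W'"
      "homotopic (subtopology (prod_topology X' X') W') X' fst snd"
    using X' by (auto simp: equiconnected_near_def)
  let ?P = "prod_topology X X"
  let ?NN = "subtopology ?P (N \<times> N)"
  let ?ff = "\<lambda>z. (f (fst z), f (snd z))"
  have NN: "?NN = prod_topology (subtopology X N) (subtopology X N)"
    by (rule subtopology_Times)
  have fst: "continuous_map ?NN (subtopology X N) fst" and snd: "continuous_map ?NN (subtopology X N) snd"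
    unfolding NN by (rule continuous_map_fst continuous_map_snd)+
  have ff: "continuous_map ?NN (prod_topology X' X') ?ff"
    using continuous_map_compose [OF fst f] continuous_map_compose [OF snd f]
    by (simp add: continuous_map_pairwise o_def)
  define W where "W = {z \<in> topspace ?NN. ?ff z \<in> W'}"
  have "openin ?NN W"
    unfolding W_def using openin_continuous_map_preimage [OF ff W'(1)] .
  then have oW: "openin ?P W"
    by (rule openin_trans_full) (simp add: openin_prod_Times_iff N)
  have sub: "subtopology ?P W = subtopology ?NN W"
  proof -
    have "W \<subseteq> N \<times> N" by (auto simp: W_def NN)
    then show ?thesis by (simp add: subtopology_subtopology Int_absorb1)
  qed
  have fst': "continuous_map (subtopology ?P W) (subtopology X N) fst"
    and snd': "continuous_map (subtopology ?P W) (subtopology X N) snd"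
    unfolding sub using fst snd by (simp_all add: continuous_map_from_subtopology)
  have ff': "continuous_map (subtopology ?P W) (subtopology (prod_topology X' X') W') ?ff"
    unfolding sub continuous_map_in_subtopology
    using ff by (auto simp: continuous_map_from_subtopology W_def)
  have "homotopic (subtopology ?P W) X fst (\<lambda>z. g (f (fst z)))"
    using homotopic_with_compose_continuous_map_right [OF gf fst']
    by (subst homotopic_with_sym) (simp add: o_def)
  moreover have "homotopic (subtopology ?P W) X (\<lambda>z. g (f (fst z))) (\<lambda>z. g (f (snd z)))"
    using homotopic_with_compose_continuous_map_left
        [OF homotopic_with_compose_continuous_map_right [OF W'(3) ff'] g]
    by (simp add: o_def)
  moreover have "homotopic (subtopology ?P W) X (\<lambda>z. g (f (snd z))) snd"
    using homotopic_with_compose_continuous_map_right [OF gf snd'] by (simp add: o_def)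
  ultimately have "homotopic (subtopology ?P W) X fst snd"
    using homotopic_with_trans by blast
  moreover have "(x, x) \<in> W" if "x \<in> K" for x
    using that W'(2) \<open>K \<subseteq> N\<close> openin_subset [OF N] by (auto simp: W_def)
  ultimately show ?thesis
    using oW unfolding equiconnected_near_def by blast
qed

text \<open>The new path from \<open>x\<close> to \<open>y\<close> first follows \<open>eB\<close> up to the time \<open>u\<close>, reaching a point \<open>z\<close>, then
  runs back and forth along a part of the loop \<open>eA (\<cdot>, z, z)\<close>, and ends with \<open>eA (\<cdot>, z, y)\<close>. Where \<open>u = 1\<close>
  we have \<open>z = y\<close>, so the excursion can be shrunk by the cutoff \<open>\<tau>\<close> before \<open>eA\<close> ceases to exist.\<close>

lemma equiconnected_near_glue:
  fixes b :: "'a \<Rightarrow> real"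
  assumes b: "continuous_map X euclideanreal b"
    and WA: "openin (prod_topology X X) WA" "\<And>x. x \<in> topspace X \<Longrightarrow> b x < 1 \<Longrightarrow> (x, x) \<in> WA"
      "\<And>z. z \<in> WA \<Longrightarrow> b (fst z) < 1"
    and eA: "continuous_map (cyl (subtopology (prod_topology X X) WA)) X eA"
      "\<And>z. z \<in> WA \<Longrightarrow> eA (0, z) = fst z" "\<And>z. z \<in> WA \<Longrightarrow> eA (1, z) = snd z"
    and WB: "openin (prod_topology X X) WB" "\<And>x. x \<in> topspace X \<Longrightarrow> 0 < b x \<Longrightarrow> (x, x) \<in> WB"
    and eB: "continuous_map (cyl (subtopology (prod_topology X X) WB)) X eB"
      "\<And>z. z \<in> WB \<Longrightarrow> eB (0, z) = fst z" "\<And>z. z \<in> WB \<Longrightarrow> eB (1, z) = snd z"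
      "\<And>x t. (x, x) \<in> WB \<Longrightarrow> t \<in> {0..1} \<Longrightarrow> eB (t, (x, x)) = x"
  shows "equiconnected_near X (topspace X)"
proof -
  let ?P = "prod_topology X X"
  \<comment> \<open>\<open>u\<close> grows from 0 to 1 while \<open>b\<close> goes from 1/3 to 2/3,
    and \<tau> drops from 1 to 0 between 2/3 and 5/6. Hence \<tau> varies only where
    \<open>u = 1\<close>.\<close>
  define u where "u z = max 0 (min 1 (3 * b (fst z) - 1))" for z :: "'a \<times> 'a"
  define \<tau> where "\<tau> z = max 0 (min 1 (5 - 6 * b (fst z)))" for z :: "'a \<times> 'a"
  have u01: "0 \<le> u z" "u z \<le> 1" and \<tau>01: "0 \<le> \<tau> z" "\<tau> z \<le> 1" for z
    by (auto simp: u_def \<tau>_def)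
  have bf: "continuous_map ?P euclideanreal (\<lambda>z. b (fst z))"
    using continuous_map_compose [OF continuous_map_fst b] by (simp add: o_def)
  have uc: "continuous_map ?P euclideanreal u" and \<tau>c: "continuous_map ?P euclideanreal \<tau>"
    unfolding u_def [abs_def] \<tau>_def [abs_def] using bf by (intro continuous_intros; simp)+
  \<comment> \<open>The intermediate point. Its value outside \<open>WB\<close> matters only on
    \<open>O1\<close>, where \<open>u = 0\<close> and \<open>eB\<close> would give
    \<open>fst z\<close> as well.\<close>
  define m where "m z = (if z \<in> WB then eB (u z, z) else fst z)" for z
  \<comment> \<open>On \<open>O1\<close> only \<open>eA\<close> is guaranteed to exist, on
    \<open>O2\<close> both homotopies, on \<open>O3\<close> only \<open>eB\<close>. The diagonal
    points with 0 < b < 1 lie in \<open>O2\<close> because \<open>eB\<close> is constant on the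
    diagonal.\<close>
  define O1 where "O1 = {z \<in> topspace ?P. b (fst z) < 1/3} \<inter> WA"
  define O2 where "O2 = {z \<in> topspace (subtopology ?P WB). (eB (u z, z), snd z) \<in> WA}"
  define O3 where "O3 = {z \<in> topspace ?P. b (fst z) > 5/6} \<inter> WB"
  have eBu: "continuous_map (subtopology ?P WB) X (\<lambda>z. eB (u z, z))"
    by (rule continuous_map_cyl_compose [OF eB(1)])
       (use u01 continuous_map_id [of "subtopology ?P WB", unfolded id_def] uc in
         \<open>auto simp: continuous_map_from_subtopology\<close>)
  have sub: "WA \<subseteq> topspace ?P" "WB \<subseteq> topspace ?P"
    using WA(1) WB(1) openin_subset by blast+
  have "openin ?P {z \<in> topspace ?P. b (fst z) \<in> {..<1/3}}" "openin ?P {z \<in> topspace ?P. b (fst z) \<in> {5/6<..}}"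
    by (rule openin_continuous_map_preimage [OF bf]; simp)+
  then have O1: "openin ?P O1" and O3: "openin ?P O3"
    using WA(1) WB(1) by (auto simp: O1_def O3_def)
  have "openin (subtopology ?P WB) O2"
    unfolding O2_def
    by (rule openin_continuous_map_preimage [OF _ WA(1)])
       (use eBu in \<open>auto simp: continuous_map_pairwise o_def continuous_map_from_subtopology continuous_map_snd\<close>)
  then have O2: "openin ?P O2"
    using WB(1) openin_trans_full by blast
  define O' where "O' = (\<lambda>i::nat. if i = 0 then O1 else if i = 1 then O2 else O3)"
  define W where "W = (\<Union>i\<in>{0,1,2}. O' i)"
  have W: "W = O1 \<union> O2 \<union> O3"
    by (auto simp: W_def O'_def)
  have oO: "openin ?P (O' i)" for i
    by (simp add: O'_def O1 O2 O3)
  have paste: "continuous_map (cyl (subtopology ?P W)) X h"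
    if "continuous_map (cyl (subtopology ?P O1)) X h" "continuous_map (cyl (subtopology ?P O2)) X h"
      "continuous_map (cyl (subtopology ?P O3)) X h" for h
    unfolding W_def
    by (rule continuous_map_cyl_openin_Un [OF oO]) (use that in \<open>auto simp: O'_def\<close>)
  have m1: "m z = fst z" if "z \<in> O1" for z
    using that eB(2) by (auto simp: m_def O1_def u_def)
  have m2: "(m z, snd z) \<in> WA" "z \<in> WB" if "z \<in> O2" for z
    using that by (auto simp: m_def O2_def)
  have m3: "z \<in> WB" "m z = snd z" "u z = 1" "\<tau> z = 0" if "z \<in> O3" for z
    using that eB(3) by (auto simp: m_def O3_def u_def \<tau>_def)
  have m4: "m z = snd z" if "z \<in> WB" "2/3 \<le> b (fst z)" for z
    using that eB(3) by (auto simp: m_def u_def)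
  \<comment> \<open>\<open>(m z, snd z)\<close> lies in \<open>WA\<close>, so
    \<open>b (m z) < 1\<close>, and this brings the diagonal point at \<open>m z\<close> back into
    \<open>WA\<close>.\<close>
  have mWA: "(m z, m z) \<in> WA" if "z \<in> O1 \<union> O2" for z
  proof (rule WA(2))
    have *: "(m z, snd z) \<in> WA" using m2(1) [of z] m1 [of z] that by (auto simp: O1_def)
    show "m z \<in> topspace X" using * sub by auto
    show "b (m z) < 1" using WA(3) [OF *] by simp
  qed
  have mWA': "(m z, snd z) \<in> WA" if "z \<in> O1 \<union> O2" for z
    using m2(1) [of z] m1 [of z] that by (auto simp: O1_def)
  let ?C = "\<lambda>S. cyl (subtopology ?P S)"
  have cf: "continuous_map (?C S) euclideanreal (\<lambda>z. fst z)" for S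
    by (rule continuous_map_fst_cyl)
  have cs: "continuous_map (?C S) Y (\<lambda>z. f (snd z))" if "continuous_map (subtopology ?P S) Y f" for S f and Y :: "'z topology"
    using continuous_map_compose [OF continuous_map_snd that] by (simp add: o_def)
  have cu: "continuous_map (?C S) euclideanreal (\<lambda>z. u (snd z))"
    and c\<tau>: "continuous_map (?C S) euclideanreal (\<lambda>z. \<tau> (snd z))" for S
    by (intro cs continuous_map_from_subtopology uc \<tau>c)+
  have cfst: "continuous_map (subtopology ?P S) X fst" and csnd: "continuous_map (subtopology ?P S) X snd" for S
    by (simp_all add: continuous_map_from_subtopology continuous_map_fst continuous_map_snd)
  have mc: "continuous_map (subtopology ?P S) X m" if "S = O1 \<or> S = O2" for S
    using that
  proof
    assume "S = O1"
    then show ?thesis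
      by (intro continuous_map_eq [OF cfst]) (auto simp: m1)
  next
    assume S: "S = O2"
    have "continuous_map (subtopology (subtopology ?P WB) O2) X (\<lambda>z. eB (u z, z))"
      using eBu continuous_map_from_subtopology by blast
    moreover have "subtopology (subtopology ?P WB) O2 = subtopology ?P O2"
      using m2(2) by (simp add: subtopology_subtopology Int_absorb1 subset_iff)
    ultimately show ?thesis
      unfolding S by (rule_tac continuous_map_eq) (use m2(2) in \<open>auto simp: m_def\<close>)
  qed
  have sin: "0 \<le> s * r \<and> s * r \<le> 1" if "0 \<le> s" "s \<le> 1" "0 \<le> r" "r \<le> 1" for s r :: real
    using that by (simp add: mult_le_one)
  have sin': "0 \<le> 1 - r + s * r \<and> 1 - r + s * r \<le> 1" if "0 \<le> s" "s \<le> 1" "0 \<le> r" "r \<le> 1" for s r :: real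
    using that by (simp add: mult_left_le_one_le)
  have 1: "homotopic (subtopology ?P W) X fst m"
  proof (rule homotopicI)
    let ?h = "\<lambda>w. if snd w \<in> WB then eB (fst w * u (snd w), snd w) else fst (snd w)"
    have *: "continuous_map (?C S) X ?h" if "S \<subseteq> WB" for S
    proof (rule continuous_map_eq)
      show "continuous_map (?C S) X (\<lambda>w. eB (fst w * u (snd w), snd w))"
      proof (rule continuous_map_cyl_compose [OF eB(1)])
        show "continuous_map (?C S) euclideanreal (\<lambda>w. fst w * u (snd w))"
          by (intro continuous_intros cf cu)
        show "continuous_map (?C S) (subtopology ?P WB) snd"
          using that cs [of S "subtopology ?P WB" "\<lambda>z. z"]
          by (auto simp: continuous_map_in_subtopology intro: continuous_map_from_subtopology)
      qed (use u01 sin in auto)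
    qed (use that in auto)
    show "continuous_map (?C W) X ?h"
    proof (rule paste)
      show "continuous_map (?C O1) X ?h"
      proof (rule continuous_map_eq)
        show "continuous_map (?C O1) X (\<lambda>w. fst (snd w))"
          by (intro cs cfst)
        show "fst (snd w) = ?h w" if "w \<in> topspace (?C O1)" for w
          using that eB(2) [of "snd w"] by (auto simp: O1_def u_def)
      qed
    qed (rule *; auto dest: m2 m3)+
    show "?h (0, z) = fst z" for z
      using eB(2) by auto
    show "?h (1, z) = m z" for z
      by (simp add: m_def)
  qed
  \<comment> \<open>The excursion runs back along \<open>eA (_, m z, m z)\<close> from time 1 to
    time \<open>1 - \<tau> z\<close> and then forwards along \<open>eA (_, m z, snd z)\<close>. Both
    pieces meet at \<open>?e z\<close>: if \<open>\<tau> z = 1\<close> they start at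
    \<open>m z\<close>, and otherwise \<open>m z = snd z\<close>.\<close>
  let ?e = "\<lambda>z. if b (fst z) \<le> 5/6 then eA (1 - \<tau> z, m z, m z) else snd z"
  have s3: "b (fst z) > 5/6" if "z \<in> O3" for z
    using that by (auto simp: O3_def)
  have s12: "m z = snd z \<and> \<tau> z = 0" if "z \<in> O1 \<union> O2" "\<not> b (fst z) \<le> 5/6" for z
  proof -
    have "z \<in> O2" using that by (auto simp: O1_def)
    then show ?thesis using m2(2) m4 that by (auto simp: \<tau>_def)
  qed
  have 2: "homotopic (subtopology ?P W) X m ?e"
  proof (rule homotopicI)
    let ?h = "\<lambda>w. if b (fst (snd w)) \<le> 5/6 then eA (1 - fst w * \<tau> (snd w), m (snd w), m (snd w)) else snd (snd w)"
    have *: "continuous_map (?C S) X ?h" if S: "S = O1 \<or> S = O2" for S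
    proof (rule continuous_map_eq)
      show "continuous_map (?C S) X (\<lambda>w. eA (1 - fst w * \<tau> (snd w), m (snd w), m (snd w)))"
      proof (rule continuous_map_cyl_compose [OF eA(1)])
        show "continuous_map (?C S) euclideanreal (\<lambda>w. 1 - fst w * \<tau> (snd w))"
          by (intro continuous_intros cf c\<tau>) simp
        show "continuous_map (?C S) (subtopology ?P WA) (\<lambda>w. (m (snd w), m (snd w)))"
          using mWA S cs [OF mc [OF S]]
          by (auto simp: continuous_map_in_subtopology continuous_map_pairwise o_def)
      qed (use \<tau>01 sin in auto)
      fix w assume "w \<in> topspace (?C S)"
      then show "eA (1 - fst w * \<tau> (snd w), m (snd w), m (snd w)) = ?h w"
        using s12 [of "snd w"] mWA [of "snd w"] eA(3) S by auto
    qed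
    show "continuous_map (?C W) X ?h"
    proof (rule paste)
      show "continuous_map (?C O3) X ?h"
        by (rule continuous_map_eq [OF cs [OF csnd]]) (use s3 in force)
    qed (rule *; simp)+
    show "?h (0, z) = m z" if "z \<in> topspace (subtopology ?P W)" for z
    proof (cases "b (fst z) \<le> 5/6")
      case True
      then have "z \<in> O1 \<union> O2" using that s3 by (force simp: W)
      then show ?thesis using eA(3) [OF mWA] True by simp
    next
      case False
      then show ?thesis using that m3(2) s12 by (auto simp: W)
    qed
    show "?h (1, z) = ?e z" for z
      by simp
  qed
  have 3: "homotopic (subtopology ?P W) X ?e snd"
  proof (rule homotopicI)
    let ?h = "\<lambda>w. if b (fst (snd w)) \<le> 5/6 then eA (1 - \<tau> (snd w) + fst w * \<tau> (snd w), m (snd w), snd (snd w)) else snd (snd w)"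
    have *: "continuous_map (?C S) X ?h" if S: "S = O1 \<or> S = O2" for S
    proof (rule continuous_map_eq)
      show "continuous_map (?C S) X (\<lambda>w. eA (1 - \<tau> (snd w) + fst w * \<tau> (snd w), m (snd w), snd (snd w)))"
      proof (rule continuous_map_cyl_compose [OF eA(1)])
        show "continuous_map (?C S) euclideanreal (\<lambda>w. 1 - \<tau> (snd w) + fst w * \<tau> (snd w))"
          by (intro continuous_intros cf c\<tau>) simp
        show "continuous_map (?C S) (subtopology ?P WA) (\<lambda>w. (m (snd w), snd (snd w)))"
          using mWA' S cs [OF mc [OF S]] cs [OF csnd]
          by (auto simp: continuous_map_in_subtopology continuous_map_pairwise o_def)
      qed (use \<tau>01 sin' in auto)
      fix w assume "w \<in> topspace (?C S)"
      then show "eA (1 - \<tau> (snd w) + fst w * \<tau> (snd w), m (snd w), snd (snd w)) = ?h w"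
        using s12 [of "snd w"] mWA' [of "snd w"] eA(3) S by auto
    qed
    show "continuous_map (?C W) X ?h"
    proof (rule paste)
      show "continuous_map (?C O3) X ?h"
        by (rule continuous_map_eq [OF cs [OF csnd]]) (use s3 in force)
    qed (rule *; simp)+
    show "?h (0, z) = ?e z" if z: "z \<in> topspace (subtopology ?P W)" for z
    proof (cases "b (fst z) \<le> 5/6")
      case True
      then have z12: "z \<in> O1 \<union> O2" using z s3 by (force simp: W)
      show ?thesis
      proof (cases "b (fst z) \<le> 2/3")
        case True
        then have "\<tau> z = 1" by (simp add: \<tau>_def)
        then show ?thesis
          using \<open>b (fst z) \<le> 5/6\<close> eA(2) [OF mWA [OF z12]] eA(2) [OF mWA' [OF z12]] by simp
      next
        case False
        then have "z \<in> O2" using z12 by (auto simp: O1_def)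
        then have "m z = snd z" using m2(2) m4 False by simp
        then show ?thesis by simp
      qed
    qed simp
    show "?h (1, z) = snd z" if z: "z \<in> topspace (subtopology ?P W)" for z
    proof (cases "b (fst z) \<le> 5/6")
      case True
      then have z12: "z \<in> O1 \<union> O2" using z s3 by (force simp: W)
      then show ?thesis using eA(3) [OF mWA' [OF z12]] by simp
    qed simp
  qed
  have "homotopic (subtopology ?P W) X fst snd"
    using homotopic_with_trans [OF homotopic_with_trans [OF 1 2] 3] .
  moreover have "openin ?P W"
    unfolding W using O1 O2 O3 by blast
  moreover have "(x, x) \<in> W" if "x \<in> topspace X" for x
  proof -
    consider "b x < 1/3" | "b x > 5/6" | "0 < b x" "b x < 1" by linarith
    then show ?thesis
    proof cases
      case 1 then show ?thesis using WA(2) that by (auto simp: W O1_def)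
    next
      case 2 then show ?thesis using WB(2) that by (auto simp: W O3_def)
    next
      case 3
      then have "(x, x) \<in> WB" "(x, x) \<in> WA" using WA(2) WB(2) that by auto
      then show ?thesis using eB(4) [of x "u (x, x)"] u01 that by (auto simp: W O2_def)
    qed
  qed
  ultimately show ?thesis
    unfolding equiconnected_near_def by blast
qed

section \<open>CW complexes\<close>

abbreviation nrm :: "nat \<Rightarrow> (nat \<Rightarrow> real) \<Rightarrow> real" where
  "nrm n v \<equiv> L2_set v {..<n}"

abbreviation disc_top :: "nat \<Rightarrow> (nat \<Rightarrow> real) topology" where
  "disc_top n \<equiv> subtopology (Euclidean_space n) (closed_disc n)"

lemma closed_disc_iff: "v \<in> closed_disc n \<longleftrightarrow> (\<forall>i\<ge>n. v i = 0) \<and> nrm n v \<le> 1"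
  and open_disc_iff: "v \<in> open_disc n \<longleftrightarrow> (\<forall>i\<ge>n. v i = 0) \<and> nrm n v < 1"
  by (auto simp: closed_disc_def open_disc_def topspace_Euclidean_space L2_set_def)

lemma topspace_disc_top: "topspace (disc_top n) = closed_disc n"
  by (auto simp: closed_disc_def)

lemma open_disc_subset: "open_disc n \<subseteq> closed_disc n"
  by (auto simp: closed_disc_iff open_disc_iff)

lemma nrm_scale: "0 \<le> c \<Longrightarrow> nrm n (\<lambda>i. c * v i) = c * nrm n v"
  by (simp add: L2_set_right_distrib)

lemma nrm_convex:
  assumes "nrm n v < 1" "nrm n w < 1" "0 \<le> t" "t \<le> 1"
  shows "nrm n (\<lambda>i. (1 - t) * v i + t * w i) < 1"
proof -
  have "nrm n (\<lambda>i. (1 - t) * v i + t * w i) \<le> (1 - t) * nrm n v + t * nrm n w"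
    using L2_set_triangle_ineq [of "\<lambda>i. (1 - t) * v i" "\<lambda>i. t * w i" "{..<n}"] assms
    by (simp add: nrm_scale)
  also have "\<dots> < 1"
    using assms convex_bound_lt [of "nrm n v" 1 "nrm n w" "1 - t" t] by simp
  finally show ?thesis .
qed

lemma continuous_map_coord:
  "continuous_map X (Euclidean_space n) f \<Longrightarrow> continuous_map X euclideanreal (\<lambda>x. f x i)"
  by (auto simp: Euclidean_space_def continuous_map_in_subtopology continuous_map_componentwise_UNIV)

lemma continuous_map_disc_topI:
  assumes "\<And>i. continuous_map X euclideanreal (\<lambda>x. f x i)" "\<And>x. x \<in> topspace X \<Longrightarrow> f x \<in> closed_disc n"
  shows "continuous_map X (disc_top n) f"
  using assms
  by (auto simp: Euclidean_space_def continuous_map_in_subtopology continuous_map_componentwise_UNIV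
      closed_disc_iff)

lemma continuous_map_nrm:
  assumes "continuous_map X (Euclidean_space n) f"
  shows "continuous_map X euclideanreal (\<lambda>x. nrm n (f x))"
  unfolding L2_set_def
  by (intro continuous_intros continuous_map_coord [OF assms]) auto

lemma continuous_map_nrm_disc: "continuous_map (disc_top n) euclideanreal (nrm n)"
  using continuous_map_nrm [of "disc_top n" n "\<lambda>x. x"]
  by (auto simp: continuous_map_from_subtopology)

text \<open>The disc is closed in the full power of the real line and contained in a power of the
  interval [-1, 1], which is compact by Tychonoff's theorem.\<close>

lemma compactin_closed_disc: "compactin (Euclidean_space n) (closed_disc n)"
proof -
  have "compactin (powertop_real UNIV) (PiE UNIV (\<lambda>_. {-1..1}))"
    by (simp add: compactin_PiE)
  moreover have "closed_disc n \<subseteq> PiE UNIV (\<lambda>_. {-1..1})"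
  proof
    fix v assume v: "v \<in> closed_disc n"
    have "\<bar>v i\<bar> \<le> 1" for i
    proof (cases "i < n")
      case True
      then have "\<bar>v i\<bar> \<le> L2_set (\<lambda>i. \<bar>v i\<bar>) {..<n}"
        using member_le_L2_set [of "{..<n}" i "\<lambda>i. \<bar>v i\<bar>"] by simp
      also have "\<dots> = nrm n v" by (simp add: L2_set_def)
      finally show ?thesis using v by (simp add: closed_disc_iff)
    qed (use v in \<open>simp add: closed_disc_iff\<close>)
    then show "v \<in> PiE UNIV (\<lambda>_. {-1..1})" by (auto simp: abs_le_iff minus_le_iff)
  qed
  moreover have "closedin (powertop_real UNIV) (closed_disc n)"
  proof -
    have "closedin (Euclidean_space n) {v \<in> topspace (Euclidean_space n). nrm n v \<in> {..1}}"
      by (rule closedin_continuous_map_preimage [OF continuous_map_nrm]) (auto simp: continuous_map_id [unfolded id_def])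
    moreover have "{v \<in> topspace (Euclidean_space n). nrm n v \<in> {..1}} = closed_disc n"
      by (auto simp: closed_disc_iff topspace_Euclidean_space)
    ultimately show ?thesis
      using closedin_Euclidean_space closedin_trans_full [of "powertop_real UNIV" "{x. \<forall>i\<ge>n. x i = 0}" "closed_disc n"]
      by (simp add: Euclidean_space_def topspace_Euclidean_space)
  qed
  ultimately have "compactin (powertop_real UNIV) (closed_disc n)"
    using closed_compactin by blast
  then show ?thesis
    by (auto simp: Euclidean_space_def compactin_subtopology closed_disc_iff)
qed

lemma openin_open_disc: "openin (disc_top n) (open_disc n)"
proof -
  have "openin (disc_top n) {v \<in> topspace (disc_top n). nrm n v \<in> {..<1}}"
    by (rule openin_continuous_map_preimage [OF continuous_map_nrm_disc]) simp
  moreover have "{v \<in> topspace (disc_top n). nrm n v \<in> {..<1}} = open_disc n"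
    unfolding topspace_disc_top by (auto simp: closed_disc_iff open_disc_iff)
  ultimately show ?thesis by simp
qed

section \<open>Skeleta, characteristic maps and the weak topology\<close>

locale cw =
  fixes Y :: "'a topology" and \<E> :: "'a set set" and d :: "'a set \<Rightarrow> nat"
    and \<Phi> :: "'a set \<Rightarrow> (nat \<Rightarrow> real) \<Rightarrow> 'a"
  assumes CW: "CW_structure Y \<E> d \<Phi>"
begin

abbreviation disc :: "'a set \<Rightarrow> (nat \<Rightarrow> real) topology" where
  "disc e \<equiv> disc_top (d e)"

text \<open>This is the skeleton of dimension n - 1. With this shift inductions start from the empty
  set \<open>Sk 0\<close>, and a cell \<open>e\<close> is attached along
  \<open>Sk (d e)\<close>.\<close>

definition Sk :: "nat \<Rightarrow> 'a set" where
  "Sk n = \<Union>{e \<in> \<E>. d e < n}"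

abbreviation SkT :: "nat \<Rightarrow> 'a topology" where
  "SkT n \<equiv> subtopology Y (Sk n)"

lemma Hausdorff: "Hausdorff_space Y"
  and cells: "\<Union>\<E> = topspace Y"
  and disjoint: "pairwise disjnt \<E>"
  using CW by (simp_all add: CW_structure_def)

lemma \<Phi>_continuous: "e \<in> \<E> \<Longrightarrow> continuous_map (disc e) Y (\<Phi> e)"
  and \<Phi>_homeo: "e \<in> \<E> \<Longrightarrow> homeomorphic_map (subtopology (Euclidean_space (d e)) (open_disc (d e))) (subtopology Y e) (\<Phi> e)"
  and \<Phi>_finite: "e \<in> \<E> \<Longrightarrow> \<exists>F\<subseteq>\<E>. finite F \<and> (\<forall>c\<in>F. d c < d e) \<and> \<Phi> e ` (closed_disc (d e) - open_disc (d e)) \<subseteq> \<Union>F"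
  and weak_closed: "A \<subseteq> topspace Y \<Longrightarrow> (\<And>e. e \<in> \<E> \<Longrightarrow> closedin Y (A \<inter> Y closure_of e)) \<Longrightarrow> closedin Y A"
proof -
  note * = CW [unfolded CW_structure_def]
  show "e \<in> \<E> \<Longrightarrow> continuous_map (disc e) Y (\<Phi> e)"
    using * by simp
  show "e \<in> \<E> \<Longrightarrow> homeomorphic_map (subtopology (Euclidean_space (d e)) (open_disc (d e))) (subtopology Y e) (\<Phi> e)"
    using * by simp
  show "e \<in> \<E> \<Longrightarrow> \<exists>F\<subseteq>\<E>. finite F \<and> (\<forall>c\<in>F. d c < d e) \<and> \<Phi> e ` (closed_disc (d e) - open_disc (d e)) \<subseteq> \<Union>F"
    using * by simp
  show "A \<subseteq> topspace Y \<Longrightarrow> (\<And>e. e \<in> \<E> \<Longrightarrow> closedin Y (A \<inter> Y closure_of e)) \<Longrightarrow> closedin Y A"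
    using * by simp
qed

lemma cell_unique: "e \<in> \<E> \<Longrightarrow> e' \<in> \<E> \<Longrightarrow> x \<in> e \<Longrightarrow> x \<in> e' \<Longrightarrow> e = e'"
  using disjoint by (auto simp: pairwise_def disjnt_iff)

lemma cell_subset: "e \<in> \<E> \<Longrightarrow> e \<subseteq> topspace Y"
  using cells by blast

lemma \<Phi>_open_disc: "e \<in> \<E> \<Longrightarrow> \<Phi> e ` open_disc (d e) = e"
  and \<Phi>_inj: "e \<in> \<E> \<Longrightarrow> inj_on (\<Phi> e) (open_disc (d e))"
proof -
  assume e: "e \<in> \<E>"
  have "topspace (subtopology (Euclidean_space (d e)) (open_disc (d e))) = open_disc (d e)"
    by (auto simp: open_disc_def)
  moreover have "topspace (subtopology Y e) = e"
    using cell_subset [OF e] by auto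
  ultimately show "\<Phi> e ` open_disc (d e) = e" "inj_on (\<Phi> e) (open_disc (d e))"
    using homeomorphic_imp_surjective_map [OF \<Phi>_homeo [OF e]] homeomorphic_imp_injective_map [OF \<Phi>_homeo [OF e]]
    by simp_all
qed

lemma \<Phi>_boundary:
  assumes "e \<in> \<E>" "v \<in> closed_disc (d e)" "v \<notin> open_disc (d e)"
  shows "\<Phi> e v \<in> Sk (d e)"
  using \<Phi>_finite [OF assms(1)] assms(2,3) unfolding Sk_def by blast

lemma \<Phi>_in_cell: "e \<in> \<E> \<Longrightarrow> v \<in> open_disc (d e) \<Longrightarrow> \<Phi> e v \<in> e"
  using \<Phi>_open_disc by blast

lemma Sk_mono: "m \<le> n \<Longrightarrow> Sk m \<subseteq> Sk n"
  by (force simp: Sk_def)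

lemma cell_Sk: "e \<in> \<E> \<Longrightarrow> d e < n \<Longrightarrow> e \<subseteq> Sk n"
  by (auto simp: Sk_def)

lemma cell_disjoint_Sk: "e \<in> \<E> \<Longrightarrow> n \<le> d e \<Longrightarrow> x \<in> e \<Longrightarrow> x \<notin> Sk n"
  using cell_unique by (force simp: Sk_def)

lemma Sk_subset: "Sk n \<subseteq> topspace Y"
  using cells by (auto simp: Sk_def)

lemma topspace_SkT [simp]: "topspace (SkT n) = Sk n"
  using Sk_subset by auto

lemma in_some_Sk: "x \<in> topspace Y \<Longrightarrow> \<exists>n. x \<in> Sk n"
  using cells unfolding Sk_def by blast

lemma \<Phi>_closed_disc_Sk:
  assumes "e \<in> \<E>" "v \<in> closed_disc (d e)" "d e < n"
  shows "\<Phi> e v \<in> Sk n"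
proof (cases "v \<in> open_disc (d e)")
  case True
  then show ?thesis using assms \<Phi>_in_cell cell_Sk by blast
next
  case False
  then show ?thesis using \<Phi>_boundary assms Sk_mono [of "d e" n] by auto
qed

lemma closedin_\<Phi>_image: "e \<in> \<E> \<Longrightarrow> K \<subseteq> closed_disc (d e) \<Longrightarrow> closedin (disc e) K \<Longrightarrow> closedin Y (\<Phi> e ` K)"
proof -
  assume "e \<in> \<E>" "K \<subseteq> closed_disc (d e)" "closedin (disc e) K"
  moreover have "compact_space (disc e)"
    using compactin_closed_disc by (rule compact_space_subtopology)
  ultimately have "compactin Y (\<Phi> e ` K)"
    using \<Phi>_continuous closedin_compact_space image_compactin by blast
  then show ?thesis
    using Hausdorff compactin_imp_closedin by blast
qed

lemma closure_cell: "e \<in> \<E> \<Longrightarrow> Y closure_of e \<subseteq> \<Phi> e ` closed_disc (d e)"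
proof -
  assume e: "e \<in> \<E>"
  have "closedin Y (\<Phi> e ` closed_disc (d e))"
    using closedin_\<Phi>_image [OF e, of "closed_disc (d e)"] by (metis closedin_topspace order_refl topspace_disc_top)
  moreover have "e \<subseteq> \<Phi> e ` closed_disc (d e)"
    using \<Phi>_open_disc [OF e] open_disc_subset by blast
  ultimately show ?thesis
    by (rule closure_of_minimal [rotated])
qed

text \<open>The weak topology is stated with closures of cells, whereas maps are studied through
  characteristic maps. Compactness of the disc links the two: the closure of \<open>e\<close> is
  covered by the image of the disc, and closed subsets of the disc have closed images.\<close>

lemma closedin_Int_closure:
  assumes e: "e \<in> \<E>" and A: "closedin (disc e) {v \<in> closed_disc (d e). \<Phi> e v \<in> A}"
  shows "closedin Y (A \<inter> Y closure_of e)"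
proof -
  have "A \<inter> Y closure_of e = \<Phi> e ` {v \<in> closed_disc (d e). \<Phi> e v \<in> A} \<inter> Y closure_of e"
    using closure_cell [OF e] by auto
  then show ?thesis
    using closedin_\<Phi>_image [OF e _ A] by (simp add: closedin_Int)
qed

text \<open>Closure finiteness propagates closedness from the cells of the skeleton to all cells.\<close>

lemma closedin_Sk:
  assumes A: "A \<subseteq> Sk n" and *: "\<And>e. e \<in> \<E> \<Longrightarrow> d e < n \<Longrightarrow> closedin Y (A \<inter> Y closure_of e)"
  shows "closedin Y A"
proof (rule weak_closed)
  show "A \<subseteq> topspace Y" using A Sk_subset by blast
  fix e assume "e \<in> \<E>"
  then show "closedin Y (A \<inter> Y closure_of e)"
  proof (induction "d e" arbitrary: e rule: less_induct)
    case less
    show ?case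
    proof (cases "d e < n")
      case False
      obtain F where F: "F \<subseteq> \<E>" "finite F" "\<forall>c\<in>F. d c < d e" "\<Phi> e ` (closed_disc (d e) - open_disc (d e)) \<subseteq> \<Union>F"
        using \<Phi>_finite [OF less.prems] by blast
      have "A \<inter> Y closure_of e \<subseteq> \<Union>F"
      proof
        fix x assume x: "x \<in> A \<inter> Y closure_of e"
        then obtain v where v: "v \<in> closed_disc (d e)" "x = \<Phi> e v"
          using closure_cell [OF less.prems] by blast
        have "v \<notin> open_disc (d e)"
          using x v A False \<Phi>_in_cell [OF less.prems] cell_disjoint_Sk [OF less.prems, of n] by auto
        then show "x \<in> \<Union>F" using F v by blast
      qed
      moreover have "c \<subseteq> Y closure_of c" if "c \<in> F" for c
        using F(1) that by (intro closure_of_subset cell_subset) auto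
      ultimately have "A \<inter> Y closure_of e = (\<Union>c\<in>F. A \<inter> Y closure_of c) \<inter> Y closure_of e"
        by blast
      moreover have "closedin Y (\<Union>c\<in>F. A \<inter> Y closure_of c)"
        using F less.hyps by (intro closedin_Union) auto
      ultimately show ?thesis
        by (simp add: closedin_Int)
    qed (use * less.prems in blast)
  qed
qed

lemma closedin_Sk_self: "closedin Y (Sk n)"
proof (rule closedin_Sk [OF order_refl])
  fix e assume e: "e \<in> \<E>" "d e < n"
  then have "{v \<in> closed_disc (d e). \<Phi> e v \<in> Sk n} = topspace (disc e)"
    using \<Phi>_closed_disc_Sk unfolding topspace_disc_top by auto
  then show "closedin Y (Sk n \<inter> Y closure_of e)"
    by (metis closedin_Int_closure closedin_topspace e(1))
qed

lemma openin_SkT: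
  assumes U: "U \<subseteq> Sk n" and *: "\<And>e. e \<in> \<E> \<Longrightarrow> d e < n \<Longrightarrow> openin (disc e) {v \<in> closed_disc (d e). \<Phi> e v \<in> U}"
  shows "openin (SkT n) U"
proof -
  have "closedin Y (Sk n - U)"
  proof (rule closedin_Sk)
    fix e assume e: "e \<in> \<E>" "d e < n"
    have "closedin (disc e) (topspace (disc e) - {v \<in> closed_disc (d e). \<Phi> e v \<in> U})"
      using * [OF e] by blast
    moreover have "topspace (disc e) - {v \<in> closed_disc (d e). \<Phi> e v \<in> U} = {v \<in> closed_disc (d e). \<Phi> e v \<in> Sk n - U}"
      using \<Phi>_closed_disc_Sk e unfolding topspace_disc_top by auto
    ultimately show "closedin Y ((Sk n - U) \<inter> Y closure_of e)"
      by (intro closedin_Int_closure e) simp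
  qed auto
  then have "closedin (SkT n) (Sk n - U)"
    by (simp add: closedin_closed_subtopology closedin_Sk_self)
  then have "openin (SkT n) (topspace (SkT n) - (Sk n - U))"
    by blast
  moreover have "topspace (SkT n) - (Sk n - U) = U"
    using U unfolding topspace_SkT by auto
  ultimately show ?thesis by simp
qed

lemma openin_weak:
  assumes U: "U \<subseteq> topspace Y" and *: "\<And>e. e \<in> \<E> \<Longrightarrow> openin (disc e) {v \<in> closed_disc (d e). \<Phi> e v \<in> U}"
  shows "openin Y U"
proof -
  have "closedin Y (topspace Y - U)"
  proof (rule weak_closed)
    fix e assume e: "e \<in> \<E>"
    have "closedin (disc e) (topspace (disc e) - {v \<in> closed_disc (d e). \<Phi> e v \<in> U})"
      using * [OF e] by blast
    moreover have "topspace (disc e) - {v \<in> closed_disc (d e). \<Phi> e v \<in> U} = {v \<in> closed_disc (d e). \<Phi> e v \<in> topspace Y - U}"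
      using \<Phi>_closed_disc_Sk [OF e _ lessI] Sk_subset unfolding topspace_disc_top by blast
    ultimately show "closedin Y ((topspace Y - U) \<inter> Y closure_of e)"
      by (intro closedin_Int_closure e) simp
  qed auto
  then show ?thesis
    using U by (simp add: openin_closedin)
qed

lemma \<Phi>_continuous_SkT: "e \<in> \<E> \<Longrightarrow> d e < n \<Longrightarrow> continuous_map (disc e) (SkT n) (\<Phi> e)"
  using \<Phi>_continuous \<Phi>_closed_disc_Sk by (auto simp: continuous_map_in_subtopology)

lemma continuous_map_cyl_SkT:
  assumes N: "openin (SkT n) N"
    and f: "\<And>e. e \<in> \<E> \<Longrightarrow> d e < n \<Longrightarrow>
      continuous_map (cyl (subtopology (disc e) {v. \<Phi> e v \<in> N})) T (\<lambda>z. f (fst z, \<Phi> e (snd z)))"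
  shows "continuous_map (cyl (subtopology (SkT n) N)) T f"
proof (rule continuous_map_cyl_weak [where I = "{e \<in> \<E>. d e < n}" and D = disc and \<Phi> = \<Phi>])
  have "x \<in> (\<Union>i\<in>{e \<in> \<E>. d e < n}. \<Phi> i ` closed_disc (d i))" if "x \<in> Sk n" for x
  proof -
    obtain e where "e \<in> \<E>" "d e < n" "x \<in> e"
      using \<open>x \<in> Sk n\<close> by (auto simp: Sk_def)
    then show ?thesis
      using \<Phi>_open_disc open_disc_subset by fast
  qed
  then show "topspace (SkT n) = (\<Union>i\<in>{e \<in> \<E>. d e < n}. \<Phi> i ` topspace (disc i))"
    using \<Phi>_closed_disc_Sk unfolding topspace_disc_top topspace_SkT by auto
  show "openin (disc i) {v \<in> topspace (disc i). \<Phi> i v \<in> N}" if "i \<in> {e \<in> \<E>. d e < n}" for i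
    using \<Phi>_continuous_SkT that by (intro openin_continuous_map_preimage [OF _ N]) auto
qed (use openin_SkT f N in \<open>simp_all add: topspace_disc_top del: topspace_subtopology\<close>)

lemma continuous_map_cyl_Y:
  assumes N: "openin Y N"
    and f: "\<And>e. e \<in> \<E> \<Longrightarrow>
      continuous_map (cyl (subtopology (disc e) {v. \<Phi> e v \<in> N})) T (\<lambda>z. f (fst z, \<Phi> e (snd z)))"
  shows "continuous_map (cyl (subtopology Y N)) T f"
proof (rule continuous_map_cyl_weak [where I = \<E> and D = disc and \<Phi> = \<Phi>])
  have "x \<in> (\<Union>i\<in>\<E>. \<Phi> i ` closed_disc (d i))" if "x \<in> topspace Y" for x
  proof -
    obtain e where "e \<in> \<E>" "x \<in> e"
      using \<open>x \<in> topspace Y\<close> cells by blast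
    then show ?thesis
      using \<Phi>_open_disc open_disc_subset by fast
  qed
  moreover have "\<Phi> e v \<in> topspace Y" if "e \<in> \<E>" "v \<in> closed_disc (d e)" for e v
    using \<Phi>_closed_disc_Sk [OF that lessI] Sk_subset by auto
  ultimately show "topspace Y = (\<Union>i\<in>\<E>. \<Phi> i ` topspace (disc i))"
    unfolding topspace_disc_top by auto
  show "openin (disc i) {v \<in> topspace (disc i). \<Phi> i v \<in> N}" if "i \<in> \<E>" for i
    using \<Phi>_continuous that by (intro openin_continuous_map_preimage [OF _ N]) auto
qed (use openin_weak f N in \<open>simp_all add: topspace_disc_top del: topspace_subtopology\<close>)

text \<open>The criterion for homotopies, applied to one that does not depend on time.\<close>

lemma continuous_map_SkT:
  assumes f: "\<And>e. e \<in> \<E> \<Longrightarrow> d e < n \<Longrightarrow> continuous_map (disc e) T (\<lambda>v. f (\<Phi> e v))"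
  shows "continuous_map (SkT n) T f"
proof -
  have "continuous_map (cyl (subtopology (SkT n) (topspace (SkT n)))) T (\<lambda>z. f (snd z))"
  proof (rule continuous_map_cyl_SkT)
    fix e assume e: "e \<in> \<E>" "d e < n"
    show "continuous_map (cyl (subtopology (disc e) {v. \<Phi> e v \<in> topspace (SkT n)})) T
            (\<lambda>z. f (snd (fst z, \<Phi> e (snd z))))"
      using continuous_map_compose [OF continuous_map_snd continuous_map_from_subtopology [OF f [OF e]]]
      by (simp add: o_def)
  qed (rule openin_topspace)
  from continuous_map_cyl_at [OF this, of 0] show ?thesis
    by (simp add: subtopology_subtopology Int_absorb1 Sk_subset Int_absorb2)
qed

section \<open>Coordinates on cells and the radial push\<close>

definition cell :: "'a \<Rightarrow> 'a set" where
  "cell y = (THE e. e \<in> \<E> \<and> y \<in> e)"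

definition coord :: "'a \<Rightarrow> nat \<Rightarrow> real" where
  "coord y = inv_into (open_disc (d (cell y))) (\<Phi> (cell y)) y"

lemma cell_eq: "e \<in> \<E> \<Longrightarrow> y \<in> e \<Longrightarrow> cell y = e"
  unfolding cell_def by (rule the_equality) (use cell_unique in auto)

lemma coord_\<Phi>: "e \<in> \<E> \<Longrightarrow> v \<in> open_disc (d e) \<Longrightarrow> coord (\<Phi> e v) = v"
  unfolding coord_def using cell_eq [OF _ \<Phi>_in_cell] \<Phi>_inj by (simp add: inv_into_f_f)

lemma coord_in: "e \<in> \<E> \<Longrightarrow> y \<in> e \<Longrightarrow> coord y \<in> open_disc (d e)"
  and \<Phi>_coord: "e \<in> \<E> \<Longrightarrow> y \<in> e \<Longrightarrow> \<Phi> e (coord y) = y"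
  unfolding coord_def using cell_eq \<Phi>_open_disc inv_into_into f_inv_into_f by metis+

lemma continuous_map_coord_cell:
  assumes e: "e \<in> \<E>"
  shows "continuous_map (subtopology Y e) (Euclidean_space (d e)) coord"
proof -
  let ?D = "subtopology (Euclidean_space (d e)) (open_disc (d e))"
  obtain g where g: "homeomorphic_maps ?D (subtopology Y e) (\<Phi> e) g"
    using \<Phi>_homeo [OF e] homeomorphic_map_maps by blast
  then have "continuous_map (subtopology Y e) (Euclidean_space (d e)) g"
    by (auto simp: homeomorphic_maps_def continuous_map_in_subtopology)
  moreover have "g y = coord y" if "y \<in> topspace (subtopology Y e)" for y
  proof -
    have y: "y \<in> e" using that by auto
    have "coord y \<in> topspace ?D"
      using coord_in [OF e y] by (auto simp: open_disc_def)
    then have "g (\<Phi> e (coord y)) = coord y"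
      using g by (auto simp: homeomorphic_maps_def)
    then show ?thesis using \<Phi>_coord [OF e y] by simp
  qed
  ultimately show ?thesis
    using continuous_map_eq by blast
qed


text \<open>The future gluing function: on an n-cell it falls from 1 at the centre to 0 at the
  boundary.\<close>

definition height :: "nat \<Rightarrow> 'a \<Rightarrow> real" where
  "height n y = (if y \<in> Sk n then 0 else 1 - nrm n (coord y))"

text \<open>The centres of the n-cells are removed. For n = 0 the norm vanishes identically, so the
  0-cells disappear and the set is empty.\<close>

definition punctured :: "nat \<Rightarrow> 'a set" where
  "punctured n = {y \<in> Sk (Suc n). height n y < 1}"

text \<open>The factor turns a norm r > 0 into (1 - s) r + s, so the point moves radially to the
  boundary sphere. At a centre the quotient has the default value 0, but centres are not in
  \<open>punctured n\<close>.\<close>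

definition push :: "nat \<Rightarrow> real \<times> 'a \<Rightarrow> 'a" where
  "push n = (\<lambda>(s, y). if y \<in> Sk n then y
     else \<Phi> (cell y) (\<lambda>i. (1 - s + s / nrm n (coord y)) * coord y i))"

lemma Sk_Suc_cases:
  assumes "y \<in> Sk (Suc n)"
  obtains "y \<in> Sk n" | e where "e \<in> \<E>" "d e = n" "y \<in> e" "y \<notin> Sk n"
proof -
  obtain e where e: "e \<in> \<E>" "d e < Suc n" "y \<in> e"
    using assms by (auto simp: Sk_def)
  show ?thesis
  proof (cases "d e < n")
    case True
    then show ?thesis using e cell_Sk that(1) by blast
  next
    case False
    then show ?thesis using e that(2) [of e] cell_disjoint_Sk [of e n y] by auto
  qed
qed

lemma nrm_boundary: "v \<in> closed_disc n \<Longrightarrow> v \<notin> open_disc n \<Longrightarrow> nrm n v = 1"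
  by (auto simp: closed_disc_iff open_disc_iff)

text \<open>On the boundary sphere \<open>1 - nrm n v\<close> vanishes, in accordance with the value
  on \<open>Sk n\<close>. One formula thus serves the whole closed disc, where continuity is
  tested.\<close>

lemma height_\<Phi>:
  assumes "e \<in> \<E>" "v \<in> closed_disc (d e)" "d e \<le> n"
  shows "height n (\<Phi> e v) = (if d e = n then 1 - nrm n v else 0)"
proof (cases "d e = n \<and> v \<in> open_disc n")
  case True
  then show ?thesis
    using assms cell_disjoint_Sk [OF assms(1) _ \<Phi>_in_cell] coord_\<Phi> by (simp add: height_def)
next
  case False
  then have "\<Phi> e v \<in> Sk n"
    using \<Phi>_closed_disc_Sk [OF assms(1,2), of n] \<Phi>_boundary [OF assms(1,2)] assms(3)
    by (cases "d e = n") auto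
  then show ?thesis
    using False nrm_boundary assms(2) by (auto simp: height_def)
qed

lemma push_Sk: "y \<in> Sk n \<Longrightarrow> push n (s, y) = y"
  by (simp add: push_def)

text \<open>At norm 1 the radial factor is 1, so the formula also covers the boundary points, whose
  images in \<open>Sk n\<close> stay fixed.\<close>

lemma push_\<Phi>:
  assumes "e \<in> \<E>" "v \<in> closed_disc (d e)" "d e = n"
  shows "push n (s, \<Phi> e v) = \<Phi> e (\<lambda>i. (1 - s + s / nrm n v) * v i)"
proof (cases "v \<in> open_disc n")
  case True
  then show ?thesis
    using assms cell_disjoint_Sk [OF assms(1) _ \<Phi>_in_cell] coord_\<Phi> cell_eq [OF assms(1) \<Phi>_in_cell]
    by (simp add: push_def)
next
  case False
  then have "\<Phi> e v \<in> Sk n"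
    using \<Phi>_boundary [OF assms(1,2)] assms(3) by auto
  then show ?thesis
    using False nrm_boundary assms by (simp add: push_Sk)
qed

lemma height_continuous: "continuous_map (SkT (Suc n)) euclideanreal (height n)"
proof (rule continuous_map_SkT)
  fix e assume e: "e \<in> \<E>" "d e < Suc n"
  show "continuous_map (disc e) euclideanreal (\<lambda>v. height n (\<Phi> e v))"
  proof (cases "d e = n")
    case True
    have "continuous_map (disc e) euclideanreal (\<lambda>v. 1 - nrm n v)"
      using continuous_map_nrm_disc [of n] True by (intro continuous_intros) auto
    then show ?thesis
      using e True by (rule_tac continuous_map_eq) (auto simp: height_\<Phi> simp del: topspace_subtopology simp add: topspace_disc_top)
  next
    case False
    have "continuous_map (disc e) euclideanreal (\<lambda>v. 0)" by simp
    then show ?thesis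
      using e False by (rule_tac continuous_map_eq) (auto simp: height_\<Phi> simp del: topspace_subtopology simp add: topspace_disc_top)
  qed
qed

lemma openin_punctured: "openin (SkT (Suc n)) (punctured n)"
proof -
  have "openin (SkT (Suc n)) {y \<in> topspace (SkT (Suc n)). height n y \<in> {..<1}}"
    by (rule openin_continuous_map_preimage [OF height_continuous]) simp
  then show ?thesis by (simp add: punctured_def del: topspace_subtopology)
qed

lemma radial_nrm:
  assumes "0 < nrm n v" "0 \<le> s" "s \<le> 1"
  shows "nrm n (\<lambda>i. (1 - s + s / nrm n v) * v i) = (1 - s) * nrm n v + s"
proof -
  have "0 \<le> 1 - s + s / nrm n v"
    using assms by (intro add_nonneg_nonneg) auto
  then show ?thesis
    using assms by (subst nrm_scale) (auto simp: field_simps)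
qed

lemma radial_in:
  assumes "v \<in> closed_disc n" "0 < nrm n v" "0 \<le> s" "s \<le> 1"
  shows "(\<lambda>i. (1 - s + s / nrm n v) * v i) \<in> closed_disc n"
proof -
  have "(1 - s) * nrm n v + s \<le> (1 - s) * 1 + s"
    using assms by (intro add_mono mult_left_mono) (auto simp: closed_disc_iff)
  then show ?thesis
    using assms radial_nrm [where n = n and v = v and s = s] by (auto simp: closed_disc_iff)
qed

lemma punctured_\<Phi>: 
  assumes "e \<in> \<E>" "v \<in> closed_disc (d e)" "d e = n"
  shows "\<Phi> e v \<in> punctured n \<longleftrightarrow> 0 < nrm n v"
  using height_\<Phi> [OF assms(1,2)] \<Phi>_closed_disc_Sk [OF assms(1,2)] assms(3) by (auto simp: punctured_def)

lemma Sk_punctured: "Sk n \<subseteq> punctured n"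
  using Sk_mono [of n "Suc n"] by (auto simp: punctured_def height_def)

lemma push_cases:
  assumes "y \<in> punctured n"
  obtains "y \<in> Sk n" | e v where "e \<in> \<E>" "d e = n" "v \<in> closed_disc n" "0 < nrm n v" "y = \<Phi> e v"
proof -
  have "y \<in> Sk (Suc n)" using assms by (simp add: punctured_def)
  then show ?thesis
  proof (cases rule: Sk_Suc_cases)
    case (2 e)
    then have "coord y \<in> closed_disc n" "y = \<Phi> e (coord y)"
      using coord_in \<Phi>_coord open_disc_subset by fastforce+
    then show ?thesis
      using that(2) [of e "coord y"] 2 punctured_\<Phi> [of e "coord y" n] assms by simp
  qed (use that in blast)
qed

lemma push_0: "y \<in> punctured n \<Longrightarrow> push n (0, y) = y"
  by (erule push_cases) (simp_all add: push_Sk push_\<Phi>)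

lemma push_1: "y \<in> punctured n \<Longrightarrow> push n (1, y) \<in> Sk n"
proof (erule push_cases)
  fix e v assume *: "e \<in> \<E>" "d e = n" "v \<in> closed_disc n" "0 < nrm n v" "y = \<Phi> e v"
  have "(\<lambda>i. (1 - 1 + 1 / nrm n v) * v i) \<notin> open_disc n"
    using radial_nrm [where n = n and v = v and s = 1] * by (simp add: open_disc_iff)
  then show ?thesis
    using * push_\<Phi> [of e v n 1] radial_in [where n = n and v = v and s = 1] \<Phi>_boundary [OF *(1)] by (simp del: diff_self)
qed (simp add: push_Sk)

lemma push_in:
  assumes "y \<in> punctured n" "0 \<le> s" "s \<le> 1"
  shows "push n (s, y) \<in> punctured n"
  using assms(1)
proof (cases rule: push_cases)
  case 1
  then show ?thesis using Sk_punctured push_Sk by auto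
next
  case (2 e v)
  have "0 < (1 - s) * nrm n v + s"
    using 2 assms by (cases "s = 0") (auto intro: add_nonneg_pos)
  then show ?thesis
    using 2 assms radial_in [where n = n and v = v and s = s] radial_nrm [where n = n and v = v and s = s] by (simp add: push_\<Phi> punctured_\<Phi>)
qed

lemma push_continuous: "continuous_map (cyl (subtopology Y (punctured n))) (subtopology Y (punctured n)) (push n)"
proof -
  have sub: "subtopology (SkT (Suc n)) (punctured n) = subtopology Y (punctured n)"
    by (auto simp: subtopology_subtopology punctured_def Int_absorb1 intro!: arg_cong [where f = "subtopology Y"])
  have "continuous_map (cyl (subtopology (SkT (Suc n)) (punctured n))) (SkT (Suc n)) (push n)"
  proof (rule continuous_map_cyl_SkT [OF openin_punctured])
    fix e assume e: "e \<in> \<E>" "d e < Suc n"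
    let ?D = "subtopology (disc e) {v. \<Phi> e v \<in> punctured n}"
    have tD: "v \<in> topspace ?D \<longleftrightarrow> v \<in> closed_disc (d e) \<and> \<Phi> e v \<in> punctured n" for v
      by (metis (mono_tags, lifting) Int_iff mem_Collect_eq topspace_disc_top topspace_subtopology)
    have sndD: "continuous_map (cyl ?D) (disc e) snd"
      using continuous_map_snd [of "top_of_set {0..1::real}" ?D] continuous_map_into_fulltopology by blast
    show "continuous_map (cyl ?D) (SkT (Suc n)) (\<lambda>z. push n (fst z, \<Phi> e (snd z)))"
    proof (cases "d e = n")
      case False
      have "continuous_map (cyl ?D) (SkT (Suc n)) (\<Phi> e \<circ> snd)"
        using continuous_map_compose [OF sndD \<Phi>_continuous_SkT [OF e]] .
      then show ?thesis
        by (rule continuous_map_eq) (use \<Phi>_closed_disc_Sk [OF e(1)] False e in \<open>auto simp: tD push_Sk simp del: topspace_subtopology\<close>)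
    next
      case True
      let ?r = "\<lambda>z i. (1 - fst z + fst z / nrm n (snd z)) * snd z i"
      have pos: "0 < nrm n (snd z)" "snd z \<in> closed_disc n" "0 \<le> fst z" "fst z \<le> 1" if "z \<in> topspace (cyl ?D)" for z
      proof -
        have "snd z \<in> topspace ?D" "fst z \<in> {0..1}"
          using that by (simp_all add: mem_Times_iff)
        then have "snd z \<in> closed_disc (d e)" "\<Phi> e (snd z) \<in> punctured n" "fst z \<in> {0..1}"
          by (simp_all only: tD)
        then show "0 < nrm n (snd z)" "snd z \<in> closed_disc n" "0 \<le> fst z" "fst z \<le> 1"
          using punctured_\<Phi> [OF e(1) _ True, of "snd z"] True by auto
      qed
      have snE: "continuous_map (cyl ?D) (Euclidean_space n) snd"
        using sndD True continuous_map_into_fulltopology by blast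
      have "continuous_map (cyl ?D) (disc_top n) ?r"
      proof (rule continuous_map_disc_topI)
        show "continuous_map (cyl ?D) euclideanreal (\<lambda>z. ?r z i)" for i
          by (intro continuous_intros continuous_map_fst_cyl continuous_map_coord [OF snE] continuous_map_nrm [OF snE])
             (use pos in force)+
        show "?r z \<in> closed_disc n" if "z \<in> topspace (cyl ?D)" for z
          using radial_in pos [OF that] by blast
      qed
      then have "continuous_map (cyl ?D) (SkT (Suc n)) (\<Phi> e \<circ> ?r)"
        using continuous_map_compose \<Phi>_continuous_SkT [OF e] True by blast
      then show ?thesis
        by (rule continuous_map_eq) (use pos(2) push_\<Phi> [OF e(1)] True in auto)
    qed
  qed
  then show ?thesis
    unfolding sub
    by (auto simp: continuous_map_in_subtopology push_in continuous_map_into_fulltopology image_subset_iff)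
qed

section \<open>Equiconnectedness of the skeleta\<close>

lemma segment_continuous:
  fixes n :: nat
  defines "W \<equiv> \<Union>e\<in>{e \<in> \<E>. d e = n}. e \<times> e"
  defines "X \<equiv> SkT (Suc n)"
  shows "openin (prod_topology X X) W"
    and "continuous_map (cyl (subtopology (prod_topology X X) W)) X
      (\<lambda>z. \<Phi> (cell (fst (snd z))) (\<lambda>i. (1 - fst z) * coord (fst (snd z)) i + fst z * coord (snd (snd z)) i))"
proof -
  \<comment> \<open>The n-cells are open in \<open>Sk (Suc n)\<close>: discs of dimension at most n
    send their boundaries to lower cells, so only the open disc of \<open>e\<close> itself reaches
    \<open>e\<close>.\<close>
  have oe: "openin X e" if e: "e \<in> \<E>" "d e = n" for e
    unfolding X_def
  proof (rule openin_SkT)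
    show "e \<subseteq> Sk (Suc n)" using cell_Sk e by simp
    fix c assume c: "c \<in> \<E>" "d c < Suc n"
    have "{v \<in> closed_disc (d c). \<Phi> c v \<in> e} = (if c = e then open_disc (d c) else {})" (is "?L = ?R")
    proof -
      have "v \<in> open_disc (d c) \<and> c = e" if v: "v \<in> closed_disc (d c)" "\<Phi> c v \<in> e" for v
      proof -
        have "v \<in> open_disc (d c)"
          using \<Phi>_boundary [OF c(1) v(1)] cell_disjoint_Sk [OF e(1) _ v(2), of "d c"] c e by auto
        then show ?thesis
          using cell_unique [OF c(1) e(1) _ v(2)] \<Phi>_in_cell [OF c(1)] by blast
      qed
      moreover have "\<Phi> e v \<in> e" "v \<in> closed_disc (d e)" if "v \<in> open_disc (d e)" for v
        using that \<Phi>_in_cell e open_disc_subset by blast+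
      ultimately show ?thesis by auto
    qed
    then show "openin (disc c) {v \<in> closed_disc (d c). \<Phi> c v \<in> e}"
      by (simp add: openin_open_disc)
  qed
  then have oee: "openin (prod_topology X X) (e \<times> e)" if "e \<in> {e \<in> \<E>. d e = n}" for e
    using that by (simp add: openin_prod_Times_iff)
  then show "openin (prod_topology X X) W"
    unfolding W_def by blast
  show "continuous_map (cyl (subtopology (prod_topology X X) W)) X
      (\<lambda>z. \<Phi> (cell (fst (snd z))) (\<lambda>i. (1 - fst z) * coord (fst (snd z)) i + fst z * coord (snd (snd z)) i))"
    (is "continuous_map _ X ?f")
    unfolding W_def
  proof (rule continuous_map_cyl_openin_Un [OF oee])
    fix e assume "e \<in> {e \<in> \<E>. d e = n}"
    then have e: "e \<in> \<E>" "d e = n" by auto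
    let ?S = "cyl (subtopology (prod_topology X X) (e \<times> e))"
    have Xe: "subtopology X e = subtopology Y e"
      using cell_Sk [of e "Suc n"] e by (simp add: X_def subtopology_subtopology Int_absorb1)
    have S: "subtopology (prod_topology X X) (e \<times> e) = prod_topology (subtopology Y e) (subtopology Y e)"
      by (simp add: subtopology_Times Xe)
    have coord: "continuous_map (subtopology Y e) (Euclidean_space n) coord"
      using continuous_map_coord_cell [OF e(1)] e(2) by simp
    have "continuous_map ?S (Euclidean_space n) (coord \<circ> (fst \<circ> snd))"
      "continuous_map ?S (Euclidean_space n) (coord \<circ> (snd \<circ> snd))"
      unfolding S
      by (intro continuous_map_compose [OF _ coord] continuous_map_compose [OF continuous_map_snd] continuous_map_fst continuous_map_snd)+
    then have 1: "continuous_map ?S (Euclidean_space n) (\<lambda>z. coord (fst (snd z)))"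
      "continuous_map ?S (Euclidean_space n) (\<lambda>z. coord (snd (snd z)))"
      by (simp_all add: o_def)
    let ?r = "\<lambda>z i. (1 - fst z) * coord (fst (snd z)) i + fst z * coord (snd (snd z)) i"
    have "continuous_map ?S (disc_top n) ?r"
    proof (rule continuous_map_disc_topI)
      show "continuous_map ?S euclideanreal (\<lambda>z. ?r z i)" for i
        by (intro continuous_intros continuous_map_fst_cyl continuous_map_coord [OF 1(1)] continuous_map_coord [OF 1(2)]) simp
      show "?r z \<in> closed_disc n" if "z \<in> topspace ?S" for z
      proof -
        have z: "fst (snd z) \<in> e" "snd (snd z) \<in> e" "0 \<le> fst z" "fst z \<le> 1"
          using that by auto
        have "coord (fst (snd z)) \<in> open_disc n" "coord (snd (snd z)) \<in> open_disc n"
          using coord_in [OF e(1)] z e(2) by auto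
        then show ?thesis
          using nrm_convex [where n = n and v = "coord (fst (snd z))" and w = "coord (snd (snd z))" and t = "fst z"] z
          by (simp add: open_disc_iff closed_disc_iff less_imp_le)
      qed
    qed
    then have "continuous_map ?S X (\<Phi> e \<circ> ?r)"
      unfolding X_def using continuous_map_compose \<Phi>_continuous_SkT [OF e(1)] e(2) by blast
    then show "continuous_map ?S X ?f"
      by (rule continuous_map_eq) (use cell_eq [OF e(1)] in auto)
  qed
qed

text \<open>In the induction step the punctured skeleton is dominated by \<open>Sk n\<close> through
  \<open>push n\<close>, and the open n-cells are equiconnected by straight segments in their
  coordinates. The segments are constant on the diagonal, which the gluing demands of one of the two
  homotopies.\<close>

lemma equiconnected_near_SkT: "equiconnected_near (SkT n) (Sk n)"
proof (induction n)
  case 0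
  show ?case
    unfolding equiconnected_near_def
    by (rule exI [of _ "{}"]) (auto simp: Sk_def homotopic_iff continuous_map_def)
next
  case (Suc n)
  let ?X = "SkT (Suc n)" and ?A = "subtopology Y (punctured n)"
  have Atop: "topspace ?A = punctured n"
    using Sk_subset by (auto simp: punctured_def)
  have "equiconnected_near ?A (punctured n)"
  proof (rule equiconnected_near_dominated)
    show "openin ?A (punctured n)"
      using openin_topspace [of ?A] unfolding Atop .
    have A: "subtopology ?A (punctured n) = ?A"
      by (simp add: subtopology_subtopology)
    have "continuous_map ?A ?A (\<lambda>x. push n (1, x))"
      by (rule continuous_map_cyl_at [OF push_continuous]) simp
    then show "continuous_map (subtopology ?A (punctured n)) (SkT n) (\<lambda>x. push n (1, x))"
      unfolding A continuous_map_in_subtopology Atop using push_1 by auto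
    show "continuous_map (SkT n) ?A id"
      using Sk_punctured [of n] by (auto simp: continuous_map_in_subtopology continuous_map_from_subtopology)
    have "homotopic ?A ?A id (id \<circ> (\<lambda>x. push n (1, x)))"
      by (rule homotopicI [OF push_continuous]) (auto simp del: topspace_subtopology simp add: Atop push_0)
    then show "homotopic (subtopology ?A (punctured n)) ?A (id \<circ> (\<lambda>x. push n (1, x))) id"
      unfolding A by (subst homotopic_with_sym)
    have "(\<lambda>x. push n (1, x)) ` punctured n \<subseteq> Sk n"
      using push_1 by auto
    then show "equiconnected_near (SkT n) ((\<lambda>x. push n (1, x)) ` punctured n)"
      using Suc.IH unfolding equiconnected_near_def by blast
  qed auto
  then obtain W where W: "openin (prod_topology ?A ?A) W" "\<forall>x\<in>punctured n. (x, x) \<in> W"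
      "homotopic (subtopology (prod_topology ?A ?A) W) ?A fst snd"
    unfolding equiconnected_near_def by blast
  have AX: "?A = subtopology ?X (punctured n)"
    by (auto simp: subtopology_subtopology punctured_def intro!: arg_cong [where f = "subtopology Y"])
  have PP: "prod_topology ?A ?A = subtopology (prod_topology ?X ?X) (punctured n \<times> punctured n)"
    unfolding AX by (rule subtopology_Times [symmetric])
  have WX: "openin (prod_topology ?X ?X) W"
    using W(1) unfolding PP by (rule openin_trans_full) (simp add: openin_prod_Times_iff openin_punctured)
  have Wsub: "W \<subseteq> punctured n \<times> punctured n"
    using openin_subset [OF W(1)] by (simp add: Atop del: topspace_subtopology)
  then have WW: "subtopology (prod_topology ?A ?A) W = subtopology (prod_topology ?X ?X) W"
    unfolding PP by (simp add: subtopology_subtopology Int_absorb1)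
  obtain eA where eA: "continuous_map (cyl (subtopology (prod_topology ?X ?X) W)) ?A eA"
     "\<And>z. z \<in> topspace (subtopology (prod_topology ?X ?X) W) \<Longrightarrow> eA (0, z) = fst z"
     "\<And>z. z \<in> topspace (subtopology (prod_topology ?X ?X) W) \<Longrightarrow> eA (1, z) = snd z"
    using W(3) unfolding WW by (rule homotopicE) blast
  have tW: "z \<in> topspace (subtopology (prod_topology ?X ?X) W)" if "z \<in> W" for z
    using that openin_subset [OF WX] by auto
  let ?WB = "\<Union>e\<in>{e \<in> \<E>. d e = n}. e \<times> e"
  let ?eB = "\<lambda>z. \<Phi> (cell (fst (snd z))) (\<lambda>i. (1 - fst z) * coord (fst (snd z)) i + fst z * coord (snd (snd z)) i)"
  have "equiconnected_near ?X (topspace ?X)"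
  \<comment> \<open>On \<open>Sk (Suc n)\<close> the function \<open>height n\<close> is below 1
    exactly on \<open>punctured n\<close> and positive exactly on the open n-cells, which are the
    regions of the two homotopies.\<close>
  proof (rule equiconnected_near_glue [where b = "height n" and WA = W and WB = ?WB and eA = eA and eB = ?eB])
    show "(x, x) \<in> W" if "x \<in> topspace ?X" "height n x < 1" for x
      using that W(2) by (simp add: punctured_def del: topspace_subtopology)
    show "height n (fst z) < 1" if "z \<in> W" for z
      using that Wsub by (auto simp: punctured_def)
    show "continuous_map (cyl (subtopology (prod_topology ?X ?X) W)) ?X eA"
      using eA(1) unfolding AX by (rule continuous_map_into_fulltopology)
    show "(x, x) \<in> ?WB" if "x \<in> topspace ?X" "0 < height n x" for x
    proof -
      have "x \<in> Sk (Suc n)" "x \<notin> Sk n"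
        using that by (auto simp: height_def split: if_splits)
      then show ?thesis by (auto elim: Sk_Suc_cases)
    qed
    show "?eB (0, z) = fst z" "?eB (1, z) = snd z" if "z \<in> ?WB" for z
      using that \<Phi>_coord cell_eq by auto
    show "?eB (t, x, x) = x" if "(x, x) \<in> ?WB" for x t
    proof -
      have "(1 - t) * a + t * a = a" for a :: real by (simp add: algebra_simps)
      then show ?thesis using that \<Phi>_coord cell_eq by auto
    qed
  qed (use WX height_continuous segment_continuous eA tW in auto)
  then show ?case unfolding topspace_SkT .
qed


text \<open>\<open>Nb n\<close> traces a neighbourhood of \<open>Sk n\<close> on the skeleta, and \<open>retr n m\<close> contracts the trace on
  \<open>Sk m\<close> into \<open>Sk n\<close>: the \<open>k\<close>-cells are pushed in the time interval from \<open>1/2^(k+1)\<close> to \<open>1/2^k\<close>.\<close>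

primrec Nb :: "nat \<Rightarrow> nat \<Rightarrow> 'a set" where
  "Nb n 0 = {}"
| "Nb n (Suc m) = (if Suc m \<le> n then Sk (Suc m) else {y \<in> punctured m. push m (1, y) \<in> Nb n m})"

primrec retr :: "nat \<Rightarrow> nat \<Rightarrow> real \<times> 'a \<Rightarrow> 'a" where
  "retr n 0 = snd"
| "retr n (Suc m) = (\<lambda>(t, y). if Suc m \<le> n then y
     else if t \<le> (1/2) ^ m then push m (max 0 (2 ^ Suc m * t - 1), y) else retr n m (t, push m (1, y)))"

lemma Nb_subset: "Nb n m \<subseteq> Sk m"
  by (cases m) (auto simp: punctured_def)

text \<open>\<open>push m\<close> fixes \<open>Sk m\<close>, so each new trace restricts to the
  previous one.\<close>

lemma Nb_Int: "Nb n (Suc m) \<inter> Sk m = Nb n m"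
proof (cases "Suc m \<le> n")
  case True
  then show ?thesis
    using Sk_mono [of m "Suc m"] by (cases m) (auto simp: Sk_def)
next
  case False
  then show ?thesis
    using Sk_punctured [of m] Nb_subset [of n m] by (auto simp: push_Sk)
qed

lemma Nb_Int_le: "m \<le> k \<Longrightarrow> Nb n k \<inter> Sk m = Nb n m"
proof (induction k)
  case (Suc k)
  show ?case
  proof (cases "m = Suc k")
    case True
    then show ?thesis using Nb_subset by blast
  next
    case False
    then have "Nb n k \<inter> Sk m = Nb n m" "Sk m \<subseteq> Sk k"
      using Suc Sk_mono by auto
    then show ?thesis using Nb_Int [of n k] by blast
  qed
qed (use Nb_subset in blast)

lemma Nb_Sk: "Sk n \<subseteq> Nb n n"
  by (cases n) (auto simp: Sk_def)

lemma openin_Nb: "openin (SkT m) (Nb n m)"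
proof (induction m)
  case (Suc m)
  show ?case
  proof (cases "Suc m \<le> n")
    case True
    then show ?thesis by (metis Nb.simps(2) openin_topspace topspace_SkT)
  next
    case False
    let ?A = "subtopology Y (punctured m)"
    have Atop: "topspace ?A = punctured m"
      using Sk_subset by (auto simp: punctured_def)
    have AX: "?A = subtopology (SkT (Suc m)) (punctured m)"
      by (auto simp: subtopology_subtopology punctured_def intro!: arg_cong [where f = "subtopology Y"])
    have "continuous_map ?A ?A (\<lambda>x. push m (1, x))"
      by (rule continuous_map_cyl_at [OF push_continuous]) simp
    then have "continuous_map ?A (SkT m) (\<lambda>x. push m (1, x))"
      unfolding continuous_map_in_subtopology Atop using push_1 by auto
    then have "openin ?A {y \<in> topspace ?A. push m (1, y) \<in> Nb n m}"
      using Suc.IH by (rule openin_continuous_map_preimage)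
    then have "openin (SkT (Suc m)) {y \<in> punctured m. push m (1, y) \<in> Nb n m}"
      unfolding Atop unfolding AX using openin_punctured by (rule openin_trans_full)
    then show ?thesis using False by simp
  qed
qed simp

text \<open>The highest cells in \<open>Sk m\<close> have dimension at most m - 1. The push of the
  (m-1)-cells starts at time 1/2^m, and lower cells start later still. This pause makes the stages
  of \<open>retr\<close> fit together.\<close>

lemma retr_early: "y \<in> Nb n m \<Longrightarrow> 0 \<le> t \<Longrightarrow> t \<le> (1/2) ^ m \<Longrightarrow> retr n m (t, y) = y"
proof (induction m)
  case (Suc m)
  have "2 ^ Suc m * t \<le> 2 ^ Suc m * (1/2) ^ Suc m"
    using Suc.prems by (intro mult_left_mono) auto
  also have "\<dots> = 1" by (simp flip: power_mult_distrib)
  finally have "max 0 (2 ^ Suc m * t - 1) = 0" by simp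
  moreover have "t \<le> (1/2) ^ m"
  proof -
    have "(1/2::real) ^ Suc m \<le> (1/2) ^ m" by simp
    then show ?thesis using Suc.prems by linarith
  qed
  ultimately show ?case
    using Suc.prems push_0 by (auto simp del: power_Suc split: if_splits)
qed simp

text \<open>As long as \<open>push m\<close> is active, \<open>retr n m\<close> does not yet move
  the points of \<open>Sk m\<close>, and \<open>push m\<close> fixes them. Hence every stage extends
  the preceding one.\<close>

lemma retr_Suc: 
  assumes "y \<in> Nb n m" "0 \<le> t"
  shows "retr n (Suc m) (t, y) = retr n m (t, y)"
proof (cases "Suc m \<le> n")
  case True
  then show ?thesis by (cases m) auto
next
  case False
  have "y \<in> Sk m" using assms Nb_subset by blast
  then show ?thesis
    using False assms retr_early by (auto simp: push_Sk)
qed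

lemma retr_le: "y \<in> Nb n m \<Longrightarrow> 0 \<le> t \<Longrightarrow> m \<le> k \<Longrightarrow> retr n k (t, y) = retr n m (t, y)"
proof (induction k)
  case (Suc k)
  show ?case
  proof (cases "m = Suc k")
    case False
    then have "m \<le> k" using Suc by simp
    then have "y \<in> Nb n k" using Nb_Int_le [of m k n] Suc.prems by blast
    then show ?thesis using retr_Suc [of y n k t] Suc \<open>m \<le> k\<close> by simp
  qed simp
qed simp

lemma retr_1:
  assumes "1 \<le> n" "y \<in> Nb n m"
  shows "retr n m (1, y) \<in> Sk n"
  using assms(2)
proof (induction m arbitrary: y)
  case (Suc m)
  show ?case
  proof (cases "Suc m \<le> n")
    case True
    then show ?thesis using Suc.prems Sk_mono [of "Suc m" n] by auto
  next
    case False
    \<comment> \<open>\<open>1 \<le> n\<close> enters here: the threshold 1/2^m must be below 1 for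
      time 1 to select the last branch of \<open>retr\<close>.\<close>
    then have "m \<noteq> 0" using assms(1) by simp
    then have "(1/2::real) ^ m < 1" by (intro power_Suc_less_one power_less_one_iff [THEN iffD2]) auto
    then show ?thesis using False Suc by auto
  qed
qed simp

lemma retr_continuous: "continuous_map (cyl (subtopology Y (Nb n m))) Y (retr n m)"
proof (induction m)
  case 0
  then show ?case by (simp add: continuous_map_def)
next
  case (Suc m)
  let ?N = "subtopology Y (Nb n (Suc m))"
  have tN: "topspace ?N = Nb n (Suc m)"
    using Nb_subset Sk_subset by fastforce
  show ?case
  proof (cases "Suc m \<le> n")
    case True
    then have "retr n (Suc m) = snd" by auto
    then show ?thesis
      using continuous_map_snd continuous_map_into_fulltopology by metis
  next
    case False
    let ?A = "subtopology Y (punctured m)"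
    have sub: "Nb n (Suc m) \<subseteq> punctured m" using False by auto
    have NA: "?N = subtopology ?A (Nb n (Suc m))"
      using sub by (simp add: subtopology_subtopology Int_absorb1)
    have pc: "continuous_map (cyl ?A) Y (push m)"
      using push_continuous continuous_map_into_fulltopology by blast
    have sndA: "continuous_map (subtopology (cyl ?N) S) ?A snd" for S
      using continuous_map_into_fulltopology [OF continuous_map_snd [of "top_of_set {0..1::real}" "subtopology ?A (Nb n (Suc m))"]]
      unfolding NA by (rule continuous_map_from_subtopology)
    have c: "continuous_map (cyl ?N) Y (\<lambda>z. if fst z \<le> (1/2) ^ m
        then push m (max 0 (2 ^ Suc m * fst z - 1), snd z) else retr n m (fst z, push m (1, snd z)))"
    proof (rule continuous_map_cases_le)
      let ?S = "{z \<in> topspace (cyl ?N). fst z \<le> (1/2) ^ m}"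
      show "continuous_map (subtopology (cyl ?N) ?S) Y (\<lambda>z. push m (max 0 (2 ^ Suc m * fst z - 1), snd z))"
      proof (rule continuous_map_cyl_compose [OF pc _ _ sndA])
        show "continuous_map (subtopology (cyl ?N) ?S) euclideanreal (\<lambda>z. max 0 (2 ^ Suc m * fst z - 1))"
          by (intro continuous_intros continuous_map_from_subtopology continuous_map_fst_cyl) simp_all
        fix z assume z: "z \<in> topspace (subtopology (cyl ?N) ?S)"
        then have "2 ^ Suc m * fst z \<le> 2 ^ Suc m * (1/2) ^ m"
          by (intro mult_left_mono) auto
        also have "\<dots> = 2" by (simp flip: power_mult_distrib)
        finally show "0 \<le> max 0 (2 ^ Suc m * fst z - 1) \<and> max 0 (2 ^ Suc m * fst z - 1) \<le> 1" by simp
      qed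
      let ?S' = "{z \<in> topspace (cyl ?N). (1/2) ^ m \<le> fst z}"
      show "continuous_map (subtopology (cyl ?N) ?S') Y (\<lambda>z. retr n m (fst z, push m (1, snd z)))"
      proof (rule continuous_map_cyl_compose [OF Suc.IH])
        show "continuous_map (subtopology (cyl ?N) ?S') euclideanreal fst"
          by (intro continuous_map_from_subtopology continuous_map_fst_cyl)
        have "continuous_map (subtopology (cyl ?N) ?S') Y (\<lambda>z. push m (1, snd z))"
          by (rule continuous_map_cyl_compose [OF pc _ _ sndA]) auto
        then show "continuous_map (subtopology (cyl ?N) ?S') (subtopology Y (Nb n m)) (\<lambda>z. push m (1, snd z))"
          using False by (auto simp: continuous_map_in_subtopology tN)
      qed auto
      fix z assume z: "z \<in> topspace (cyl ?N)" "fst z = (1/2) ^ m"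
      have "2 ^ Suc m * fst z = 2" using z(2) by (simp flip: power_mult_distrib)
      then have "max 0 (2 ^ Suc m * fst z - 1) = 1" by linarith
      moreover have "push m (1, snd z) \<in> Nb n m"
      proof -
        have "snd z \<in> topspace ?N"
          using z(1) unfolding topspace_prod_topology mem_Times_iff by blast
        then show ?thesis unfolding tN using False by simp
      qed
      ultimately show "push m (max 0 (2 ^ Suc m * fst z - 1), snd z) = retr n m (fst z, push m (1, snd z))"
        using retr_early [of "push m (1, snd z)" n m "fst z"] z(2) by (simp del: power_Suc)
    qed (auto simp: continuous_map_fst_cyl)
    show ?thesis
      by (rule continuous_map_eq [OF c]) (use False in auto)
  qed
qed

section \<open>The retracting neighbourhood in the whole complex, and compact sets\<close>

definition nbhd :: "nat \<Rightarrow> 'a set" where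
  "nbhd n = (\<Union>m. Nb n m)"

text \<open>For t \<ge> 0 every \<open>m\<close> with \<open>y \<in> Nb n m\<close> gives the same
  value, by \<open>retr_le\<close>.\<close>

definition retraction :: "nat \<Rightarrow> real \<times> 'a \<Rightarrow> 'a" where
  "retraction n = (\<lambda>(t, y). retr n (LEAST m. y \<in> Nb n m) (t, y))"

lemma nbhd_Int: "nbhd n \<inter> Sk m = Nb n m"
proof -
  have "Nb n k \<inter> Sk m \<subseteq> Nb n m" for k
  proof (cases "m \<le> k")
    case True
    then show ?thesis using Nb_Int_le by blast
  next
    case False
    then have "Nb n m \<inter> Sk k = Nb n k" by (intro Nb_Int_le) simp
    then show ?thesis by blast
  qed
  then show ?thesis using Nb_subset by (fastforce simp: nbhd_def)
qed

lemma retraction_eq: "y \<in> Nb n m \<Longrightarrow> 0 \<le> t \<Longrightarrow> retraction n (t, y) = retr n m (t, y)"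
  unfolding retraction_def using retr_le [of y n "LEAST m. y \<in> Nb n m" t m]
    LeastI [of "\<lambda>m. y \<in> Nb n m" m] Least_le [of "\<lambda>m. y \<in> Nb n m" m] by simp

lemma openin_nbhd: "openin Y (nbhd n)"
proof (rule openin_weak)
  show "nbhd n \<subseteq> topspace Y"
    using Nb_subset Sk_subset by (fastforce simp: nbhd_def)
  fix e assume e: "e \<in> \<E>"
  have "openin (disc e) {v \<in> topspace (disc e). \<Phi> e v \<in> Nb n (Suc (d e))}"
    by (rule openin_continuous_map_preimage [OF \<Phi>_continuous_SkT [OF e lessI] openin_Nb])
  moreover have "{v \<in> topspace (disc e). \<Phi> e v \<in> Nb n (Suc (d e))} = {v \<in> closed_disc (d e). \<Phi> e v \<in> nbhd n}"
    using \<Phi>_closed_disc_Sk [OF e _ lessI] nbhd_Int [of n "Suc (d e)"] unfolding topspace_disc_top by blast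
  ultimately show "openin (disc e) {v \<in> closed_disc (d e). \<Phi> e v \<in> nbhd n}"
    by simp
qed

lemma retraction_continuous: "continuous_map (cyl (subtopology Y (nbhd n))) Y (retraction n)"
proof (rule continuous_map_cyl_Y [OF openin_nbhd])
  fix e assume e: "e \<in> \<E>"
  let ?D = "subtopology (disc e) {v. \<Phi> e v \<in> nbhd n}"
  have in_Nb: "\<Phi> e v \<in> Nb n (Suc (d e))" if "v \<in> topspace ?D" for v
  proof -
    have "v \<in> closed_disc (d e)" "\<Phi> e v \<in> nbhd n" using that by auto
    then show ?thesis
      using \<Phi>_closed_disc_Sk [OF e _ lessI] nbhd_Int [of n "Suc (d e)"] by blast
  qed
  have "continuous_map ?D (subtopology Y (Nb n (Suc (d e)))) (\<Phi> e)"
    using in_Nb \<Phi>_continuous [OF e]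
    by (simp add: continuous_map_in_subtopology continuous_map_from_subtopology image_subset_iff del: topspace_subtopology)
  then have "continuous_map (cyl ?D) (subtopology Y (Nb n (Suc (d e)))) (\<lambda>z. \<Phi> e (snd z))"
    using continuous_map_compose [OF continuous_map_snd] by (fastforce simp: o_def)
  then have "continuous_map (cyl ?D) Y (\<lambda>z. retr n (Suc (d e)) (fst z, \<Phi> e (snd z)))"
    by (intro continuous_map_cyl_compose [OF retr_continuous] continuous_map_fst_cyl) auto
  then show "continuous_map (cyl ?D) Y (\<lambda>z. retraction n (fst z, \<Phi> e (snd z)))"
  proof (rule continuous_map_eq)
    fix z assume "z \<in> topspace (cyl ?D)"
    then have "snd z \<in> topspace ?D" "0 \<le> fst z" by auto
    then show "retr n (Suc (d e)) (fst z, \<Phi> e (snd z)) = retraction n (fst z, \<Phi> e (snd z))"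
      using retraction_eq [OF in_Nb] by simp
  qed
qed

text \<open>A sequence leaving all skeleta has closed tails, because the closure of a cell
  \<open>e\<close> lies in \<open>Sk (Suc (d e))\<close> and so meets only finitely many terms. The
  complements of the tails would cover \<open>K\<close> without a finite subcover.\<close>

lemma compactin_Sk:
  assumes K: "compactin Y K"
  shows "\<exists>n. K \<subseteq> Sk n"
proof (rule ccontr)
  assume "\<not> ?thesis"
  then have "\<forall>n. \<exists>y. y \<in> K \<and> y \<notin> Sk n" by blast
  then obtain y where y: "\<And>n. y n \<in> K" "\<And>n. y n \<notin> Sk n" by metis
  have KY: "K \<subseteq> topspace Y" using K compactin_subset_topspace by blast
  define U where "U n = topspace Y - y ` {n..}" for n
  have oU: "openin Y (U n)" for n
  proof -
    have "closedin Y (y ` {n..})"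
    proof (rule weak_closed)
      show "y ` {n..} \<subseteq> topspace Y" using y KY by auto
      fix e assume e: "e \<in> \<E>"
      have "y ` {n..} \<inter> Y closure_of e \<subseteq> y ` {..d e}"
      proof
        fix x assume x: "x \<in> y ` {n..} \<inter> Y closure_of e"
        then obtain k where k: "x = y k" by auto
        have "x \<in> Sk (Suc (d e))"
          using x closure_cell [OF e] \<Phi>_closed_disc_Sk [OF e _ lessI] by auto
        then have "\<not> Suc (d e) \<le> k" using Sk_mono [of "Suc (d e)" k] y k by auto
        then show "x \<in> y ` {..d e}" using k by auto
      qed
      then have "finite (y ` {n..} \<inter> Y closure_of e)"
        by (rule finite_subset) simp
      then show "closedin Y (y ` {n..} \<inter> Y closure_of e)"
        using Hausdorff y KY by (intro closedin_Hausdorff_finite) auto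
    qed
    then show ?thesis by (auto simp: U_def)
  qed
  have "K \<subseteq> \<Union>(range U)"
  proof
    fix x assume "x \<in> K"
    then obtain m where m: "x \<in> Sk m" using KY in_some_Sk by blast
    then have "x \<notin> y ` {m..}" using y Sk_mono by fastforce
    then show "x \<in> \<Union>(range U)" using \<open>x \<in> K\<close> KY by (auto simp: U_def)
  qed
  then obtain F where F: "finite F" "F \<subseteq> range U" "K \<subseteq> \<Union>F"
    using K oU unfolding compactin_def by (metis (no_types, lifting) imageE)
  then obtain I where I: "finite I" "F = U ` I" by (meson finite_subset_image)
  obtain n where n: "\<forall>i\<in>I. i \<le> n" using I finite_nat_set_iff_bounded_le by blast
  have "y n \<in> \<Union>F" using F y by blast
  then show False using I n by (auto simp: U_def)
qed

lemma equiconnected_near_compact: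
  assumes "compactin Y K"
  shows "equiconnected_near Y K"
proof -
  obtain n0 where n0: "K \<subseteq> Sk n0" using compactin_Sk [OF assms] by blast
  \<comment> \<open>\<open>retr_1\<close> asks for \<open>1 \<le> n\<close>; passing to a larger
    skeleton ensures it.\<close>
  define n where "n = Suc n0"
  have n: "1 \<le> n" "K \<subseteq> Sk n" using Sk_mono [of n0 "Suc n0"] n0 by (auto simp: n_def)
  let ?N = "subtopology Y (nbhd n)"
  have tN: "topspace ?N = nbhd n" using openin_subset [OF openin_nbhd] by auto
  have inN: "\<exists>m. y \<in> Nb n m" if "y \<in> nbhd n" for y
    using that by (auto simp: nbhd_def)
  have r1: "retraction n (1, y) \<in> Sk n" if "y \<in> nbhd n" for y
    using inN [OF that] retr_1 [OF n(1)] retraction_eq by fastforce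
  have r0: "retraction n (0, y) = y" if "y \<in> nbhd n" for y
    using inN [OF that] retr_early retraction_eq by fastforce
  show ?thesis
  proof (rule equiconnected_near_dominated [OF openin_nbhd])
    have "continuous_map ?N Y (\<lambda>x. retraction n (1, x))"
      by (rule continuous_map_cyl_at [OF retraction_continuous]) simp
    then show "continuous_map ?N (SkT n) (\<lambda>x. retraction n (1, x))"
      using r1 by (auto simp: continuous_map_in_subtopology tN)
    show "continuous_map (SkT n) Y id"
      by (simp add: continuous_map_from_subtopology)
    have "homotopic ?N Y id (id \<circ> (\<lambda>x. retraction n (1, x)))"
      by (rule homotopicI [OF retraction_continuous]) (auto simp: tN r0 simp del: topspace_subtopology)
    then show "homotopic ?N Y (id \<circ> (\<lambda>x. retraction n (1, x))) id"
      by (subst homotopic_with_sym)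
    have Kn: "K \<subseteq> nbhd n" using n(2) Nb_Sk by (auto simp: nbhd_def)
    then show "K \<subseteq> nbhd n" .
    have "(\<lambda>x. retraction n (1, x)) ` K \<subseteq> Sk n"
      using Kn r1 by auto
    then show "equiconnected_near (SkT n) ((\<lambda>x. retraction n (1, x)) ` K)"
      by (rule equiconnected_near_mono [OF equiconnected_near_SkT])
  qed
qed

end

lemma CW_homotopy_type_equiconnected_near:
  assumes "has_CW_homotopy_type TYPE('w) X" "compactin X K"
  shows "equiconnected_near X K"
proof -
  obtain Y :: "'w topology" where Y: "CW_complex Y" "X homotopy_equivalent_space Y"
    using assms(1) by (auto simp: has_CW_homotopy_type_def)
  obtain \<E> d \<Phi> where "cw Y \<E> d \<Phi>"
    using Y(1) by (auto simp: CW_complex_def cw_def)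
  then interpret cw Y \<E> d \<Phi> .
  obtain f g where fg: "continuous_map X Y f" "continuous_map Y X g" "homotopic X X (g \<circ> f) id"
    using Y(2) by (auto simp: homotopy_equivalent_space_def)
  show ?thesis
  proof (rule equiconnected_near_dominated [OF openin_topspace])
    show "K \<subseteq> topspace X" using assms(2) compactin_subset_topspace by blast
    show "equiconnected_near Y (f ` K)"
      using equiconnected_near_compact image_compactin [OF assms(2) fg(1)] by blast
  qed (use fg in simp_all)
qed

section \<open>Lifting homotopies into fibres\<close>

lemma conc_map:
  assumes "t \<in> {0..1}" "\<And>s. s \<in> {0..1} \<Longrightarrow> q (f (s, x)) = f' (s, x)" "\<And>s. s \<in> {0..1} \<Longrightarrow> q (g (s, x)) = g' (s, x)"
  shows "q (conc f g (t, x)) = conc f' g' (t, x)"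
  using assms by (auto simp: conc_def)

text \<open>Three sides of a lifted square form a path with the end points of the fourth side. Hence a
  path can be pushed along a homotopy of its projection with end points kept fixed, although the
  homotopy itself is lifted freely.\<close>

lemma squeeze:
  assumes lift: "homotopy_lifting (cyl T) E B q"
    and G: "continuous_map (cyl T) E G" and K: "continuous_map (cyl (cyl T)) B K"
    and K0: "\<And>t x. t \<in> {0..1} \<Longrightarrow> x \<in> topspace T \<Longrightarrow> K (0, (t, x)) = q (G (t, x))"
  obtains Q where "continuous_map (cyl T) E Q"
    "\<And>x. x \<in> topspace T \<Longrightarrow> Q (0, x) = G (0, x)" "\<And>x. x \<in> topspace T \<Longrightarrow> Q (1, x) = G (1, x)"
    "\<And>t x. t \<in> {0..1} \<Longrightarrow> x \<in> topspace T \<Longrightarrow>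
       q (Q (t, x)) = conc (conc (\<lambda>(s, x). K (s, (0, x))) (\<lambda>(s, x). K (1, (s, x))))
                           (rev_path (\<lambda>(s, x). K (s, (1, x)))) (t, x)"
proof -
  obtain L where L: "continuous_map (cyl (cyl T)) E L" "\<And>z. z \<in> topspace (cyl T) \<Longrightarrow> L (0, z) = G z"
    "\<And>s z. s \<in> {0..1} \<Longrightarrow> z \<in> topspace (cyl T) \<Longrightarrow> q (L (s, z)) = K (s, z)"
    using lift [unfolded homotopy_lifting_def, rule_format, OF G K] K0 by auto
  have side: "continuous_map (cyl T) E (\<lambda>(s, x). L (s, (r, x)))" if "r \<in> {0..1}" for r
  proof -
    have "continuous_map (cyl T) (cyl T) (\<lambda>z. (r, snd z))"
      using that by (intro continuous_map_cylI continuous_map_snd) auto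
    then have "continuous_map (cyl T) E (\<lambda>z. L (fst z, (r, snd z)))"
      by (intro continuous_map_cyl_compose [OF L(1)] continuous_map_fst_cyl) auto
    then show ?thesis by (simp add: case_prod_beta')
  qed
  have top: "continuous_map (cyl T) E (\<lambda>(s, x). L (1, (s, x)))"
    using continuous_map_cyl_at [OF L(1), of 1] by (simp add: case_prod_beta')
  let ?a = "\<lambda>(s, x). L (s, (0, x))" and ?b = "\<lambda>(s, x). L (1, (s, x))" and ?c = "\<lambda>(s, x). L (s, (1, x))"
  show ?thesis
  proof (rule that [of "conc (conc ?a ?b) (rev_path ?c)"])
    show "continuous_map (cyl T) E (conc (conc ?a ?b) (rev_path ?c))"
      by (intro continuous_map_conc continuous_map_rev_path side top) auto
    show "q (conc (conc ?a ?b) (rev_path ?c) (t, x)) =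
      conc (conc (\<lambda>(s, x). K (s, (0, x))) (\<lambda>(s, x). K (1, (s, x)))) (rev_path (\<lambda>(s, x). K (s, (1, x)))) (t, x)"
      if "t \<in> {0..1}" "x \<in> topspace T" for t x
      using that L(3) by (intro conc_map that) (auto simp: rev_path_def)
  qed (use L(2) in auto)
qed

section \<open>The inverse system\<close>

lemma finite_Sup_compact:
  assumes "regular_lattice TYPE('x::complete_lattice)" "finite F" "F \<subseteq> compact_elements"
  shows "Sup F \<in> (compact_elements :: 'x set)"
  using assms(2,3)
proof (induction F)
  case empty
  show ?case by (auto simp: compact_elements_def bot_unique intro: exI [of _ "{}"])
next
  case (insert x F)
  then show ?case using assms(1) by (simp add: regular_lattice_def)
qed

lemma path_components_of_eq:
  assumes "D \<in> path_components_of X" "x \<in> D"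
  shows "D = path_component_of_set X x"
proof -
  obtain z where z: "D = path_component_of_set X z"
    using assms by (auto simp: path_components_of_def)
  then have "path_component_of X z x" using assms by simp
  then show ?thesis
    unfolding z by (intro Collect_cong iffI) (metis path_component_of_trans path_component_of_sym)+
qed

lemma cyl_path_component:
  assumes "continuous_map (cyl T) X h" "x \<in> topspace T" "s \<in> {0..1}" "t \<in> {0..1}"
  shows "path_component_of X (h (s, x)) (h (t, x))"
proof -
  have "path_connectedin X ((\<lambda>t. h (t, x)) ` {0..1})"
    by (rule path_connectedin_path_image [OF continuous_map_cyl_path [OF assms(1,2)]])
  then show ?thesis
    using assms(3,4) unfolding path_component_of by blast
qed

locale restricted_fibrations =
  fixes Z :: "'x::complete_lattice \<Rightarrow> 'a topology" and p :: "'x \<Rightarrow> 'x \<Rightarrow> 'a \<Rightarrow> 'a"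
    and C :: "'a set" and \<zeta> :: 'a
  assumes regular: "regular_lattice TYPE('x)"
    and fibrations: "system_of_fibrations Z p"
    and restricted: "restricted_system Z p"
    and C: "C \<in> path_components_of (Z top_class.top)"
    and \<zeta>: "\<zeta> \<in> C"
begin

abbreviation ZZ :: "'a topology" where
  "ZZ \<equiv> Z top_class.top"

abbreviation pr :: "'x \<Rightarrow> 'a \<Rightarrow> 'a" where
  "pr \<equiv> p top_class.top"

abbreviation KK :: "'x set" where
  "KK \<equiv> compact_elements"

definition Fib :: "'x \<Rightarrow> 'a set" where
  "Fib l = {z \<in> C. pr l z = pr l \<zeta>}"

lemma system: "inverse_system Z p"
  using fibrations by (simp add: system_of_fibrations_def)

lemma p_continuous: "l \<le> m \<Longrightarrow> continuous_map (Z m) (Z l) (p m l)"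
  and p_refl: "z \<in> topspace (Z l) \<Longrightarrow> p l l z = z"
  and p_comp: "l \<le> m \<Longrightarrow> m \<le> n \<Longrightarrow> z \<in> topspace (Z n) \<Longrightarrow> p m l (p n m z) = p n l z"
  and Hausdorff_Z: "Hausdorff_space (Z l)"
  using system by (auto simp: inverse_system_def)

lemma p_in: "l \<le> m \<Longrightarrow> z \<in> topspace (Z m) \<Longrightarrow> p m l z \<in> topspace (Z l)"
  using continuous_map_image_subset_topspace [OF p_continuous] by blast

lemma pr_continuous: "continuous_map ZZ (Z l) (pr l)"
  by (simp add: p_continuous)

lemma pr_comp: "l \<le> m \<Longrightarrow> z \<in> topspace ZZ \<Longrightarrow> p m l (pr m z) = pr l z"
  by (simp add: p_comp)

lemma lifting: "l \<le> m \<Longrightarrow> homotopy_lifting T (Z m) (Z l) (p m l)"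
  by (intro hurewicz_fibration_lifting Hausdorff_Z) (use fibrations in \<open>simp add: system_of_fibrations_def\<close>)

lemma C_subset: "C \<subseteq> topspace ZZ"
  using C path_components_of_subset by blast

lemma C_top: "z \<in> C \<Longrightarrow> z \<in> topspace ZZ"
  using C_subset by blast

lemma C_eq: "x \<in> C \<Longrightarrow> C = path_component_of_set ZZ x"
  by (rule path_components_of_eq [OF C])

lemma C_path: "x \<in> C \<Longrightarrow> path_component_of ZZ x y \<Longrightarrow> y \<in> C"
  using C_eq by blast

lemma bot_compact: "(bot::'x) \<in> KK"
  using finite_Sup_compact [OF regular, of "{}"] by simp

lemma sup_compact: "\<kappa> \<in> KK \<Longrightarrow> \<kappa>' \<in> KK \<Longrightarrow> sup \<kappa> \<kappa>' \<in> KK"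
  using finite_Sup_compact [OF regular, of "{\<kappa>, \<kappa>'}"] by simp

lemma directed_compact: "directed_set KK"
  unfolding directed_set_def using bot_compact sup_compact by (metis empty_iff sup_ge1 sup_ge2)

lemma Sup_compact: "Sup KK = (top_class.top :: 'x)"
proof -
  obtain \<Lambda> where "\<Lambda> \<subseteq> KK" "(top_class.top :: 'x) = Sup \<Lambda>"
    using regular unfolding regular_lattice_def by blast
  then have "top_class.top \<le> Sup KK"
    using Sup_subset_mono [of \<Lambda> KK] by simp
  then show ?thesis by (intro antisym top_greatest)
qed

lemma pr_homeomorphic:
  assumes "directed_set L" "Sup L = top_class.top"
  shows "homeomorphic_map ZZ (inverse_limit Z p L) (\<lambda>z. restrict (\<lambda>l. pr l z) L)"
  using restricted assms unfolding restricted_system_def by metis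

text \<open>A basic neighbourhood in the limit over \<open>KK\<close> restricts only finitely many
  coordinates. Their indices have a compact supremum \<kappa>, and a point that agrees with \<zeta>
  over \<kappa> agrees with it in all restricted coordinates.\<close>

lemma fibre_nbhd:
  assumes U: "openin ZZ U" and zU: "\<zeta> \<in> U"
  shows "\<exists>\<kappa>\<in>KK. \<forall>z\<in>topspace ZZ. pr \<kappa> z = pr \<kappa> \<zeta> \<longrightarrow> z \<in> U"
proof -
  let ?h = "\<lambda>z. restrict (\<lambda>l. pr l z) KK"
  have h: "homeomorphic_map ZZ (inverse_limit Z p KK) ?h"
    by (rule pr_homeomorphic [OF directed_compact Sup_compact])
  have "openin (inverse_limit Z p KK) (?h ` U)"
    using h U homeomorphic_imp_open_map open_map_def by blast
  then obtain V where V: "openin (product_topology Z KK) V"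
    "?h ` U = V \<inter> {z. \<forall>l\<in>KK. \<forall>m\<in>KK. l \<le> m \<longrightarrow> p m l (z m) = z l}" (is "_ = V \<inter> ?S")
    unfolding inverse_limit_def openin_subtopology by (elim exE conjE) (rule that)
  have "?h \<zeta> \<in> V" using V(2) zU by blast
  then obtain u where u: "finite {i \<in> KK. u i \<noteq> topspace (Z i)}" "?h \<zeta> \<in> PiE KK u" "PiE KK u \<subseteq> V"
    using V(1) unfolding openin_product_topology_alt by meson
  define \<kappa> where "\<kappa> = Sup {i \<in> KK. u i \<noteq> topspace (Z i)}"
  have "\<kappa> \<in> KK" unfolding \<kappa>_def by (rule finite_Sup_compact [OF regular u(1)]) auto
  moreover have "z \<in> U" if z: "z \<in> topspace ZZ" "pr \<kappa> z = pr \<kappa> \<zeta>" for z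
  proof -
    have "pr i z \<in> u i" if i: "i \<in> KK" for i
    proof (cases "u i = topspace (Z i)")
      case True
      then show ?thesis using z p_in by simp
    next
      case False
      then have "i \<le> \<kappa>" unfolding \<kappa>_def using i by (intro Sup_upper) auto
      then have "pr i z = pr i \<zeta>"
        using pr_comp z C_top [OF \<zeta>] by metis
      then show ?thesis using u(2) i by (auto simp: PiE_iff)
    qed
    then have "?h z \<in> V" using u(3) by (auto simp: PiE_iff)
    moreover have "?h z \<in> ?S" using z pr_comp by auto
    ultimately have "?h z \<in> ?h ` U" unfolding V(2) by blast
    then obtain y where y: "y \<in> U" "?h z = ?h y" by (rule imageE)
    have "y \<in> topspace ZZ" using y(1) openin_subset [OF U] by blast
    then have "z = y"
      using homeomorphic_imp_injective_map [OF h] y(2) z(1) unfolding inj_on_def by blast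
    then show ?thesis using y(1) by simp
  qed
  ultimately show ?thesis by blast
qed

lemma Fib_mono: "l \<le> m \<Longrightarrow> Fib m \<subseteq> Fib l"
proof
  fix z assume lm: "l \<le> m" and "z \<in> Fib m"
  then have "z \<in> C" "pr m z = pr m \<zeta>" by (auto simp: Fib_def)
  then show "z \<in> Fib l"
    using pr_comp [OF lm C_top] \<zeta> unfolding Fib_def by (metis (mono_tags, lifting) mem_Collect_eq)
qed

lemma \<zeta>_Fib: "\<zeta> \<in> Fib l"
  using \<zeta> by (simp add: Fib_def)

lemma Fib_subset: "Fib l \<subseteq> topspace ZZ"
  using C_subset by (auto simp: Fib_def)

lemma topspace_Fib: "topspace (subtopology ZZ (Fib l)) = Fib l"
  using Fib_subset by auto

lemma fibre_contraction:
  assumes \<kappa>: "\<kappa> \<in> KK"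
    and eC: "equiconnected_near (subtopology ZZ C) {\<zeta>}"
    and eZ: "\<And>L. compactin (Z \<kappa>) L \<Longrightarrow> equiconnected_near (Z \<kappa>) L"
  obtains l c where "l \<in> KK" "\<kappa> \<le> l" "continuous_map (cyl (subtopology ZZ (Fib l))) ZZ c"
    "\<And>x. x \<in> Fib l \<Longrightarrow> c (0, x) = x" "\<And>x. x \<in> Fib l \<Longrightarrow> c (1, x) = \<zeta>"
    "\<And>x t. x \<in> Fib l \<Longrightarrow> t \<in> {0..1} \<Longrightarrow> c (t, x) \<in> Fib \<kappa>"
proof -
  let ?C = "subtopology ZZ C" and ?b = "pr \<kappa> \<zeta>"
  have tC: "topspace ?C = C" using C_subset by auto
  obtain W where W: "openin (prod_topology ?C ?C) W" "(\<zeta>, \<zeta>) \<in> W"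
      "homotopic (subtopology (prod_topology ?C ?C) W) ?C fst snd"
    using eC by (auto simp: equiconnected_near_def)
  have tW: "topspace (subtopology (prod_topology ?C ?C) W) = W"
    using openin_subset [OF W(1)] by auto
  obtain e where e: "continuous_map (cyl (subtopology (prod_topology ?C ?C) W)) ?C e"
      "\<And>z. z \<in> W \<Longrightarrow> e (0, z) = fst z" "\<And>z. z \<in> W \<Longrightarrow> e (1, z) = snd z"
    using W(3) tW by (elim homotopicE) auto
  \<comment> \<open>The slice of \<open>W\<close> at \<zeta>. The contraction \<open>H\<close> of
    \<open>U\<close> derived from it may carry \<zeta> around a loop that is not constant.\<close>
  define U where "U = {x \<in> topspace ?C. (x, \<zeta>) \<in> W}"
  have pair: "continuous_map ?C (prod_topology ?C ?C) (\<lambda>x. (x, \<zeta>))"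
    using \<zeta> tC by (simp add: continuous_map_pairwise o_def continuous_map_id [unfolded id_def])
  have oU: "openin ?C U"
    unfolding U_def using pair W(1) by (rule openin_continuous_map_preimage)
  have UC: "U \<subseteq> C" using tC by (auto simp: U_def)
  have U\<zeta>: "\<zeta> \<in> U" using W(2) \<zeta> tC by (simp add: U_def)
  let ?U = "subtopology ?C U"
  have tU: "topspace ?U = U" using UC C_subset by auto
  define H where "H = (\<lambda>(t, x). e (t, (x, \<zeta>)))"
  have "continuous_map ?U (subtopology (prod_topology ?C ?C) W) (\<lambda>x. (x, \<zeta>))"
    using pair by (simp add: continuous_map_in_subtopology continuous_map_from_subtopology) (auto simp: U_def)
  then have "continuous_map (cyl ?U) (subtopology (prod_topology ?C ?C) W) (\<lambda>z. (snd z, \<zeta>))"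
    using continuous_map_compose [OF continuous_map_snd] by (fastforce simp: o_def)
  then have "continuous_map (cyl ?U) ?C (\<lambda>z. e (fst z, (snd z, \<zeta>)))"
    by (intro continuous_map_cyl_compose [OF e(1)] continuous_map_fst_cyl) auto
  then have H: "continuous_map (cyl ?U) ?C H"
    by (simp add: H_def case_prod_beta')
  have H0: "H (0, x) = x" and H1: "H (1, x) = \<zeta>" if "x \<in> U" for x
    using that e by (auto simp: H_def U_def)
  have HZ: "continuous_map (cyl ?U) ZZ H"
    using H continuous_map_into_fulltopology by blast
  have pH: "continuous_map (cyl ?U) (Z \<kappa>) (\<lambda>z. pr \<kappa> (H z))"
    using continuous_map_compose [OF HZ pr_continuous] by (simp add: o_def)
  have "pathin (Z \<kappa>) (\<lambda>t. pr \<kappa> (H (t, \<zeta>)))"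
    by (rule continuous_map_cyl_path [OF pH]) (use U\<zeta> tU in simp)
  then have "compactin (Z \<kappa>) ((\<lambda>t. pr \<kappa> (H (t, \<zeta>))) ` {0..1})"
    by (rule compactin_path_image)
  from eZ [OF this] obtain W2 where W2: "openin (prod_topology (Z \<kappa>) (Z \<kappa>)) W2"
      "\<And>t. t \<in> {0..1} \<Longrightarrow> (pr \<kappa> (H (t, \<zeta>)), pr \<kappa> (H (t, \<zeta>))) \<in> W2"
      "homotopic (subtopology (prod_topology (Z \<kappa>) (Z \<kappa>)) W2) (Z \<kappa>) fst snd"
    unfolding equiconnected_near_def by blast
  let ?W2 = "subtopology (prod_topology (Z \<kappa>) (Z \<kappa>)) W2"
  have tW2: "topspace ?W2 = W2"
    using openin_subset [OF W2(1)] by auto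
  obtain E where E: "continuous_map (cyl ?W2) (Z \<kappa>) E"
      "\<And>z. z \<in> W2 \<Longrightarrow> E (0, z) = fst z" "\<And>z. z \<in> W2 \<Longrightarrow> E (1, z) = snd z"
    using W2(3) tW2 by (elim homotopicE) auto
  \<comment> \<open>\<open>M\<close> pairs the projected tracks of \<open>x\<close> and of \<zeta>.
    For \<open>x = \<zeta>\<close> it stays in \<open>W2\<close>, and compactness of the interval
    extends this to all \<open>x\<close> in a neighbourhood \<open>V\<close> of \<zeta>.\<close>
  define M where "M = (\<lambda>(t, x). (pr \<kappa> (H (t, x)), pr \<kappa> (H (t, \<zeta>))))"
  have "continuous_map (cyl ?U) (Z \<kappa>) (\<lambda>z. pr \<kappa> (H (fst z, \<zeta>)))"
    by (intro continuous_map_cyl_compose [OF pH] continuous_map_fst_cyl) (use U\<zeta> tU in auto)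
  then have M: "continuous_map (cyl ?U) (prod_topology (Z \<kappa>) (Z \<kappa>)) M"
    using pH by (simp add: M_def case_prod_beta' continuous_map_pairwise o_def)
  have oM: "openin (cyl ?U) {z \<in> topspace (cyl ?U). M z \<in> W2}"
    by (rule openin_continuous_map_preimage [OF M W2(1)])
  have "compactin (top_of_set {0..1::real}) {0..1}"
    by (simp add: compactin_subtopology)
  moreover have "{0..1} \<times> {\<zeta>} \<subseteq> {z \<in> topspace (cyl ?U). M z \<in> W2}"
    using W2(2) U\<zeta> tU by (auto simp: M_def simp del: topspace_subtopology)
  ultimately obtain A V where AV: "openin ?U V" "{0..1} \<subseteq> A" "\<zeta> \<in> V" "A \<times> V \<subseteq> {z \<in> topspace (cyl ?U). M z \<in> W2}"
    using tube_lemma_left [OF oM, of "{0..1}" \<zeta>] U\<zeta> tU by auto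
  have VU: "V \<subseteq> U" using openin_subset [OF AV(1)] tU by simp
  have MV: "M (t, x) \<in> W2" if "t \<in> {0..1}" "x \<in> V" for t x
    using AV(2,4) that by blast
  have "openin ?C V" using AV(1) oU openin_trans_full by blast
  then obtain V' where V': "openin ZZ V'" "V = V' \<inter> C"
    by (auto simp: openin_subtopology)
  obtain l0 where l0: "l0 \<in> KK" "\<And>z. z \<in> topspace ZZ \<Longrightarrow> pr l0 z = pr l0 \<zeta> \<Longrightarrow> z \<in> V'"
    using fibre_nbhd [OF V'(1)] AV(3) V'(2) by blast
  \<comment> \<open>\<open>l0\<close> forces the fibre into \<open>V\<close>, and \<kappa> makes the
    fibre lie over \<open>?b\<close>.\<close>
  define l where "l = sup \<kappa> l0"
  have l: "l \<in> KK" "\<kappa> \<le> l" "l0 \<le> l"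
    using sup_compact \<kappa> l0(1) by (auto simp: l_def)
  let ?T = "subtopology ZZ (Fib l)"
  have FV: "Fib l \<subseteq> V"
  proof
    fix z assume "z \<in> Fib l"
    then have "z \<in> Fib l0" "z \<in> C" using Fib_mono [OF l(3)] by (auto simp: Fib_def)
    then show "z \<in> V" using l0(2) C_top V'(2) by (auto simp: Fib_def)
  qed
  have F\<kappa>: "pr \<kappa> x = ?b" if "x \<in> Fib l" for x
    using Fib_mono [OF l(2)] that by (auto simp: Fib_def)
  have TU: "continuous_map ?T ?U (\<lambda>x. x)"
    using FV VU UC by (auto simp: continuous_map_in_subtopology topspace_Fib continuous_map_from_subtopology)
  have sT: "continuous_map (cyl ?T) ?U snd"
    using continuous_map_compose [OF continuous_map_snd TU] by (simp add: o_def)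
  have G: "continuous_map (cyl ?T) ZZ H"
    using continuous_map_cyl_compose [OF HZ continuous_map_fst_cyl _ sT] by auto
  have "continuous_map (cyl ?T) (prod_topology (Z \<kappa>) (Z \<kappa>)) M"
    using continuous_map_cyl_compose [OF M continuous_map_fst_cyl _ sT] by auto
  then have "continuous_map (cyl ?T) ?W2 M"
    using MV FV by (auto simp: continuous_map_in_subtopology topspace_Fib simp del: topspace_subtopology)
  then have "continuous_map (cyl (cyl ?T)) ?W2 (\<lambda>z. M (snd z))"
    using continuous_map_compose [OF continuous_map_snd] by (fastforce simp: o_def)
  then have "continuous_map (cyl (cyl ?T)) (Z \<kappa>) (\<lambda>z. E (fst z, M (snd z)))"
    by (intro continuous_map_cyl_compose [OF E(1)] continuous_map_fst_cyl) auto
  then have K: "continuous_map (cyl (cyl ?T)) (Z \<kappa>) (\<lambda>(s, z). E (s, M z))"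
    by (simp add: case_prod_beta')
  have EM0: "E (0, M (t, x)) = pr \<kappa> (H (t, x))" and EM1: "E (1, M (t, x)) = pr \<kappa> (H (t, \<zeta>))"
    if "t \<in> {0..1}" "x \<in> Fib l" for t x
    using E(2,3) [OF MV [of t x]] that FV by (auto simp: M_def)
  have M0: "M (0, x) = (?b, ?b)" and M1: "M (1, x) = (?b, ?b)" if "x \<in> Fib l" for x
    using H0 [of x] H1 [of x] H0 [OF U\<zeta>] H1 [OF U\<zeta>] that FV VU F\<kappa> by (auto simp: M_def)
  \<comment> \<open>\<open>E\<close> deforms the projected track of \<open>x\<close> to that of
    \<zeta>. The sides at t = 0 and t = 1 are \<open>E (s, (?b, ?b))\<close>: they need not be
    constant, but they are the same for all \<open>x\<close>. After the squeeze the projection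
    therefore no longer depends on \<open>x\<close>.\<close>
  obtain Q where Q: "continuous_map (cyl ?T) ZZ Q"
    "\<And>x. x \<in> topspace ?T \<Longrightarrow> Q (0, x) = H (0, x)" "\<And>x. x \<in> topspace ?T \<Longrightarrow> Q (1, x) = H (1, x)"
    "\<And>t x. t \<in> {0..1} \<Longrightarrow> x \<in> topspace ?T \<Longrightarrow>
       pr \<kappa> (Q (t, x)) = conc (conc (\<lambda>(s, x). (\<lambda>(s, z). E (s, M z)) (s, (0, x))) (\<lambda>(s, x). (\<lambda>(s, z). E (s, M z)) (1, (s, x))))
                           (rev_path (\<lambda>(s, x). (\<lambda>(s, z). E (s, M z)) (s, (1, x)))) (t, x)"
    by (rule squeeze [OF lifting G K]) (use EM0 topspace_Fib in auto)
  define \<theta> where "\<theta> t = pr \<kappa> (Q (t, \<zeta>))" for t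
  have \<theta>: "pr \<kappa> (Q (t, x)) = \<theta> t" if "t \<in> {0..1}" "x \<in> Fib l" for t x
  proof -
    have "x \<in> topspace ?T" "\<zeta> \<in> topspace ?T"
      by (simp_all only: topspace_Fib that \<zeta>_Fib)
    then show ?thesis
      using Q(4) [OF that(1)] that M0 M1 EM1 \<zeta>_Fib [of l]
      by (auto simp: \<theta>_def conc_def rev_path_def simp del: topspace_subtopology)
  qed
  have Q0: "Q (0, x) = x" and Q1: "Q (1, x) = \<zeta>" if "x \<in> Fib l" for x
    using Q(2,3) [unfolded topspace_Fib, OF that] that FV VU H0 H1 by auto
  have Q\<zeta>: "continuous_map (cyl ?T) ZZ (\<lambda>(t, x). Q (t, \<zeta>))"
  proof -
    have "continuous_map (cyl ?T) ZZ (\<lambda>z. Q (fst z, \<zeta>))"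
      by (intro continuous_map_cyl_compose [OF Q(1)] continuous_map_fst_cyl)
        (use \<zeta>_Fib C_top [OF \<zeta>] in auto)
    then show ?thesis by (simp add: case_prod_beta')
  qed
  \<comment> \<open>Appending the reversed track of \<zeta> cancels the common projection: over
    \<kappa> the new path runs along \<theta> and back. It still ends at \<zeta>, since
    \<open>Q (_, \<zeta>)\<close> is a loop at \<zeta>.\<close>
  define G2 where "G2 = conc Q (rev_path (\<lambda>(t, x). Q (t, \<zeta>)))"
  have G2: "continuous_map (cyl ?T) ZZ G2"
    unfolding G2_def
    by (intro continuous_map_conc continuous_map_rev_path Q\<zeta> Q(1)) (use Q1 \<zeta>_Fib topspace_Fib in auto)
  have pG2: "pr \<kappa> (G2 (t, x)) = \<theta> (min (2 * t) (2 - 2 * t))" if "t \<in> {0..1}" "x \<in> Fib l" for t x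
    using that \<theta> \<zeta>_Fib by (auto simp: G2_def conc_def rev_path_def min_def)
  have \<theta>0: "\<theta> 0 = ?b" using Q0 \<zeta>_Fib by (simp add: \<theta>_def)
  let ?m = "\<lambda>t::real. min (2 * t) (2 - 2 * t)"
  \<comment> \<open>The path \<theta> followed by its reverse is shrunk by travelling less and less
    far. All three sides that the squeeze uses are constant at \<open>?b\<close>, because
    \<open>?m\<close> vanishes at both ends; so \<open>c\<close> stays over
    \<open>?b\<close>.\<close>
  have K2: "continuous_map (cyl (cyl ?T)) (Z \<kappa>) (\<lambda>(s, (t, x)). \<theta> ((1 - s) * ?m t))"
  proof -
    have pQ: "continuous_map (cyl ?T) (Z \<kappa>) (\<lambda>z. pr \<kappa> (Q z))"
      using continuous_map_compose [OF Q(1) pr_continuous] by (simp add: o_def)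
    have ff: "continuous_map (cyl (cyl ?T)) euclideanreal (\<lambda>z. fst (snd z))"
      using continuous_map_compose [OF continuous_map_snd continuous_map_fst_cyl] by (simp add: o_def)
    have "continuous_map (cyl (cyl ?T)) (Z \<kappa>) (\<lambda>z. pr \<kappa> (Q ((1 - fst z) * ?m (fst (snd z)), \<zeta>)))"
    proof (rule continuous_map_cyl_compose [OF pQ])
      show "continuous_map (cyl (cyl ?T)) euclideanreal (\<lambda>z. (1 - fst z) * ?m (fst (snd z)))"
        by (intro continuous_intros ff continuous_map_fst_cyl) auto
      show "0 \<le> (1 - fst z) * ?m (fst (snd z)) \<and> (1 - fst z) * ?m (fst (snd z)) \<le> 1"
        if "z \<in> topspace (cyl (cyl ?T))" for z
      proof -
        have z: "0 \<le> 1 - fst z" "1 - fst z \<le> 1" "0 \<le> ?m (fst (snd z))" "?m (fst (snd z)) \<le> 1"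
          using that by auto
        then show ?thesis by (metis mult_le_one mult_nonneg_nonneg)
      qed
    qed (use \<zeta>_Fib C_top [OF \<zeta>] in auto)
    then show ?thesis by (simp add: \<theta>_def case_prod_beta')
  qed
  obtain c where c: "continuous_map (cyl ?T) ZZ c"
    "\<And>x. x \<in> topspace ?T \<Longrightarrow> c (0, x) = G2 (0, x)" "\<And>x. x \<in> topspace ?T \<Longrightarrow> c (1, x) = G2 (1, x)"
    "\<And>t x. t \<in> {0..1} \<Longrightarrow> x \<in> topspace ?T \<Longrightarrow>
       pr \<kappa> (c (t, x)) = conc (conc (\<lambda>(s, x). (\<lambda>(s, (t, x)). \<theta> ((1 - s) * ?m t)) (s, (0, x)))
           (\<lambda>(s, x). (\<lambda>(s, (t, x)). \<theta> ((1 - s) * ?m t)) (1, (s, x))))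
           (rev_path (\<lambda>(s, x). (\<lambda>(s, (t, x)). \<theta> ((1 - s) * ?m t)) (s, (1, x)))) (t, x)"
    by (rule squeeze [OF lifting G2 K2]) (use pG2 topspace_Fib in auto)
  have c0: "c (0, x) = x" and c1: "c (1, x) = \<zeta>" if "x \<in> Fib l" for x
    using c(2,3) [unfolded topspace_Fib, OF that] that Q0 \<zeta>_Fib by (auto simp: G2_def)
  show ?thesis
  proof (rule that [OF l(1,2) c(1) c0 c1])
    fix x t assume x: "x \<in> Fib l" and t: "t \<in> {0..1::real}"
    have "pr \<kappa> (c (t, x)) = ?b"
      using c(4) [unfolded topspace_Fib, OF t x] \<theta>0 by (simp add: conc_def rev_path_def split: if_splits)
    moreover have "path_component_of ZZ (c (0, x)) (c (t, x))"
      by (rule cyl_path_component [OF c(1)]) (use x t topspace_Fib in auto)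
    then have "c (t, x) \<in> C"
      using C_path [of x] c0 [OF x] x by (simp add: Fib_def)
    ultimately show "c (t, x) \<in> Fib \<kappa>" by (simp add: Fib_def)
  qed
qed

end

section \<open>Spheroids\<close>

text \<open>For a point of the cube, its distance to the boundary in the maximum norm; the value 1/2
  for k = 0 is also the maximum in every positive dimension.\<close>

primrec depth :: "nat \<Rightarrow> (nat \<Rightarrow> real) \<Rightarrow> real" where
  "depth 0 x = 1/2"
| "depth (Suc k) x = min (depth k x) (min (x k) (1 - x k))"

text \<open>The middle cube with sides [1/4, 3/4] is magnified to the whole cube, and the collar
  around it is crushed to the boundary. The value at 0 is 0, so the vanishing coordinates beyond the
  dimension are respected.\<close>

definition zoom :: "(nat \<Rightarrow> real) \<Rightarrow> nat \<Rightarrow> real" where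
  "zoom x = (\<lambda>i. max 0 (min 1 (2 * x i - 1/2)))"

lemma cube_boundary_subset: "cube_boundary k \<subseteq> topspace (unit_cube k)"
  by (auto simp: cube_boundary_def)

lemma depth_nonneg: "x \<in> topspace (unit_cube k) \<Longrightarrow> 0 \<le> depth k x"
proof -
  have "(\<forall>i<k. 0 \<le> x i \<and> x i \<le> 1) \<Longrightarrow> 0 \<le> depth k x" by (induction k) auto
  then show "x \<in> topspace (unit_cube k) \<Longrightarrow> 0 \<le> depth k x" by (simp add: topspace_unit_cube)
qed

lemma depth_le: "i < k \<Longrightarrow> depth k x \<le> min (x i) (1 - x i)"
proof (induction k)
  case (Suc k)
  then show ?case by (cases "i = k") (auto simp: min_le_iff_disj)
qed simp

lemma depth_boundary: "x \<in> cube_boundary k \<Longrightarrow> depth k x = 0"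
proof -
  assume x: "x \<in> cube_boundary k"
  then obtain i where "i < k" "x i \<in> {0, 1}" by (auto simp: cube_boundary_def)
  then have "depth k x \<le> 0" using depth_le [of i k x] by auto
  then show ?thesis using depth_nonneg cube_boundary_subset x by (metis antisym subsetD)
qed

lemma zoom_cube: "x \<in> topspace (unit_cube k) \<Longrightarrow> zoom x \<in> topspace (unit_cube k)"
  by (auto simp: topspace_unit_cube zoom_def)

lemma zoom_boundary:
  assumes "x \<in> topspace (unit_cube k)" "depth k x \<le> 1/4"
  shows "zoom x \<in> cube_boundary k"
proof -
  have "depth k x \<le> 1/4 \<Longrightarrow> \<exists>i<k. x i \<le> 1/4 \<or> 3/4 \<le> x i"
  proof (induction k)
    case (Suc k)
    then have "depth k x \<le> 1/4 \<or> x k \<le> 1/4 \<or> 3/4 \<le> x k"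
      by (simp only: depth.simps min_le_iff_disj) argo
    then show ?case using Suc.IH less_SucI by blast
  qed simp
  then obtain i where "i < k" "x i \<le> 1/4 \<or> 3/4 \<le> x i" using assms by blast
  then have "zoom x i \<in> {0, 1}" by (auto simp: zoom_def)
  then show ?thesis using \<open>i < k\<close> zoom_cube [OF assms(1)] by (auto simp: cube_boundary_def)
qed

lemma continuous_map_cube_coord:
  "continuous_map T (unit_cube k) u \<Longrightarrow> continuous_map T euclideanreal (\<lambda>z. u z i)"
  by (simp add: continuous_map_unit_cube)

lemma continuous_map_depth:
  assumes "continuous_map T (unit_cube n) u"
  shows "continuous_map T euclideanreal (\<lambda>z. depth k (u z))"
  by (induction k) (auto intro!: continuous_intros continuous_map_cube_coord [OF assms])

lemma continuous_map_cubeI: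
  assumes "\<And>i. continuous_map T euclideanreal (\<lambda>z. u z i)"
    "\<And>z. z \<in> topspace T \<Longrightarrow> u z \<in> topspace (unit_cube k)"
  shows "continuous_map T (unit_cube k) u"
  using assms by (auto simp: continuous_map_unit_cube)

lemma continuous_map_zoom:
  assumes "continuous_map T (unit_cube k) u"
  shows "continuous_map T (unit_cube k) (\<lambda>z. zoom (u z))"
proof (rule continuous_map_cubeI)
  show "continuous_map T euclideanreal (\<lambda>z. zoom (u z) i)" for i
    unfolding zoom_def by (intro continuous_intros continuous_map_cube_coord [OF assms]) auto
  show "zoom (u z) \<in> topspace (unit_cube k)" if "z \<in> topspace T" for z
    using zoom_cube continuous_map_image_subset_topspace [OF assms] that by blast
qed

lemma cube_convex:
  assumes "x \<in> topspace (unit_cube k)" "y \<in> topspace (unit_cube k)" "0 \<le> u" "u \<le> 1"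
  shows "(\<lambda>i. (1 - u) * x i + u * y i) \<in> topspace (unit_cube k)"
proof -
  have "0 \<le> (1 - u) * a + u * b \<and> (1 - u) * a + u * b \<le> 1" if "0 \<le> a \<and> a \<le> 1" "0 \<le> b \<and> b \<le> 1" for a b :: real
    using that assms convex_bound_le [of a 1 b "1 - u" u] by simp
  then show ?thesis using assms by (simp add: topspace_unit_cube)
qed

text \<open>The bottom face of a box is moved, relative to its boundary, to the other faces.\<close>

lemma spheroid_box:
  assumes h: "continuous_map (cube_cylinder k) X h" and a: "\<And>x. x \<in> cube_boundary k \<Longrightarrow> h (0, x) = a"
  shows "spheroid_homotopic k X a (\<lambda>x. h (0, x)) (\<lambda>x. h (min 1 (4 * depth k x), zoom x))"
  unfolding spheroid_homotopic_iff
proof (intro exI conjI ballI)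
  \<comment> \<open>The factor 4 matches the collar width 1/4. At the end of the deformation the
    middle cube covers the face at height 1, while the collar climbs from height 0 to height 1 over
    the boundary.\<close>
  let ?s = "\<lambda>z. fst z * min 1 (4 * depth k (snd z))"
  let ?x = "\<lambda>z i. (1 - fst z) * snd z i + fst z * zoom (snd z) i"
  let ?h = "\<lambda>z. h (?s z, ?x z)"
  have snd: "continuous_map (cube_cylinder k) (unit_cube k) snd"
    by (rule continuous_map_snd)
  show "continuous_map (cube_cylinder k) X ?h"
  proof (rule continuous_map_cyl_compose [OF h])
    show "continuous_map (cube_cylinder k) euclideanreal ?s"
      by (intro continuous_intros continuous_map_fst_cyl continuous_map_depth [OF snd]) auto
    show "0 \<le> ?s z \<and> ?s z \<le> 1" if "z \<in> topspace (cube_cylinder k)" for z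
    proof -
      have z: "0 \<le> fst z" "fst z \<le> 1" "0 \<le> min 1 (4 * depth k (snd z))" "min 1 (4 * depth k (snd z)) \<le> 1"
        using that depth_nonneg [of "snd z" k] by auto
      then show ?thesis by (metis mult_le_one mult_nonneg_nonneg)
    qed
    show "continuous_map (cube_cylinder k) (unit_cube k) ?x"
    proof (rule continuous_map_cubeI)
      show "continuous_map (cube_cylinder k) euclideanreal (\<lambda>z. ?x z i)" for i
        by (intro continuous_intros continuous_map_fst_cyl continuous_map_cube_coord [OF snd]
            continuous_map_cube_coord [OF continuous_map_zoom [OF snd]]) auto
      show "?x z \<in> topspace (unit_cube k)" if "z \<in> topspace (cube_cylinder k)" for z
        using that by (intro cube_convex zoom_cube) auto
    qed
  qed
  fix t x assume t: "t \<in> {0..1::real}" and x: "x \<in> cube_boundary k"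
  have x': "x \<in> topspace (unit_cube k)" using x cube_boundary_subset by blast
  obtain i where i: "i < k" "x i \<in> {0, 1}" using x by (auto simp: cube_boundary_def)
  \<comment> \<open>\<open>zoom\<close> fixes 0 and 1, so a boundary point never leaves its face;
    having depth 0, it also stays at height 0.\<close>
  have "(1 - t) * x i + t * zoom x i \<in> {0, 1}"
    using i by (auto simp: zoom_def)
  moreover have "(\<lambda>i. (1 - t) * x i + t * zoom x i) \<in> topspace (unit_cube k)"
    using t by (intro cube_convex x' zoom_cube) auto
  ultimately have "(\<lambda>i. (1 - t) * x i + t * zoom x i) \<in> cube_boundary k"
    using i by (auto simp: cube_boundary_def)
  then show "?h (t, x) = a"
    using a depth_boundary [OF x] by simp
qed auto

text \<open>A box whose filling does not depend on the height.\<close>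

lemma spheroid_zoom:
  assumes "spheroid k X a f"
  shows "spheroid_homotopic k X a f (\<lambda>x. f (zoom x))"
  using spheroid_box [of k X "\<lambda>z. f (snd z)" a] assms continuous_map_compose [OF continuous_map_snd]
  by (fastforce simp: spheroid_def o_def)

context restricted_fibrations
begin

abbreviation CT :: "'x \<Rightarrow> 'a topology" where
  "CT l \<equiv> subtopology (Z l) (pr l ` C)"

lemma continuous_map_into_C:
  assumes h: "continuous_map (cyl T) ZZ h" and "\<And>x. x \<in> topspace T \<Longrightarrow> h (0, x) \<in> C"
  shows "continuous_map (cyl T) (subtopology ZZ C) h"
proof -
  have "h (t, x) \<in> C" if "t \<in> {0..1}" "x \<in> topspace T" for t x
    using C_path [OF assms(2) [OF that(2)] cyl_path_component [OF h that(2) _ that(1)]] by simp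
  then show ?thesis using h by (auto simp: continuous_map_in_subtopology)
qed

lemma spheroid_compose_pr:
  assumes "l \<le> m" "spheroid_homotopic k (CT m) (pr m \<zeta>) f g"
  shows "spheroid_homotopic k (CT l) (pr l \<zeta>) (p m l \<circ> f) (p m l \<circ> g)"
proof (rule spheroid_homotopic_compose [OF assms(2)])
  have "p m l ` (pr m ` C) \<subseteq> pr l ` C"
    using pr_comp [OF assms(1)] C_top by auto
  then show "continuous_map (CT m) (CT l) (p m l)"
    using p_continuous [OF assms(1)]
    by (auto simp: continuous_map_in_subtopology continuous_map_from_subtopology)
  show "p m l (pr m \<zeta>) = pr l \<zeta>"
    using pr_comp [OF assms(1)] C_top \<zeta> by blast
qed

context
  fixes l :: 'x and \<kappa> :: 'x and c :: "real \<times> 'a \<Rightarrow> 'a"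
  assumes l: "\<kappa> \<le> l"
    and c: "continuous_map (cyl (subtopology ZZ (Fib l))) ZZ c"
    and c0: "\<And>x. x \<in> Fib l \<Longrightarrow> c (0, x) = x" and c1: "\<And>x. x \<in> Fib l \<Longrightarrow> c (1, x) = \<zeta>"
    and cF: "\<And>x t. x \<in> Fib l \<Longrightarrow> t \<in> {0..1} \<Longrightarrow> c (t, x) \<in> Fib \<kappa>"
begin

text \<open>Lifting a null homotopy freely moves the spheroid into the fibre, where \<open>c\<close> contracts it; the
  box lemma restores the base point both times.\<close>

lemma spheroid_injective:
  assumes m: "l \<le> m" and f: "spheroid k (subtopology ZZ C) \<zeta> f"
    and null: "spheroid_homotopic k (CT m) (pr m \<zeta>) (pr m \<circ> f) (\<lambda>_. pr m \<zeta>)"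
  shows "spheroid_homotopic k (subtopology ZZ C) \<zeta> f (\<lambda>_. \<zeta>)"
proof -
  let ?Q = "unit_cube k" and ?C = "subtopology ZZ C"
  obtain H where H: "continuous_map (cyl ?Q) (CT m) H"
    "\<And>x. x \<in> topspace ?Q \<Longrightarrow> H (0, x) = pr m (f x)" "\<And>x. x \<in> topspace ?Q \<Longrightarrow> H (1, x) = pr m \<zeta>"
    "\<And>t x. t \<in> {0..1} \<Longrightarrow> x \<in> cube_boundary k \<Longrightarrow> H (t, x) = pr m \<zeta>"
    using null unfolding spheroid_homotopic_iff by auto
  have fC: "f x \<in> C" if "x \<in> topspace ?Q" for x
    using continuous_map_image_subset_topspace [of ?Q ?C f] f that unfolding spheroid_def by auto
  have fZ: "continuous_map ?Q ZZ f"
    using f continuous_map_into_fulltopology unfolding spheroid_def by blast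
  have HZ: "continuous_map (cyl ?Q) (Z m) H"
    using H(1) continuous_map_into_fulltopology by blast
  obtain L where L: "continuous_map (cyl ?Q) ZZ L" "\<And>x. x \<in> topspace ?Q \<Longrightarrow> L (0, x) = f x"
    "\<And>t x. t \<in> {0..1} \<Longrightarrow> x \<in> topspace ?Q \<Longrightarrow> pr m (L (t, x)) = H (t, x)"
    using lifting [of m "top_class.top", unfolded homotopy_lifting_def, rule_format, OF _ fZ HZ] H(2) by auto
  have LC: "continuous_map (cyl ?Q) ?C L"
    using L fC by (intro continuous_map_into_C) auto
  have LC': "L (t, x) \<in> C" if "t \<in> {0..1}" "x \<in> topspace ?Q" for t x
    using continuous_map_cyl_in [OF LC that] by auto
  let ?m = "\<lambda>x. min 1 (4 * depth k x)"
  let ?g = "\<lambda>x. L (?m x, zoom x)"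
  have "\<And>x. x \<in> cube_boundary k \<Longrightarrow> L (0, x) = \<zeta>"
    using f L(2) subsetD [OF cube_boundary_subset] by (auto simp: spheroid_def)
  from spheroid_box [OF LC this] have 1: "spheroid_homotopic k ?C \<zeta> (\<lambda>x. L (0, x)) ?g" by simp
  then have g: "spheroid k ?C \<zeta> ?g" by (rule spheroid_homotopicD)
  have m01: "?m x \<in> {0..1}" if "x \<in> topspace ?Q" for x
    using depth_nonneg that by auto
  \<comment> \<open>On the middle cube the height is 1, where \<open>H\<close> has reached the base
    point; on the collar \<open>zoom x\<close> lies on the boundary, where \<open>H\<close> rests at
    the base point.\<close>
  have gF: "?g x \<in> Fib l" if x: "x \<in> topspace ?Q" for x
  proof -
    have "pr m (?g x) = pr m \<zeta>"
    proof (cases "1/4 \<le> depth k x")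
      case True
      then show ?thesis using L(3) [OF m01 [OF x] zoom_cube [OF x]] H(3) [OF zoom_cube [OF x]] by simp
    next
      case False
      then show ?thesis
        using L(3) [OF m01 [OF x] zoom_cube [OF x]] H(4) [OF m01 [OF x] zoom_boundary [OF x]] by simp
    qed
    then show ?thesis
      using Fib_mono [OF m] LC' [OF m01 [OF x] zoom_cube [OF x]] by (auto simp: Fib_def)
  qed
  have gT: "continuous_map ?Q (subtopology ZZ (Fib l)) ?g"
    using g gF by (auto simp: spheroid_def continuous_map_in_subtopology)
  define h where "h = (\<lambda>z. c (fst z, ?g (snd z)))"
  have "continuous_map (cyl ?Q) ZZ h"
    unfolding h_def
    using continuous_map_compose [OF continuous_map_snd gT]
    by (intro continuous_map_cyl_compose [OF c] continuous_map_fst_cyl) (auto simp: o_def)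
  then have hC: "continuous_map (cyl ?Q) ?C h"
    using gF c0 by (intro continuous_map_into_C) (auto simp: h_def Fib_def)
  have "h (0, x) = \<zeta>" if "x \<in> cube_boundary k" for x
    using that gF [of x] c0 g cube_boundary_subset [of k] by (auto simp: h_def spheroid_def)
  from spheroid_box [OF hC this]
  have 2: "spheroid_homotopic k ?C \<zeta> (\<lambda>x. h (0, x)) (\<lambda>x. h (?m x, zoom x))" by simp
  note hs = spheroid_homotopicD [OF 2]
  \<comment> \<open>On the middle cube \<open>c\<close> has arrived at \<zeta>, on the collar
    \<open>?g\<close> is at \<zeta>. In both cases only the track of \<zeta> under \<open>c\<close>
    remains, and step \<open>4\<close> removes it by cutting down its time.\<close>
  have 3: "h (?m x, zoom x) = c (?m x, \<zeta>)" if x: "x \<in> topspace ?Q" for x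
  proof (cases "1/4 \<le> depth k x")
    case True
    then show ?thesis using c1 gF zoom_cube [OF x] \<zeta>_Fib by (simp add: h_def)
  next
    case False
    then have "?g (zoom x) = \<zeta>"
      using g zoom_boundary [OF x] by (simp add: spheroid_def)
    then show ?thesis by (simp add: h_def)
  qed
  have 4: "spheroid_homotopic k ?C \<zeta> (\<lambda>_. \<zeta>) (\<lambda>x. c (?m x, \<zeta>))"
    unfolding spheroid_homotopic_iff
  proof (intro exI conjI ballI)
    let ?k = "\<lambda>z. c (fst z * ?m (snd z), \<zeta>)"
    have "continuous_map (cyl ?Q) ZZ ?k"
    proof (rule continuous_map_cyl_compose [OF c])
      show "continuous_map (cyl ?Q) euclideanreal (\<lambda>z. fst z * ?m (snd z))"
        by (intro continuous_intros continuous_map_fst_cyl continuous_map_depth [OF continuous_map_snd]) auto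
      show "0 \<le> fst z * ?m (snd z) \<and> fst z * ?m (snd z) \<le> 1" if "z \<in> topspace (cyl ?Q)" for z
      proof -
        have "0 \<le> fst z" "fst z \<le> 1" "0 \<le> ?m (snd z)" "?m (snd z) \<le> 1"
          using that m01 by auto
        then show ?thesis by (metis mult_le_one mult_nonneg_nonneg)
      qed
    qed (use \<zeta>_Fib C_top [OF \<zeta>] in auto)
    then show "continuous_map (cyl ?Q) ?C ?k"
      using c0 \<zeta>_Fib \<zeta> by (intro continuous_map_into_C) auto
  qed (use c0 \<zeta>_Fib depth_boundary in auto)
  have 5: "spheroid_homotopic k ?C \<zeta> (\<lambda>x. h (?m x, zoom x)) (\<lambda>x. c (?m x, \<zeta>))"
    using hs(2) 3 by (rule spheroid_homotopic_eq)
  have 6: "spheroid_homotopic k ?C \<zeta> f (\<lambda>x. L (0, x))"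
    using f L(2) by (intro spheroid_homotopic_eq) auto
  have 7: "spheroid_homotopic k ?C \<zeta> ?g (\<lambda>x. h (0, x))"
    using g c0 gF by (intro spheroid_homotopic_eq) (auto simp: h_def)
  show ?thesis
    using spheroid_homotopic_trans [OF 6 spheroid_homotopic_trans [OF 1 spheroid_homotopic_trans
      [OF 7 spheroid_homotopic_trans [OF 2 spheroid_homotopic_trans [OF 5 spheroid_homotopic_sym [OF 4]]]]]] .
qed

text \<open>A spheroid is lifted from one vertex of the cube; its boundary then lies in the fibre and is
  contracted by \<open>c\<close> on a collar.\<close>

lemma spheroid_lift:
  assumes k: "1 \<le> k" and m: "l \<le> m" and f: "spheroid k (CT m) (pr m \<zeta>) f"
  obtains g where "spheroid k (subtopology ZZ C) \<zeta> g"
    "spheroid_homotopic k (CT \<kappa>) (pr \<kappa> \<zeta>) (p m \<kappa> \<circ> f) (pr \<kappa> \<circ> g)"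
proof -
  let ?Q = "unit_cube k" and ?C = "subtopology ZZ C"
  have fZ: "continuous_map ?Q (Z m) f"
    using f continuous_map_into_fulltopology unfolding spheroid_def by blast
  \<comment> \<open>Scaling towards the vertex 0 contracts \<open>f\<close> with free boundary. As
    \<open>1 \<le> k\<close>, this vertex is a boundary point, where \<open>f\<close> takes the base
    point; so the lift can start from the constant map \<zeta>.\<close>
  let ?H = "\<lambda>z. f (\<lambda>i. fst z * snd z i)"
  have scale: "continuous_map (cyl ?Q) ?Q (\<lambda>z i. fst z * snd z i)"
  proof (rule continuous_map_cubeI)
    show "continuous_map (cyl ?Q) euclideanreal (\<lambda>z. fst z * snd z i)" for i
      by (intro continuous_intros continuous_map_fst_cyl continuous_map_cube_coord [OF continuous_map_snd])
    show "(\<lambda>i. fst z * snd z i) \<in> topspace ?Q" if "z \<in> topspace (cyl ?Q)" for z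
      using that by (auto simp: topspace_unit_cube mult_le_one)
  qed
  have H: "continuous_map (cyl ?Q) (Z m) ?H"
    using continuous_map_compose [OF scale fZ] by (simp add: o_def)
  have "(\<lambda>i. 0) \<in> cube_boundary k"
    using k by (auto simp: cube_boundary_def topspace_unit_cube intro: exI [of _ 0])
  then have H0: "?H (0, x) = pr m \<zeta>" for x
    using f by (simp add: spheroid_def)
  have const: "continuous_map ?Q ZZ (\<lambda>_. \<zeta>)"
    using C_top [OF \<zeta>] by simp
  obtain L where L: "continuous_map (cyl ?Q) ZZ L" "\<And>x. x \<in> topspace ?Q \<Longrightarrow> L (0, x) = \<zeta>"
    "\<And>t x. t \<in> {0..1} \<Longrightarrow> x \<in> topspace ?Q \<Longrightarrow> pr m (L (t, x)) = ?H (t, x)"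
    using lifting [of m "top_class.top", unfolded homotopy_lifting_def, rule_format, OF _ const H] H0 by auto
  define F where "F x = L (1, x)" for x
  have LC: "continuous_map (cyl ?Q) ?C L"
    using L \<zeta> by (intro continuous_map_into_C) auto
  have FC: "continuous_map ?Q ?C F"
    unfolding F_def by (rule continuous_map_cyl_at [OF LC]) simp
  have F: "F x \<in> C" "pr m (F x) = f x" if "x \<in> topspace ?Q" for x
    using continuous_map_cyl_in [OF LC _ that, of 1] L(3) [OF _ that, of 1] by (auto simp: F_def)
  have FF: "F x \<in> Fib l" if "x \<in> cube_boundary k" for x
  proof -
    have "x \<in> topspace ?Q" using that cube_boundary_subset by blast
    then have "F x \<in> Fib m" using F [of x] f that by (simp add: Fib_def spheroid_def)
    then show ?thesis using Fib_mono [OF m] by blast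
  qed
  \<comment> \<open>The time \<open>1 - 4 * depth k x\<close> is 0 at the inner edge of the collar
    and 1 on the boundary of the cube, where \<open>c\<close> arrives at \<zeta>.\<close>
  let ?g = "\<lambda>x. if 1/4 \<le> depth k x then F (zoom x) else c (1 - 4 * depth k x, F (zoom x))"
  have idQ: "continuous_map (subtopology ?Q S) ?Q (\<lambda>x. x)" for S
    by (simp add: continuous_map_from_subtopology continuous_map_id [unfolded id_def])
  have gC: "continuous_map ?Q ZZ ?g"
  proof (rule continuous_map_cases_le)
    show "continuous_map ?Q euclideanreal (depth k)"
      using continuous_map_depth [OF continuous_map_id [unfolded id_def]] .
    have Fz: "continuous_map (subtopology ?Q S) ZZ (\<lambda>x. F (zoom x))" for S
      using continuous_map_compose [OF continuous_map_zoom [OF idQ] continuous_map_into_fulltopology [OF FC]]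
      by (simp add: o_def)
    then show "continuous_map (subtopology ?Q {x \<in> topspace ?Q. 1/4 \<le> depth k x}) ZZ (\<lambda>x. F (zoom x))" .
    show "continuous_map (subtopology ?Q {x \<in> topspace ?Q. depth k x \<le> 1/4}) ZZ (\<lambda>x. c (1 - 4 * depth k x, F (zoom x)))"
    proof (rule continuous_map_cyl_compose [OF c])
      let ?S = "{x \<in> topspace ?Q. depth k x \<le> 1/4}"
      show "continuous_map (subtopology ?Q ?S) euclideanreal (\<lambda>x. 1 - 4 * depth k x)"
        by (intro continuous_intros continuous_map_depth [OF idQ]) auto
      show "0 \<le> 1 - 4 * depth k x \<and> 1 - 4 * depth k x \<le> 1" if "x \<in> topspace (subtopology ?Q ?S)" for x
        using that depth_nonneg [of x k] by auto
      show "continuous_map (subtopology ?Q ?S) (subtopology ZZ (Fib l)) (\<lambda>x. F (zoom x))"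
        using Fz FF zoom_boundary by (auto simp: continuous_map_in_subtopology)
    qed
    show "F (zoom x) = c (1 - 4 * depth k x, F (zoom x))" if "x \<in> topspace ?Q" "1/4 = depth k x" for x
    proof -
      have "1 - 4 * depth k x = 0" using that(2) by simp
      then show ?thesis using c0 [OF FF [OF zoom_boundary [OF that(1)]]] that(2) by (simp only: order_refl)
    qed
  qed simp
  \<comment> \<open>Over \<kappa> the contraction is invisible, so \<open>?g\<close> projects
    exactly to the projection of \<open>f\<close> after \<open>zoom\<close>.\<close>
  have gx: "?g x \<in> C \<and> pr \<kappa> (?g x) = p m \<kappa> (f (zoom x))" if x: "x \<in> topspace ?Q" for x
  proof (cases "1/4 \<le> depth k x")
    case True
    have "p m \<kappa> (pr m (F (zoom x))) = pr \<kappa> (F (zoom x))"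
      using F(1) [OF zoom_cube [OF x]] C_top l m by (intro pr_comp) auto
    then show ?thesis using True F [OF zoom_cube [OF x]] by simp
  next
    case False
    have b: "zoom x \<in> cube_boundary k" using zoom_boundary [OF x] False by simp
    have "c (1 - 4 * depth k x, F (zoom x)) \<in> Fib \<kappa>"
      using False depth_nonneg [OF x] by (intro cF FF b) auto
    moreover have "p m \<kappa> (f (zoom x)) = pr \<kappa> \<zeta>"
    proof -
      have "p m \<kappa> (pr m \<zeta>) = pr \<kappa> \<zeta>"
        using C_top [OF \<zeta>] l m by (intro pr_comp) auto
      then show ?thesis using f b by (simp add: spheroid_def)
    qed
    ultimately show ?thesis using False by (simp add: Fib_def)
  qed
  have g: "spheroid k ?C \<zeta> ?g"
    unfolding spheroid_def continuous_map_in_subtopology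
  proof (intro conjI ballI)
    show "?g \<in> topspace ?Q \<rightarrow> C" using gx by blast
    fix x assume x: "x \<in> cube_boundary k"
    then have "x \<in> topspace ?Q" using cube_boundary_subset by blast
    then show "?g x = \<zeta>"
      using depth_boundary [OF x] c1 [OF FF] zoom_boundary by simp
  qed (rule gC)
  have "spheroid_homotopic k (CT m) (pr m \<zeta>) f (\<lambda>x. f (zoom x))"
    by (rule spheroid_zoom [OF f])
  from spheroid_compose_pr [OF order_trans [OF l m] this]
  have 1: "spheroid_homotopic k (CT \<kappa>) (pr \<kappa> \<zeta>) (p m \<kappa> \<circ> f) (p m \<kappa> \<circ> (\<lambda>x. f (zoom x)))" .
  then have "spheroid k (CT \<kappa>) (pr \<kappa> \<zeta>) (p m \<kappa> \<circ> (\<lambda>x. f (zoom x)))"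
    by (rule spheroid_homotopicD)
  then have "spheroid_homotopic k (CT \<kappa>) (pr \<kappa> \<zeta>) (p m \<kappa> \<circ> (\<lambda>x. f (zoom x))) (pr \<kappa> \<circ> ?g)"
    by (rule spheroid_homotopic_eq) (use gx in simp)
  from that [OF g spheroid_homotopic_trans [OF 1 this]] show ?thesis .
qed

end

end

section \<open>Phantom components\<close>

text \<open>Paths are treated as homotopies of the one-point space, so that concatenation, lifting
  and \<open>squeeze\<close> apply to them unchanged.\<close>

abbreviation pt :: "unit topology" where
  "pt \<equiv> discrete_topology {()}"

lemma path_component_of_cylE:
  assumes "path_component_of X x y"
  obtains f where "continuous_map (cyl pt) X f" "f (0, ()) = x" "f (1, ()) = y"
proof -
  obtain g where g: "pathin X g" "g 0 = x" "g 1 = y"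
    using assms by (auto simp: path_component_of_def)
  have "continuous_map (cyl pt) X (g \<circ> fst)"
    using g(1) unfolding pathin_def by (intro continuous_map_compose [OF continuous_map_fst])
  then show ?thesis using that g(2,3) by simp
qed

context restricted_fibrations
begin

lemma C_connected: "x \<in> C \<Longrightarrow> y \<in> C \<Longrightarrow> path_component_of ZZ x y"
  using C_eq by blast

lemma path_lift:
  assumes "l \<le> m" "continuous_map (cyl pt) (Z l) \<gamma>" "z \<in> topspace (Z m)" "\<gamma> (0, ()) = p m l z"
  obtains g where "continuous_map (cyl pt) (Z m) g" "g (0, ()) = z"
    "\<And>t. t \<in> {0..1} \<Longrightarrow> p m l (g (t, ())) = \<gamma> (t, ())"
proof -
  have "continuous_map pt (Z m) (\<lambda>_. z)" using assms(3) by simp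
  from lifting [OF assms(1), of pt, unfolded homotopy_lifting_def, rule_format, OF this assms(2)]
  obtain G where "continuous_map (cyl pt) (Z m) G" "\<forall>x\<in>topspace pt. G (0, x) = z"
    "\<forall>t\<in>{0..1}. \<forall>x\<in>topspace pt. p m l (G (t, x)) = \<gamma> (t, x)"
    using assms(4) by auto
  then show ?thesis using that by simp
qed

text \<open>Openness puts the whole fibre over the image of \<zeta> into \<open>C\<close> once the
  index is large. If \<open>z\<close> has the same image as some \<open>y\<close> in
  \<open>C\<close>, a path from \<open>y\<close> to \<zeta> is projected and lifted from
  \<open>z\<close>; the lift ends in that fibre, hence in \<open>C\<close>.\<close>

lemma open_component:
  assumes "openin ZZ C"
  shows "\<exists>\<kappa>\<^sub>0\<in>KK. \<forall>\<kappa>. \<kappa>\<^sub>0 \<le> \<kappa> \<longrightarrow> {z \<in> topspace ZZ. pr \<kappa> z \<in> pr \<kappa> ` C} = C"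
proof -
  obtain \<kappa>\<^sub>0 where \<kappa>\<^sub>0: "\<kappa>\<^sub>0 \<in> KK" "\<And>z. z \<in> topspace ZZ \<Longrightarrow> pr \<kappa>\<^sub>0 z = pr \<kappa>\<^sub>0 \<zeta> \<Longrightarrow> z \<in> C"
    using fibre_nbhd [OF assms \<zeta>] by blast
  have "z \<in> C" if le: "\<kappa>\<^sub>0 \<le> \<kappa>" and z: "z \<in> topspace ZZ" and y: "y \<in> C" "pr \<kappa> z = pr \<kappa> y" for \<kappa> z y
  proof -
    obtain f where f: "continuous_map (cyl pt) ZZ f" "f (0, ()) = y" "f (1, ()) = \<zeta>"
      using path_component_of_cylE [OF C_connected [OF y(1) \<zeta>]] .
    have "continuous_map (cyl pt) (Z \<kappa>) (\<lambda>z. pr \<kappa> (f z))"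
      using continuous_map_compose [OF f(1) pr_continuous] by (simp add: o_def)
    from path_lift [OF top_greatest this z]
    obtain g where g: "continuous_map (cyl pt) ZZ g" "g (0, ()) = z"
      "\<And>t. t \<in> {0..1} \<Longrightarrow> pr \<kappa> (g (t, ())) = pr \<kappa> (f (t, ()))"
      using f(2) y(2) by auto
    have g1: "g (1, ()) \<in> topspace ZZ"
      using continuous_map_cyl_in [OF g(1)] by simp
    have "pr \<kappa> (g (1, ())) = pr \<kappa> \<zeta>" using g(3) [of 1] f(3) by simp
    then have "pr \<kappa>\<^sub>0 (g (1, ())) = pr \<kappa>\<^sub>0 \<zeta>"
      using pr_comp [OF le g1] pr_comp [OF le C_top [OF \<zeta>]] by simp
    then have "g (1, ()) \<in> C" using \<kappa>\<^sub>0(2) g1 by blast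
    moreover have "path_component_of ZZ (g (1, ())) (g (0, ()))"
      by (rule cyl_path_component [OF g(1)]) auto
    ultimately show ?thesis using C_path g(2) by simp
  qed
  then have "{z \<in> topspace ZZ. pr \<kappa> z \<in> pr \<kappa> ` C} = C" if "\<kappa>\<^sub>0 \<le> \<kappa>" for \<kappa>
    using that C_subset by auto
  then show ?thesis using \<kappa>\<^sub>0(1) by auto
qed

lemma Ph_eqI:
  assumes "\<And>D. D \<in> path_components_of ZZ \<Longrightarrow> (\<And>\<kappa>. \<kappa> \<in> KK \<Longrightarrow> pr \<kappa> ` D = pr \<kappa> ` C) \<Longrightarrow> \<exists>x\<in>D. x \<in> C"
  shows "Ph Z p C = {C}"
proof -
  have "D = C" if "D \<in> path_components_of ZZ" "\<And>\<kappa>. \<kappa> \<in> KK \<Longrightarrow> pr \<kappa> ` D = pr \<kappa> ` C" for D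
    using assms [OF that] path_components_of_eq [OF that(1)] C_eq by metis
  then show ?thesis using C by (auto simp: Ph_def phantom_pair_def)
qed

section \<open>Limits along a sequence and infinite concatenation\<close>

lemma sequential_limit:
  fixes ks :: "nat \<Rightarrow> 'x"
  assumes ks: "mono ks" "Sup (range ks) = top_class.top"
    and u: "\<And>n. continuous_map X (Z (ks n)) (u n)"
    and compat: "\<And>n m x. n \<le> m \<Longrightarrow> x \<in> topspace X \<Longrightarrow> p (ks m) (ks n) (u m x) = u n x"
  obtains g where "continuous_map X ZZ g" "\<And>n x. x \<in> topspace X \<Longrightarrow> pr (ks n) (g x) = u n x"
proof -
  let ?L = "range ks" and ?h = "\<lambda>z. restrict (\<lambda>l. pr l z) (range ks)"
  have "directed_set ?L"
    unfolding directed_set_def using ks(1) by (auto simp: mono_def) (metis nat_le_linear order_refl)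
  from pr_homeomorphic [OF this ks(2)]
  obtain k where k: "homeomorphic_maps ZZ (inverse_limit Z p ?L) ?h k"
    by (auto simp: homeomorphic_map_maps)
  have uin: "u n x \<in> topspace (Z (ks n))" if "x \<in> topspace X" for n x
    using continuous_map_image_subset_topspace [OF u] that by blast
  have ueq': "u n x = u n' x" if "ks n = ks n'" "n \<le> n'" "x \<in> topspace X" for n n' x
    using compat [OF that(2,3)] p_refl [OF uin [OF that(3)]] that(1) by metis
  have ueq: "u n x = u n' x" if "ks n = ks n'" "x \<in> topspace X" for n n' x
    using ueq' [of n n' x] ueq' [of n' n x] that by (metis nat_le_linear)
  \<comment> \<open>The limit is indexed by the values of \<open>ks\<close>, which may repeat; the
    choice of \<open>n\<close> is immaterial by \<open>ueq\<close>.\<close>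
  define i where "i l = (SOME n. ks n = l)" for l
  have i: "ks (i l) = l" if "l \<in> ?L" for l
    unfolding i_def using that by (metis (mono_tags) imageE someI)
  define v where "v x = restrict (\<lambda>l. u (i l) x) ?L" for x
  have ui: "u (i (ks n)) x = u n x" if "x \<in> topspace X" for n x
    using ueq [OF i that] by simp
  have vc: "continuous_map X (inverse_limit Z p ?L) v"
    unfolding inverse_limit_def continuous_map_in_subtopology
  proof
    have "continuous_map X (Z l) (\<lambda>x. v x l)" if "l \<in> ?L" for l
      using u [of "i l"] i [OF that] that by (simp add: v_def)
    then show "continuous_map X (product_topology Z ?L) v"
      by (auto simp: continuous_map_componentwise v_def)
    have "p m l (v x m) = v x l" if lm: "l \<in> ?L" "m \<in> ?L" "l \<le> m" and x: "x \<in> topspace X" for l m x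
    proof (cases "i l \<le> i m")
      case True
      then show ?thesis using compat [OF True x] i lm by (simp add: v_def)
    next
      case False
      then have "ks (i m) \<le> ks (i l)" using ks(1) by (simp add: mono_def)
      then have "l = m" using i lm by simp
      then show ?thesis using lm p_refl uin [OF x, of "i m"] i [OF lm(2)] by (simp add: v_def)
    qed
    then show "v \<in> topspace X \<rightarrow> {z. \<forall>l\<in>?L. \<forall>m\<in>?L. l \<le> m \<longrightarrow> p m l (z m) = z l}" by auto
  qed
  show ?thesis
  proof
    show "continuous_map X ZZ (k \<circ> v)"
      using vc k continuous_map_compose unfolding homeomorphic_maps_def by blast
    fix n x assume x: "x \<in> topspace X"
    have "v x \<in> topspace (inverse_limit Z p ?L)"
      using continuous_map_image_subset_topspace [OF vc] x by blast
    then have "?h (k (v x)) = v x"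
      using k unfolding homeomorphic_maps_def by blast
    then have "?h (k (v x)) (ks n) = v x (ks n)" by simp
    then show "pr (ks n) ((k \<circ> v) x) = u n x"
      using ui [OF x] by (simp add: v_def)
  qed
qed

lemma sequential_eq:
  assumes "mono ks" "Sup (range ks) = top_class.top" "y \<in> topspace ZZ" "z \<in> topspace ZZ"
    "\<And>n::nat. pr (ks n) y = pr (ks n) z"
  shows "y = z"
proof -
  have "directed_set (range ks)"
    unfolding directed_set_def using assms(1) by (auto simp: mono_def) (metis nat_le_linear order_refl)
  from pr_homeomorphic [OF this assms(2)]
  have "inj_on (\<lambda>z. restrict (\<lambda>l. pr l z) (range ks)) (topspace ZZ)"
    by (rule homeomorphic_imp_injective_map)
  moreover have "restrict (\<lambda>l. pr l y) (range ks) = restrict (\<lambda>l. pr l z) (range ks)"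
    by (rule restrict_ext) (use assms(5) in auto)
  ultimately show ?thesis using assms(3,4) by (simp add: inj_on_def)
qed

text \<open>The loop over \<open>l\<close> obstructing the choice of a path inside the fibre is killed by a loop in \<open>C\<close>: this is
  the Mittag-Leffler property of the fundamental groups.\<close>

lemma fibre_path_step:
  assumes le: "\<kappa> \<le> l" "l \<le> m"
    and contr: "\<And>x. x \<in> Fib l \<Longrightarrow> \<exists>f. continuous_map (cyl pt) ZZ f \<and> f (0, ()) = x \<and> f (1, ()) = \<zeta> \<and>
        (\<forall>t\<in>{0..1}. pr \<kappa> (f (t, ())) = pr \<kappa> \<zeta>)"
    and d: "d \<in> topspace ZZ" "pr l d = pr l \<zeta>" "pr m d \<in> pr m ` C"
  shows "\<exists>f. continuous_map (cyl pt) ZZ f \<and> f (0, ()) = d \<and> pr m (f (1, ())) = pr m \<zeta> \<and>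
        (\<forall>t\<in>{0..1}. pr \<kappa> (f (t, ())) = pr \<kappa> \<zeta>)"
proof -
  have \<kappa>m: "\<kappa> \<le> m" using le by simp
  obtain y where y: "y \<in> C" "pr m d = pr m y" using d(3) by blast
  obtain f where f: "continuous_map (cyl pt) ZZ f" "f (0, ()) = y" "f (1, ()) = \<zeta>"
    using path_component_of_cylE [OF C_connected [OF y(1) \<zeta>]] .
  have proj: "continuous_map (cyl pt) (Z i) (\<lambda>z. pr i (g z))" if "continuous_map (cyl pt) ZZ g" for g i
    using continuous_map_compose [OF that pr_continuous] by (simp add: o_def)
  have fin: "g (t, ()) \<in> topspace ZZ" if "continuous_map (cyl pt) ZZ g" "t \<in> {0..1}" for g t
    using continuous_map_cyl_in [OF that] by simp
  \<comment> \<open>Over \<open>l\<close> the path \<open>f\<close> is a loop at the base point,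
    although \<open>y\<close> may differ from \<zeta>. Its lift \<tau> from \<zeta> therefore ends
    in \<open>Fib l\<close>.\<close>
  have f0: "pr l (f (0, ())) = pr l \<zeta>"
    using pr_comp [OF le(2) d(1)] pr_comp [OF le(2) C_top [OF y(1)]] d(2) y(2) f(2) by simp
  from path_lift [OF top_greatest proj [OF f(1)] C_top [OF \<zeta>] f0]
  obtain \<tau> where \<tau>: "continuous_map (cyl pt) ZZ \<tau>" "\<tau> (0, ()) = \<zeta>"
    "\<And>t. t \<in> {0..1} \<Longrightarrow> pr l (\<tau> (t, ())) = pr l (f (t, ()))"
    by blast
  have "path_component_of ZZ (\<tau> (0, ())) (\<tau> (1, ()))"
    by (rule cyl_path_component [OF \<tau>(1)]) auto
  then have "\<tau> (1, ()) \<in> Fib l"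
    using C_path [OF \<zeta>] \<tau>(2) \<tau>(3) [of 1] f(3) by (simp add: Fib_def)
  from contr [OF this] obtain \<rho> where \<rho>: "continuous_map (cyl pt) ZZ \<rho>" "\<rho> (0, ()) = \<tau> (1, ())" "\<rho> (1, ()) = \<zeta>"
    "\<And>t. t \<in> {0..1} \<Longrightarrow> pr \<kappa> (\<rho> (t, ())) = pr \<kappa> \<zeta>"
    by blast
  \<comment> \<open>\<tau> followed by \<rho> is a loop in \<open>C\<close> that agrees with
    \<open>f\<close> over \<kappa> up to a constant piece. Its reverse after \<open>f\<close> leads
    to the base point of \<open>Z m\<close> and cancels \<open>f\<close> over \<kappa>.\<close>
  let ?\<delta> = "conc (\<lambda>z. pr m (f z)) (conc (rev_path (\<lambda>z. pr m (\<rho> z))) (rev_path (\<lambda>z. pr m (\<tau> z))))"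
  have "continuous_map (cyl pt) (Z m) ?\<delta>"
    by (intro continuous_map_conc continuous_map_rev_path proj f(1) \<rho>(1) \<tau>(1)) (use f \<rho> \<tau> in auto)
  from path_lift [OF top_greatest this d(1)]
  obtain \<sigma> where \<sigma>: "continuous_map (cyl pt) ZZ \<sigma>" "\<sigma> (0, ()) = d"
    "\<And>t. t \<in> {0..1} \<Longrightarrow> pr m (\<sigma> (t, ())) = ?\<delta> (t, ())"
    using y(2) f(2) by auto
  define \<omega> where "\<omega> t = pr \<kappa> (f (t, ()))" for t
  \<comment> \<open>The profile of the nested \<open>conc\<close>: \<omega> forwards on [0, 1/2],
    rest on [1/2, 3/4], \<omega> backwards on [3/4, 1]. It vanishes at both ends, so scaling it by
    \<open>1 - s\<close> contracts the loop with fixed end points.\<close>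
  let ?w = "\<lambda>t. min (2 * t) (min 1 (4 - 4 * t)) :: real"
  have \<tau>\<kappa>: "pr \<kappa> (\<tau> (t, ())) = \<omega> t" if "t \<in> {0..1}" for t
    using pr_comp [OF le(1) fin [OF \<tau>(1) that]] pr_comp [OF le(1) fin [OF f(1) that]] \<tau>(3) [OF that]
    by (simp add: \<omega>_def)
  have \<omega>1: "\<omega> 1 = pr \<kappa> \<zeta>" by (simp add: \<omega>_def f(3))
  have \<omega>0: "\<omega> 0 = pr \<kappa> \<zeta>" using \<tau>\<kappa> [of 0] \<tau>(2) by simp
  have \<sigma>\<kappa>: "pr \<kappa> (\<sigma> (t, ())) = \<omega> (?w t)" if t: "t \<in> {0..1}" for t
  proof -
    have pm: "p m \<kappa> (pr m (g (s, ()))) = pr \<kappa> (g (s, ()))" if "continuous_map (cyl pt) ZZ g" "s \<in> {0..1}" for g s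
      using pr_comp [OF \<kappa>m fin [OF that]] .
    have "pr \<kappa> (\<sigma> (t, ())) = p m \<kappa> (?\<delta> (t, ()))"
      using pr_comp [OF \<kappa>m fin [OF \<sigma>(1) t]] \<sigma>(3) [OF t] by simp
    also have "\<dots> = conc (\<lambda>(s, x). \<omega> s) (conc (\<lambda>(s, x). pr \<kappa> \<zeta>) (\<lambda>(s, x). \<omega> (1 - s))) (t, ())"
      by (intro conc_map t) (use \<tau>\<kappa> \<rho>(4) pm [OF f(1)] pm [OF \<rho>(1)] pm [OF \<tau>(1)] in \<open>auto simp: rev_path_def \<omega>_def\<close>)
    also have "\<dots> = \<omega> (?w t)"
    proof -
      consider "t \<le> 1/2" | "1/2 < t" "t \<le> 3/4" | "3/4 < t" by linarith
      then show ?thesis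
      proof cases
        case 1 then show ?thesis by (simp add: conc_def min_def)
      next
        case 2
        then have "?w t = 1" by (auto simp: min_def)
        then show ?thesis using 2 by (simp add: conc_def \<omega>1)
      next
        case 3
        then have "?w t = 1 - (2 * (2 * t - 1) - 1)" by (auto simp: min_def)
        then show ?thesis using 3 by (simp add: conc_def)
      qed
    qed
    finally show ?thesis .
  qed
  have K: "continuous_map (cyl (cyl pt)) (Z \<kappa>) (\<lambda>(s, (t, x)). \<omega> ((1 - s) * ?w t))"
  proof -
    have ff: "continuous_map (cyl (cyl pt)) euclideanreal (\<lambda>z. fst (snd z))"
      using continuous_map_compose [OF continuous_map_snd continuous_map_fst_cyl] by (simp add: o_def)
    have "continuous_map (cyl (cyl pt)) (Z \<kappa>) (\<lambda>z. pr \<kappa> (f ((1 - fst z) * ?w (fst (snd z)), ())))"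
    proof (rule continuous_map_cyl_compose [OF proj [OF f(1)]])
      show "continuous_map (cyl (cyl pt)) euclideanreal (\<lambda>z. (1 - fst z) * ?w (fst (snd z)))"
        by (intro continuous_intros ff continuous_map_fst_cyl) auto
      show "0 \<le> (1 - fst z) * ?w (fst (snd z)) \<and> (1 - fst z) * ?w (fst (snd z)) \<le> 1"
        if "z \<in> topspace (cyl (cyl pt))" for z
      proof -
        have "0 \<le> 1 - fst z" "1 - fst z \<le> 1" "0 \<le> ?w (fst (snd z))" "?w (fst (snd z)) \<le> 1"
          using that by auto
        then show ?thesis by (metis mult_le_one mult_nonneg_nonneg)
      qed
    qed auto
    then show ?thesis by (simp add: \<omega>_def case_prod_beta')
  qed
  obtain Q where Q: "continuous_map (cyl pt) ZZ Q"
    "\<And>x. x \<in> topspace pt \<Longrightarrow> Q (0, x) = \<sigma> (0, x)" "\<And>x. x \<in> topspace pt \<Longrightarrow> Q (1, x) = \<sigma> (1, x)"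
    "\<And>t x. t \<in> {0..1} \<Longrightarrow> x \<in> topspace pt \<Longrightarrow>
       pr \<kappa> (Q (t, x)) = conc (conc (\<lambda>(s, x). (\<lambda>(s, (t, x)). \<omega> ((1 - s) * ?w t)) (s, (0, x)))
           (\<lambda>(s, x). (\<lambda>(s, (t, x)). \<omega> ((1 - s) * ?w t)) (1, (s, x))))
           (rev_path (\<lambda>(s, x). (\<lambda>(s, (t, x)). \<omega> ((1 - s) * ?w t)) (s, (1, x)))) (t, x)"
    by (rule squeeze [OF lifting \<sigma>(1) K]) (use \<sigma>\<kappa> in auto)
  have "pr \<kappa> (Q (t, ())) = pr \<kappa> \<zeta>" if "t \<in> {0..1}" for t
    using Q(4) [OF that, of "()"] \<omega>0 by (simp add: conc_def rev_path_def split: if_splits)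
  moreover have "pr m (Q (1, ())) = pr m \<zeta>"
    using Q(3) [of "()"] \<sigma>(3) [of 1] \<tau>(2) by simp
  ultimately show ?thesis using Q(1) Q(2) [of "()"] \<sigma>(2) by auto
qed

text \<open>The projections of the partial concatenations \<open>G n\<close> stabilize, because the \<open>n\<close>-th path is
  constant over \<open>ks n\<close>.\<close>

lemma infinite_concatenation:
  fixes ks :: "nat \<Rightarrow> 'x" and d :: "nat \<Rightarrow> 'a" and \<sigma> :: "nat \<Rightarrow> real \<times> unit \<Rightarrow> 'a"
  assumes ks: "mono ks" "Sup (range ks) = top_class.top"
    and \<sigma>: "\<And>n. continuous_map (cyl pt) ZZ (\<sigma> n)" "\<And>n. \<sigma> n (0, ()) = d n" "\<And>n. \<sigma> n (1, ()) = d (Suc n)"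
      "\<And>n t. t \<in> {0..1} \<Longrightarrow> pr (ks n) (\<sigma> n (t, ())) = pr (ks n) \<zeta>"
  shows "path_component_of ZZ (d 0) \<zeta>"
proof -
  \<comment> \<open>The n-th path occupies the interval from \<open>a n\<close> to
    \<open>a (Suc n)\<close>, of length 1/2^(n+1). \<open>G n\<close> follows the paths before the
    n-th and then waits at \<open>d n\<close>.\<close>
  define a :: "nat \<Rightarrow> real" where "a n = 1 - (1/2) ^ n" for n
  have a: "a 0 = 0" "0 \<le> a n" "a n < 1" "a n \<le> a (Suc n)" for n
    by (auto simp: a_def power_le_one)
  have a_Suc: "(a (Suc n) - a n) * 2 ^ Suc n = 1" for n
    by (simp add: a_def field_simps)
  define G where "G = rec_nat (\<lambda>t. d 0) (\<lambda>n g t. if t \<le> a n then g t else \<sigma> n (max 0 (min 1 ((t - a n) * 2 ^ Suc n)), ()))"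
  have G0: "G 0 t = d 0" and GS: "G (Suc n) t = (if t \<le> a n then G n t else \<sigma> n (max 0 (min 1 ((t - a n) * 2 ^ Suc n)), ()))" for n t
    by (simp_all add: G_def)
  have \<sigma>in: "\<sigma> n (t, ()) \<in> topspace ZZ" if "t \<in> {0..1}" for n t
    using continuous_map_cyl_in [OF \<sigma>(1) that] by simp
  have din: "d n \<in> topspace ZZ" for n
    using \<sigma>in [of 0 n] \<sigma>(2) by simp
  have Gd: "G n t = d n" if "a n \<le> t" for n t
  proof (cases n)
    case (Suc k)
    have "(a n - a k) * 2 ^ n \<le> (t - a k) * 2 ^ n"
      using that by (intro mult_right_mono) auto
    then have "1 \<le> (t - a k) * 2 ^ n"
      using a_Suc [of k] Suc by (simp del: power_Suc)
    then have "max 0 (min 1 ((t - a k) * 2 ^ n)) = 1"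
      by simp
    moreover have "\<not> t \<le> a k"
    proof
      assume "t \<le> a k"
      then have "a (Suc k) \<le> a k" using that Suc by simp
      then show False by (simp add: a_def)
    qed
    ultimately show ?thesis using GS [of k t] \<sigma>(3) Suc by simp
  qed (simp add: G0)
  let ?I = "top_of_set {0..1::real}"
  have tc: "continuous_map (subtopology ?I S) euclideanreal (\<lambda>t. t)" for S
    by (intro continuous_map_from_subtopology) (simp add: continuous_map_in_subtopology continuous_map_id [unfolded id_def])
  have Gc: "continuous_map ?I ZZ (G n)" for n
  proof (induction n)
    case 0
    then show ?case using din by (simp add: G0 [abs_def])
  next
    case (Suc n)
    have "continuous_map ?I ZZ (\<lambda>t. if t \<le> a n then G n t else \<sigma> n (max 0 (min 1 ((t - a n) * 2 ^ Suc n)), ()))"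
    proof (rule continuous_map_cases_le)
      show "continuous_map (subtopology ?I {t \<in> topspace ?I. t \<le> a n}) ZZ (G n)"
        using Suc by (rule continuous_map_from_subtopology)
      show "continuous_map (subtopology ?I {t \<in> topspace ?I. a n \<le> t}) ZZ
          (\<lambda>t. \<sigma> n (max 0 (min 1 ((t - a n) * 2 ^ Suc n)), ()))"
        by (intro continuous_map_cyl_compose [OF \<sigma>(1)] continuous_intros tc) auto
      show "G n t = \<sigma> n (max 0 (min 1 ((t - a n) * 2 ^ Suc n)), ())" if "t = a n" for t
        using Gd [of n t] that \<sigma>(2) by simp
    qed (use tc [of UNIV] in auto)
    then show ?case by (simp add: GS [abs_def])
  qed
  have Gin: "G n t \<in> topspace ZZ" if "t \<in> {0..1}" for n t
    using continuous_map_image_subset_topspace [OF Gc, of n] that by (simp add: image_subset_iff)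
  have ps: "pr (ks m) (\<sigma> n (t, ())) = pr (ks m) \<zeta>" if "m \<le> n" "t \<in> {0..1}" for m n t
  proof -
    have "ks m \<le> ks n" using ks(1) that by (simp add: mono_def)
    then show ?thesis
      using \<sigma>(4) [OF that(2)] pr_comp [of "ks m" "ks n"] \<sigma>in [OF that(2)] C_top [OF \<zeta>] by metis
  qed
  have pd: "pr (ks m) (d n) = pr (ks m) \<zeta>" if "m \<le> n" for m n
    using ps [OF that, of 0] \<sigma>(2) by simp
  have step: "pr (ks m) (G (Suc n) t) = pr (ks m) (G n t)" if "m \<le> n" "t \<in> {0..1}" for m n t
  proof (cases "t \<le> a n")
    case False
    let ?r = "max 0 (min 1 ((t - a n) * 2 ^ Suc n))"
    have r: "?r \<in> {0..1}" by simp
    have 1: "G (Suc n) t = \<sigma> n (?r, ())" by (simp only: GS False if_False)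
    have 2: "G n t = d n" using Gd False by simp
    show ?thesis by (simp only: 1 2 ps [OF that(1) r] pd [OF that(1)])
  qed (simp add: GS)
  have stable: "pr (ks m) (G n t) = pr (ks m) (G m t)" if "m \<le> n" "t \<in> {0..1}" for m n t
    using that(1) by (induction n rule: dec_induct) (use step that(2) in auto)
  \<comment> \<open>Over each \<open>ks n\<close> the limit path coincides with the single path
    \<open>G n\<close>. Continuity at time 1 thus comes from the topology of the limit.\<close>
  obtain g where g: "continuous_map ?I ZZ g" "\<And>n t. t \<in> topspace ?I \<Longrightarrow> pr (ks n) (g t) = pr (ks n) (G n t)"
  proof (rule sequential_limit [OF ks, of ?I "\<lambda>n t. pr (ks n) (G n t)"])
    show "continuous_map ?I (Z (ks n)) (\<lambda>t. pr (ks n) (G n t))" for n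
      using continuous_map_compose [OF Gc pr_continuous] by (simp add: o_def)
    show "p (ks m) (ks n) (pr (ks m) (G m t)) = pr (ks n) (G n t)" if "n \<le> m" "t \<in> topspace ?I" for n m t
    proof -
      have "ks n \<le> ks m" using ks(1) that by (simp add: mono_def)
      then have "p (ks m) (ks n) (pr (ks m) (G m t)) = pr (ks n) (G m t)"
        using pr_comp Gin that by auto
      then show ?thesis using stable [OF that(1), of t] that(2) by simp
    qed
  qed blast
  have gin: "g t \<in> topspace ZZ" if "t \<in> {0..1}" for t
    using continuous_map_image_subset_topspace [OF g(1)] that by (simp add: image_subset_iff)
  have "G n 0 = d 0" for n
    by (induction n) (use a(2) in \<open>auto simp: G0 GS\<close>)
  then have "g 0 = d 0"
    using g(2) [of 0] by (intro sequential_eq [OF ks gin din]) auto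
  moreover have "g 1 = \<zeta>"
  proof (rule sequential_eq [OF ks gin C_top [OF \<zeta>]])
    fix n
    have "G n 1 = d n" using Gd a(3) [of n] by simp
    then show "pr (ks n) (g 1) = pr (ks n) \<zeta>" using g(2) [of 1] pd [of n n] by simp
  qed simp
  ultimately show ?thesis
    using g(1) by (auto simp: path_component_of_def pathin_def)
qed

lemma countable_phantom:
  assumes count: "K_countable TYPE('x)"
    and contr: "\<And>\<kappa>. \<kappa> \<in> KK \<Longrightarrow> \<exists>l\<in>KK. \<kappa> \<le> l \<and> (\<forall>x\<in>Fib l. \<exists>f. continuous_map (cyl pt) ZZ f \<and>
        f (0, ()) = x \<and> f (1, ()) = \<zeta> \<and> (\<forall>t\<in>{0..1}. pr \<kappa> (f (t, ())) = pr \<kappa> \<zeta>))"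
  shows "Ph Z p C = {C}"
proof (rule Ph_eqI)
  fix D assume D: "D \<in> path_components_of ZZ" "\<And>\<kappa>. \<kappa> \<in> KK \<Longrightarrow> pr \<kappa> ` D = pr \<kappa> ` C"
  obtain \<Lambda> where \<Lambda>: "\<Lambda> \<subseteq> KK" "countable \<Lambda>" "Sup \<Lambda> = (top_class.top :: 'x)"
    using count unfolding K_countable_def by blast
  \<comment> \<open>\<open>bot\<close> makes the enumerated set nonempty without changing its
    supremum.\<close>
  define b where "b = from_nat_into (insert bot \<Lambda>)"
  have b: "range b = insert bot \<Lambda>"
    unfolding b_def using \<Lambda>(2) by (intro range_from_nat_into) auto
  have bK: "b n \<in> KK" for n
    using b \<Lambda>(1) bot_compact by (metis insert_subset rangeI subsetD)
  define P where "P \<kappa> l \<longleftrightarrow> l \<in> KK \<and> \<kappa> \<le> l \<and> (\<forall>x\<in>Fib l. \<exists>f. continuous_map (cyl pt) ZZ f \<and>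
        f (0, ()) = x \<and> f (1, ()) = \<zeta> \<and> (\<forall>t\<in>{0..1}. pr \<kappa> (f (t, ())) = pr \<kappa> \<zeta>))" for \<kappa> l
  have "\<exists>ks. \<forall>n. (ks n \<in> KK \<and> b n \<le> ks n) \<and> P (ks n) (ks (Suc n))"
  proof (rule dependent_nat_choice)
    show "\<exists>x. x \<in> KK \<and> b 0 \<le> x" using bK by blast
    fix \<kappa> n assume "\<kappa> \<in> KK \<and> b n \<le> \<kappa>"
    then obtain l where l: "P \<kappa> l" using contr unfolding P_def by blast
    \<comment> \<open>Enlarging \<open>l\<close> shrinks \<open>Fib l\<close>, so the next index may
      absorb \<open>b (Suc n)\<close>; this drives the supremum of the chain to the top.\<close>
    then have "P \<kappa> (sup l (b (Suc n)))"
      using Fib_mono [of l "sup l (b (Suc n))"] sup_compact bK unfolding P_def by (meson le_supI1 subsetD sup_ge1)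
    moreover have "sup l (b (Suc n)) \<in> KK" using calculation by (simp add: P_def)
    ultimately show "\<exists>y. (y \<in> KK \<and> b (Suc n) \<le> y) \<and> P \<kappa> y" using sup_ge2 by blast
  qed
  then obtain ks where ks: "\<And>n. ks n \<in> KK" "\<And>n. b n \<le> ks n" "\<And>n. P (ks n) (ks (Suc n))" by blast
  have inc: "ks n \<le> ks (Suc n)" for n using ks(3) by (simp add: P_def)
  then have mono: "mono ks" by (simp add: mono_iff_le_Suc)
  have "Sup (insert bot \<Lambda>) \<le> Sup (range ks)"
    unfolding b [symmetric] by (rule Sup_mono) (use ks(2) in blast)
  then have top: "Sup (range ks) = top_class.top"
    using \<Lambda>(3) by (simp add: top_unique)
  have D_top: "D \<subseteq> topspace ZZ" using D(1) path_components_of_subset by blast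
  have D_path: "y \<in> D" if "x \<in> D" "path_component_of ZZ x y" for x y
    using path_components_of_eq [OF D(1) that(1)] that(2) by simp
  have move: "f (1, ()) \<in> D" if "continuous_map (cyl pt) ZZ f" "f (0, ()) \<in> D" for f
    using D_path [OF that(2) cyl_path_component [OF that(1), of "()" 0 1]] by simp
  have "D \<noteq> {}" using D(1) nonempty_path_components_of by blast
  then obtain x0 where x0: "x0 \<in> D" by blast
  \<comment> \<open>The shift by one leaves room for \<open>fibre_path_step\<close>: a point lying
    over the base point at level n + 1 moves along a path that is constant at level n and ends over
    the base point at level n + 2.\<close>
  define S where "S n d \<longleftrightarrow> d \<in> D \<and> pr (ks (Suc n)) d = pr (ks (Suc n)) \<zeta>" for n d
  define R where "R n d d' \<longleftrightarrow> (\<exists>f. continuous_map (cyl pt) ZZ f \<and> f (0, ()) = d \<and> f (1, ()) = d' \<and>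
        (\<forall>t\<in>{0..1}. pr (ks n) (f (t, ())) = pr (ks n) \<zeta>))" for n d d'
  have "\<exists>d. \<forall>n. S n (d n) \<and> R n (d n) (d (Suc n))"
  proof (rule dependent_nat_choice)
    \<comment> \<open>The phantom condition over \<open>ks 1\<close> joins the image of
      \<open>x0\<close> to the base point within the image of \<open>C\<close>; lifting that path
      from \<open>x0\<close> leads to a suitable point of \<open>D\<close>.\<close>
    show "\<exists>d. S 0 d"
    proof -
      have "pr (ks 1) x0 \<in> pr (ks 1) ` C" using D(2) [OF ks(1)] x0 by blast
      then obtain y where y: "y \<in> C" "pr (ks 1) x0 = pr (ks 1) y" by blast
      obtain f where f: "continuous_map (cyl pt) ZZ f" "f (0, ()) = y" "f (1, ()) = \<zeta>"
        using path_component_of_cylE [OF C_connected [OF y(1) \<zeta>]] .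
      have "continuous_map (cyl pt) (Z (ks 1)) (\<lambda>z. pr (ks 1) (f z))"
        using continuous_map_compose [OF f(1) pr_continuous] by (simp add: o_def)
      from path_lift [OF top_greatest this, of x0]
      obtain g where g: "continuous_map (cyl pt) ZZ g" "g (0, ()) = x0"
        "\<And>t. t \<in> {0..1} \<Longrightarrow> pr (ks 1) (g (t, ())) = pr (ks 1) (f (t, ()))"
        using f(2) y(2) x0 D_top by auto
      have "g (1, ()) \<in> D" using move [OF g(1)] g(2) x0 by simp
      then have "S 0 (g (1, ()))" using g(3) [of 1] f(3) by (simp add: S_def)
      then show ?thesis by blast
    qed
    fix d n assume S: "S n d"
    have le: "ks n \<le> ks (Suc n)" "ks (Suc n) \<le> ks (Suc (Suc n))" by (rule inc)+
    have "\<exists>f. continuous_map (cyl pt) ZZ f \<and> f (0, ()) = d \<and> pr (ks (Suc (Suc n))) (f (1, ())) = pr (ks (Suc (Suc n))) \<zeta> \<and>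
        (\<forall>t\<in>{0..1}. pr (ks n) (f (t, ())) = pr (ks n) \<zeta>)"
    proof (rule fibre_path_step [OF le])
      show "\<exists>f. continuous_map (cyl pt) ZZ f \<and> f (0, ()) = x \<and> f (1, ()) = \<zeta> \<and>
        (\<forall>t\<in>{0..1}. pr (ks n) (f (t, ())) = pr (ks n) \<zeta>)" if "x \<in> Fib (ks (Suc n))" for x
        using ks(3) [of n] that unfolding P_def by blast
      show "d \<in> topspace ZZ" using S D_top by (auto simp: S_def)
      show "pr (ks (Suc n)) d = pr (ks (Suc n)) \<zeta>" using S by (simp add: S_def)
      have "d \<in> D" using S by (simp add: S_def)
      then show "pr (ks (Suc (Suc n))) d \<in> pr (ks (Suc (Suc n))) ` C"
        unfolding D(2) [OF ks(1), symmetric] by (rule imageI)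
    qed
    then obtain f where f: "continuous_map (cyl pt) ZZ f" "f (0, ()) = d"
      "pr (ks (Suc (Suc n))) (f (1, ())) = pr (ks (Suc (Suc n))) \<zeta>"
      "\<forall>t\<in>{0..1}. pr (ks n) (f (t, ())) = pr (ks n) \<zeta>" by blast
    have "f (1, ()) \<in> D" using move [OF f(1)] f(2) S by (simp add: S_def)
    then have "S (Suc n) (f (1, ()))" using f(3) by (simp add: S_def)
    moreover have "R n d (f (1, ()))" using f unfolding R_def by blast
    ultimately show "\<exists>y. S (Suc n) y \<and> R n d y" by blast
  qed
  then obtain d where d: "\<And>n. S n (d n)" "\<And>n. R n (d n) (d (Suc n))" by blast
  obtain \<sigma> where \<sigma>: "\<And>n. continuous_map (cyl pt) ZZ (\<sigma> n) \<and> \<sigma> n (0, ()) = d n \<and> \<sigma> n (1, ()) = d (Suc n) \<and>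
        (\<forall>t\<in>{0..1}. pr (ks n) (\<sigma> n (t, ())) = pr (ks n) \<zeta>)"
    using d(2) unfolding R_def by metis
  have "path_component_of ZZ (d 0) \<zeta>"
    by (rule infinite_concatenation [OF mono top, of \<sigma>]) (use \<sigma> in auto)
  moreover have "d 0 \<in> D" using d(1) by (simp add: S_def)
  ultimately show "\<exists>x\<in>D. x \<in> C" using D_path \<zeta> by blast
qed

section \<open>Homotopy groups\<close>

lemma p_CT_continuous: "l \<le> m \<Longrightarrow> continuous_map (CT m) (CT l) (p m l)"
  using p_continuous [of l m] pr_comp [of l m] C_top
  by (auto simp: continuous_map_in_subtopology continuous_map_from_subtopology)

lemma pr_CT_continuous: "continuous_map (subtopology ZZ C) (CT l) (pr l)"
  using pr_continuous [of l] by (auto simp: continuous_map_in_subtopology continuous_map_from_subtopology)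

lemma topspace_CT: "topspace (CT l) = pr l ` C"
  using p_in [of l "top_class.top"] C_top by auto

lemma homotopy_group_system:
  assumes k: "1 \<le> k" and I: "directed_set I"
  shows "inverse_system_of_groups I (\<lambda>l. homotopy_group k (CT l) (pr l \<zeta>))
     (\<lambda>m l. homotopy_hom k (CT l) (pr l \<zeta>) (p m l))"
  unfolding inverse_system_of_groups_def
proof (intro conjI ballI impI)
  have base: "p m l (pr m \<zeta>) = pr l \<zeta>" if "l \<le> m" for l m
    using pr_comp [OF that C_top [OF \<zeta>]] .
  show "group (homotopy_group k (CT i) (pr i \<zeta>))" for i
    using \<zeta> by (intro group_homotopy_group k) (simp add: topspace_CT del: topspace_subtopology)
  show "homotopy_hom k (CT i) (pr i \<zeta>) (p j i) \<in> hom (homotopy_group k (CT j) (pr j \<zeta>)) (homotopy_group k (CT i) (pr i \<zeta>))"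
    if "i \<le> j" for i j
    by (rule homotopy_hom [OF k p_CT_continuous [OF that] base [OF that]])
  show "homotopy_hom k (CT i) (pr i \<zeta>) (p i i) A = A" if "A \<in> carrier (homotopy_group k (CT i) (pr i \<zeta>))" for i A
    by (rule homotopy_hom_id [OF that]) (use p_refl base in auto)
  show "homotopy_hom k (CT i) (pr i \<zeta>) (p j i) (homotopy_hom k (CT j) (pr j \<zeta>) (p l j) A) =
        homotopy_hom k (CT i) (pr i \<zeta>) (p l i) A"
    if "i \<le> j" "j \<le> l" "A \<in> carrier (homotopy_group k (CT l) (pr l \<zeta>))" for i j l A
    using that order_trans [OF that(1,2)] p_comp [OF that(1,2)]
    by (intro homotopy_hom_compose [OF that(3)] p_CT_continuous base) auto
qed (rule I)

text \<open>One inclusion is \<open>spheroid_lift\<close>; the other holds because the projection of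
  \<open>C\<close> to level \<kappa> factors through level \<open>m\<close>.\<close>

lemma homotopy_group_image:
  assumes k: "1 \<le> k" and l: "\<kappa> \<le> l" "l \<le> m"
    and c: "continuous_map (cyl (subtopology ZZ (Fib l))) ZZ c"
      "\<And>x. x \<in> Fib l \<Longrightarrow> c (0, x) = x" "\<And>x. x \<in> Fib l \<Longrightarrow> c (1, x) = \<zeta>"
      "\<And>x t. x \<in> Fib l \<Longrightarrow> t \<in> {0..1} \<Longrightarrow> c (t, x) \<in> Fib \<kappa>"
  shows "homotopy_hom k (CT \<kappa>) (pr \<kappa> \<zeta>) (p m \<kappa>) ` carrier (homotopy_group k (CT m) (pr m \<zeta>)) =
    homotopy_hom k (CT \<kappa>) (pr \<kappa> \<zeta>) (pr \<kappa>) ` carrier (homotopy_group k (subtopology ZZ C) \<zeta>)"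
    (is "?h ` ?M = ?q ` ?C")
proof
  have \<kappa>m: "\<kappa> \<le> m" using l by simp
  have base: "p m \<kappa> (pr m \<zeta>) = pr \<kappa> \<zeta>"
    using pr_comp [OF \<kappa>m C_top [OF \<zeta>]] .
  show "?h ` ?M \<subseteq> ?q ` ?C"
  proof
    fix B assume "B \<in> ?h ` ?M"
    then obtain f where f: "spheroid k (CT m) (pr m \<zeta>) f" "B = ?h (spheroid_class k (CT m) (pr m \<zeta>) f)"
      by (auto simp: homotopy_group_def)
    obtain g where g: "spheroid k (subtopology ZZ C) \<zeta> g"
      "spheroid_homotopic k (CT \<kappa>) (pr \<kappa> \<zeta>) (p m \<kappa> \<circ> f) (pr \<kappa> \<circ> g)"
      using spheroid_lift [OF l(1) c k l(2) f(1)] .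
    have "B = spheroid_class k (CT \<kappa>) (pr \<kappa> \<zeta>) (p m \<kappa> \<circ> f)"
      unfolding f(2) by (rule homotopy_hom_class [OF f(1) p_CT_continuous [OF \<kappa>m] base])
    also have "\<dots> = spheroid_class k (CT \<kappa>) (pr \<kappa> \<zeta>) (pr \<kappa> \<circ> g)"
      by (rule spheroid_class_eq [OF g(2)])
    also have "\<dots> = ?q (spheroid_class k (subtopology ZZ C) \<zeta> g)"
      by (rule homotopy_hom_class [OF g(1) pr_CT_continuous refl, symmetric])
    finally show "B \<in> ?q ` ?C"
      using g(1) by (auto simp: homotopy_group_def)
  qed
  show "?q ` ?C \<subseteq> ?h ` ?M"
  proof
    fix B assume "B \<in> ?q ` ?C"
    then obtain A where A: "A \<in> ?C" "B = ?q A" by blast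
    have "homotopy_hom k (CT m) (pr m \<zeta>) (pr m) A \<in> ?M"
      using homotopy_hom [OF k pr_CT_continuous refl] A(1) unfolding hom_def by blast
    moreover have "?h (homotopy_hom k (CT m) (pr m \<zeta>) (pr m) A) = ?q A"
      by (rule homotopy_hom_compose [OF A(1) pr_CT_continuous refl p_CT_continuous [OF \<kappa>m] base pr_CT_continuous refl])
         (use pr_comp [OF \<kappa>m] in auto)
    ultimately show "B \<in> ?h ` ?M" using A(2) by (metis imageI)
  qed
qed

lemma homotopy_group_injective:
  assumes k: "1 \<le> k" and l: "\<kappa> \<le> l" "l \<le> m"
    and c: "continuous_map (cyl (subtopology ZZ (Fib l))) ZZ c"
      "\<And>x. x \<in> Fib l \<Longrightarrow> c (0, x) = x" "\<And>x. x \<in> Fib l \<Longrightarrow> c (1, x) = \<zeta>"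
      "\<And>x t. x \<in> Fib l \<Longrightarrow> t \<in> {0..1} \<Longrightarrow> c (t, x) \<in> Fib \<kappa>"
  shows "inj_on (homotopy_hom k (CT m) (pr m \<zeta>) (pr m)) (carrier (homotopy_group k (subtopology ZZ C) \<zeta>))"
proof -
  let ?C = "subtopology ZZ C"
  have \<zeta>C: "\<zeta> \<in> topspace ?C" "pr m \<zeta> \<in> topspace (CT m)"
    using \<zeta> C_top unfolding topspace_CT by auto
  have groups: "group (homotopy_group k ?C \<zeta>)" "group (homotopy_group k (CT m) (pr m \<zeta>))"
    by (intro group_homotopy_group k \<zeta>C)+
  show ?thesis
  proof (subst inj_on_one_iff' [OF homotopy_hom [OF k pr_CT_continuous refl] groups], intro allI impI)
    fix A assume "A \<in> carrier (homotopy_group k ?C \<zeta>)"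
      and one: "homotopy_hom k (CT m) (pr m \<zeta>) (pr m) A = \<one>\<^bsub>homotopy_group k (CT m) (pr m \<zeta>)\<^esub>"
    then obtain f where f: "spheroid k ?C \<zeta> f" "A = spheroid_class k ?C \<zeta> f"
      by (auto elim: homotopy_group_carrierE)
    have "spheroid_class k (CT m) (pr m \<zeta>) (pr m \<circ> f) = spheroid_class k (CT m) (pr m \<zeta>) (\<lambda>_. pr m \<zeta>)"
      using one homotopy_hom_class [OF f(1) pr_CT_continuous refl, of m] by (simp add: f(2) homotopy_group_def)
    then have "spheroid_homotopic k (CT m) (pr m \<zeta>) (pr m \<circ> f) (\<lambda>_. pr m \<zeta>)"
      using spheroid_class_eq_iff [OF spheroid_const [OF \<zeta>C(2)]] by blast
    from spheroid_injective [OF l(1) c l(2) f(1) this]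
    have "spheroid_homotopic k ?C \<zeta> f (\<lambda>_. \<zeta>)" .
    from spheroid_class_eq [OF this]
    show "A = \<one>\<^bsub>homotopy_group k ?C \<zeta>\<^esub>"
      by (simp add: f(2) homotopy_group_def)
  qed
qed

end

theorem theorem1p4p4:
  fixes \<alpha> :: "'x::complete_lattice"
    and Z :: "'x \<Rightarrow> 'a topology"
    and p :: "'x \<Rightarrow> 'x \<Rightarrow> 'a \<Rightarrow> 'a"
    and C :: "'a set" and \<zeta> :: 'a
    and C' :: "'x \<Rightarrow> 'a set" and \<zeta>' :: "'x \<Rightarrow> 'a"
    and \<pi> :: "nat \<Rightarrow> 'x \<Rightarrow> ((nat \<Rightarrow> real) \<Rightarrow> 'a) set monoid"
    and \<pi>map :: "nat \<Rightarrow> 'x \<Rightarrow> 'x \<Rightarrow> ((nat \<Rightarrow> real) \<Rightarrow> 'a) set \<Rightarrow> ((nat \<Rightarrow> real) \<Rightarrow> 'a) set"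
  assumes "regular_lattice TYPE('x)"
    and "\<alpha> = top_class.top"
    and "\<alpha> \<notin> compact_elements"
    and "system_of_fibrations Z p"
    and "restricted_system Z p"
    and "\<forall>\<kappa>\<in>compact_elements. has_CW_homotopy_type TYPE('w) (Z \<kappa>)"
    and "C \<in> path_components_of (Z \<alpha>)"
    and "\<zeta> \<in> C"
    and "has_CW_homotopy_type TYPE('v) (subtopology (Z \<alpha>) C)"
    and C'_eq: "\<And>l. C' l = p \<alpha> l ` C"
    and \<zeta>'_eq: "\<And>l. \<zeta>' l = p \<alpha> l \<zeta>"
    and \<pi>_eq: "\<And>k l. \<pi> k l = homotopy_group k (subtopology (Z l) (C' l)) (\<zeta>' l)"
    and \<pi>map_eq: "\<And>k m l. \<pi>map k m l = homotopy_hom k (subtopology (Z l) (C' l)) (\<zeta>' l) (p m l)"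
  shows "(\<forall>\<kappa>\<in>compact_elements. \<exists>l\<in>compact_elements. \<kappa> \<le> l \<and>
            (\<forall>k\<ge>1. \<forall>m\<ge>l. \<pi>map k m \<kappa> ` carrier (\<pi> k m) =
               \<pi>map k \<alpha> \<kappa> ` carrier (homotopy_group k (subtopology (Z \<alpha>) C) \<zeta>))) \<and>
         (\<exists>\<kappa>\<^sub>0\<in>compact_elements. \<forall>\<kappa>\<in>compact_elements. \<kappa>\<^sub>0 \<le> \<kappa> \<longrightarrow>
            (\<forall>k\<ge>1. inj_on (\<pi>map k \<alpha> \<kappa>)
               (carrier (homotopy_group k (subtopology (Z \<alpha>) C) \<zeta>)))) \<and>
         uniformly_Mittag_Leffler {1..} compact_elements \<pi> \<pi>map \<and>
         (openin (Z \<alpha>) C \<longrightarrow>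
            (\<exists>\<kappa>\<^sub>0\<in>compact_elements. \<forall>\<kappa>\<in>compact_elements. \<kappa>\<^sub>0 \<le> \<kappa> \<longrightarrow>
               {z \<in> topspace (Z \<alpha>). p \<alpha> \<kappa> z \<in> C' \<kappa>} = C) \<and>
            Ph Z p C = {C}) \<and>
         (K_countable TYPE('x) \<longrightarrow> Ph Z p C = {C})"
proof -
  note \<alpha> = \<open>\<alpha> = top_class.top\<close>
  interpret restricted_fibrations Z p C \<zeta>
    using assms(1,4,5,7,8) unfolding \<alpha> by unfold_locales
  have \<pi>: "\<pi> k = (\<lambda>l. homotopy_group k (CT l) (pr l \<zeta>))" for k
    by (rule ext) (simp add: \<pi>_eq C'_eq \<zeta>'_eq \<alpha>)
  have \<pi>map: "\<pi>map k = (\<lambda>m l. homotopy_hom k (CT l) (pr l \<zeta>) (p m l))" for k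
    by (intro ext) (simp add: \<pi>map_eq C'_eq \<zeta>'_eq \<alpha>)
  have eC: "equiconnected_near (subtopology ZZ C) {\<zeta>}"
    using CW_homotopy_type_equiconnected_near [OF assms(9) [unfolded \<alpha>], of "{\<zeta>}"] C_top \<zeta> by simp
  have contr: "\<exists>l c. l \<in> KK \<and> \<kappa> \<le> l \<and> continuous_map (cyl (subtopology ZZ (Fib l))) ZZ c \<and>
      (\<forall>x\<in>Fib l. c (0, x) = x \<and> c (1, x) = \<zeta> \<and> (\<forall>t\<in>{0..1}. c (t, x) \<in> Fib \<kappa>))" if \<kappa>: "\<kappa> \<in> KK" for \<kappa>
  proof -
    have "has_CW_homotopy_type TYPE('w) (Z \<kappa>)" using assms(6) \<kappa> by blast
    then have "equiconnected_near (Z \<kappa>) L" if "compactin (Z \<kappa>) L" for L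
      using CW_homotopy_type_equiconnected_near that by blast
    then show ?thesis
      by (rule fibre_contraction [OF \<kappa> eC]) blast+
  qed
  have images: "\<exists>l\<in>KK. \<kappa> \<le> l \<and> (\<forall>k\<ge>1. \<forall>m\<ge>l. \<pi>map k m \<kappa> ` carrier (\<pi> k m) =
      \<pi>map k top_class.top \<kappa> ` carrier (homotopy_group k (subtopology ZZ C) \<zeta>))" if \<kappa>: "\<kappa> \<in> KK" for \<kappa>
  proof -
    obtain l c where lc: "l \<in> KK" "\<kappa> \<le> l" "continuous_map (cyl (subtopology ZZ (Fib l))) ZZ c"
      "\<forall>x\<in>Fib l. c (0, x) = x \<and> c (1, x) = \<zeta> \<and> (\<forall>t\<in>{0..1}. c (t, x) \<in> Fib \<kappa>)"
      using contr [OF \<kappa>] by blast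
    have "\<pi>map k m \<kappa> ` carrier (\<pi> k m) = \<pi>map k top_class.top \<kappa> ` carrier (homotopy_group k (subtopology ZZ C) \<zeta>)"
      if "1 \<le> k" "l \<le> m" for k m
      unfolding \<pi> \<pi>map by (rule homotopy_group_image [OF that(1) lc(2) that(2) lc(3)]) (use lc(4) in auto)
    then show ?thesis using lc(1,2) by blast
  qed
  have inj: "\<exists>\<kappa>\<^sub>0\<in>KK. \<forall>\<kappa>\<in>KK. \<kappa>\<^sub>0 \<le> \<kappa> \<longrightarrow> (\<forall>k\<ge>1. inj_on (\<pi>map k top_class.top \<kappa>)
      (carrier (homotopy_group k (subtopology ZZ C) \<zeta>)))"
  proof -
    \<comment> \<open>Injectivity asks only for a contraction of \<open>Fib l\<close> inside
      \<open>C\<close>. The contraction may therefore run in the fibre over the least index, and a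
      single \<open>l\<close> serves all \<kappa> above it.\<close>
    obtain l c where lc: "l \<in> KK" "bot \<le> l" "continuous_map (cyl (subtopology ZZ (Fib l))) ZZ c"
      "\<forall>x\<in>Fib l. c (0, x) = x \<and> c (1, x) = \<zeta> \<and> (\<forall>t\<in>{0..1}. c (t, x) \<in> Fib bot)"
      using contr [OF bot_compact] by blast
    have "inj_on (\<pi>map k top_class.top \<kappa>) (carrier (homotopy_group k (subtopology ZZ C) \<zeta>))"
      if "1 \<le> k" "l \<le> \<kappa>" for k \<kappa>
      unfolding \<pi>map by (rule homotopy_group_injective [OF that(1) lc(2) that(2) lc(3)]) (use lc(4) in auto)
    then show ?thesis using lc(1) by blast
  qed
  have mittag: "uniformly_Mittag_Leffler {1..} KK \<pi> \<pi>map"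
    unfolding uniformly_Mittag_Leffler_def
  proof (intro conjI ballI)
    show "inverse_system_of_groups KK (\<pi> k) (\<pi>map k)" if "k \<in> {1..}" for k
      unfolding \<pi> \<pi>map using that by (intro homotopy_group_system directed_compact) auto
    \<comment> \<open>From \<open>l\<close> on, all images coincide with the image of the groups of
      \<open>C\<close>, and \<open>l\<close> was found independently of \<open>k\<close>.\<close>
    fix \<kappa> :: 'x assume "\<kappa> \<in> KK"
    then obtain l where "l \<in> KK" "\<kappa> \<le> l" "\<forall>k\<ge>1. \<forall>m\<ge>l. \<pi>map k m \<kappa> ` carrier (\<pi> k m) =
      \<pi>map k top_class.top \<kappa> ` carrier (homotopy_group k (subtopology ZZ C) \<zeta>)"
      using images by blast
    then show "\<exists>j\<in>KK. \<kappa> \<le> j \<and> (\<forall>k\<in>{1..}. \<forall>l\<in>KK. j \<le> l \<longrightarrow>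
        \<pi>map k l \<kappa> ` carrier (\<pi> k l) = \<pi>map k j \<kappa> ` carrier (\<pi> k j))"
      by (intro bexI [of _ l]) auto
  qed
  have opn: "(\<exists>\<kappa>\<^sub>0\<in>KK. \<forall>\<kappa>\<in>KK. \<kappa>\<^sub>0 \<le> \<kappa> \<longrightarrow> {z \<in> topspace ZZ. pr \<kappa> z \<in> C' \<kappa>} = C) \<and> Ph Z p C = {C}"
    if oC: "openin ZZ C"
  proof -
    obtain \<kappa>\<^sub>0 where \<kappa>\<^sub>0: "\<kappa>\<^sub>0 \<in> KK" "\<And>\<kappa>. \<kappa>\<^sub>0 \<le> \<kappa> \<Longrightarrow> {z \<in> topspace ZZ. pr \<kappa> z \<in> pr \<kappa> ` C} = C"
      using open_component [OF oC] by blast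
    have "Ph Z p C = {C}"
    proof (rule Ph_eqI)
      fix D assume D: "D \<in> path_components_of ZZ" "\<And>\<kappa>. \<kappa> \<in> KK \<Longrightarrow> pr \<kappa> ` D = pr \<kappa> ` C"
      have "D \<noteq> {}" using D(1) nonempty_path_components_of by blast
      then obtain x where x: "x \<in> D" by blast
      then have "x \<in> topspace ZZ" "pr \<kappa>\<^sub>0 x \<in> pr \<kappa>\<^sub>0 ` C"
        using D(2) [OF \<kappa>\<^sub>0(1)] path_components_of_subset [OF D(1)] by blast+
      then have "x \<in> C" using \<kappa>\<^sub>0(2) [OF order_refl] by blast
      then show "\<exists>x\<in>D. x \<in> C" using x by blast
    qed
    then show ?thesis using \<kappa>\<^sub>0 unfolding C'_eq \<alpha> by blast
  qed
  have count: "Ph Z p C = {C}" if "K_countable TYPE('x)"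
  proof (rule countable_phantom [OF that])
    fix \<kappa> :: 'x assume "\<kappa> \<in> KK"
    then obtain l c where lc: "l \<in> KK" "\<kappa> \<le> l" "continuous_map (cyl (subtopology ZZ (Fib l))) ZZ c"
      "\<forall>x\<in>Fib l. c (0, x) = x \<and> c (1, x) = \<zeta> \<and> (\<forall>t\<in>{0..1}. c (t, x) \<in> Fib \<kappa>)"
      using contr by blast
    have "continuous_map (cyl pt) ZZ (\<lambda>z. c (fst z, x))" if "x \<in> Fib l" for x
      using that topspace_Fib by (intro continuous_map_cyl_compose [OF lc(3)] continuous_map_fst_cyl) auto
    then have "\<exists>f. continuous_map (cyl pt) ZZ f \<and> f (0, ()) = x \<and> f (1, ()) = \<zeta> \<and>
        (\<forall>t\<in>{0..1}. pr \<kappa> (f (t, ())) = pr \<kappa> \<zeta>)" if "x \<in> Fib l" for x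
      using lc(4) that by (intro exI [of _ "\<lambda>z. c (fst z, x)"]) (auto simp: Fib_def)
    then show "\<exists>l\<in>KK. \<kappa> \<le> l \<and> (\<forall>x\<in>Fib l. \<exists>f. continuous_map (cyl pt) ZZ f \<and>
        f (0, ()) = x \<and> f (1, ()) = \<zeta> \<and> (\<forall>t\<in>{0..1}. pr \<kappa> (f (t, ())) = pr \<kappa> \<zeta>))"
      using lc(1,2) by blast
  qed
  show ?thesis
    unfolding \<alpha>
    by (intro conjI impI ballI)
       (rule inj mittag | rule images opn [THEN conjunct1] opn [THEN conjunct2] count, assumption)+
qed

end
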